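(* Let $\mathcal C$ be a braided monoidal category with braiding $\Phi$, let $H\in\mathcal C$ be a finite Hopf algebra with bijective antipode, and assume that $\Phi_{H,H^*}$ is symmetric, i.e. $\Phi_{H,H^*}=\Phi_{H^*,H}^{-1}$. Let $D(H)=(H^{op})^*\bowtie H$ be the Drinfel'd double. The following are equivalent: (i) $D(H)$ is commutative; (ii) $H$ and $H^*$ are commutative; (iii) $H$ and $H^*$ are cocommutative; (iv) $D(H)$ is cocommutative.
   Context: $\mathcal C$ is taken strict; an object name also denotes its identity morphism and composition is written by juxtaposition. $H$ has multiplication $\nabla$, unit $\eta$, comultiplication $\Delta$, counit $\varepsilon$, antipode $S$. An algebra $A$ is commutative if $\nabla_A\Phi_{A,A}=\nabla_A$; a coalgebra $C$ is cocommutative if $\Phi_{C,C}\Delta_C=\Delta_C$. $H$ is finite if $[H,I]$, $[H,H]$ exist and the dual basis morphism $H\otimes[H,I]\to[H,H]$ is an isomorphism; then $H^*=[H,I]$ is a left dual of $H$ with evaluation $ev:H^*\otimes H\to I$. Put $\overline{ev}=ev\,\Phi_{H,H^*}:H\otimes H^*\to I$. Symmetricity of $\Phi_{H,H^*}$ is known to be equivalent to $\Phi_{H,H}=\Phi_{H,H}^{-1}$. $H^*$ is a Hopf algebra with multiplication given by $ev(\nabla_{H^*}\otimes H)=(ev\otimes ev)(H^*\otimes\Phi_{H^*,H}\otimes H)(H^*\otimes H^*\otimes\Delta)$, comultiplication given by $(ev\otimes ev)(H^*\otimes\Phi_{H^*,H}\otimes H)(\Delta_{H^*}\otimes H\otimes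 H)=ev(H^*\otimes\nabla)$, unit given by $ev(\eta_{H^*}\otimes H)=\varepsilon$, counit $ev(H^*\otimes\eta)$. $H^{op}$ is $H$ with multiplication $\nabla\Phi_{H,H}$, and $B=(H^{op})^*$ is the object $H^*$ with the same formulas, $\nabla$ replaced by $\nabla\Phi_{H,H}$ in the one for the comultiplication. Define $\triangleright:H\otimes B\to B$ by $\overline{ev}(H\otimes\triangleright)=\overline{ev}\big(\nabla\Phi_{H,H}(\nabla\otimes S^{-1})(H\otimes\Delta)\otimes B\big)$ and $\triangleleft:H\otimes B\to H$ by $\triangleleft=(H\otimes\overline{ev})(H\otimes\nabla\Phi_{H,H}\otimes B)(\Phi_{H,H}^{-1}\otimes S^{-1}\otimes B)((\Delta\otimes H)\Delta\otimes B)$. Then $D(H)=B\bowtie H$ is the object $B\otimes H$ with unit $\eta_B\otimes\eta$, counit $\varepsilon_B\otimes\varepsilon$, comultiplication $(B\otimes\Phi_{B,H}\otimes H)(\Delta_B\otimes\Delta)$ and multiplication $(\nabla_B\otimes\nabla)(B\otimes\triangleright\otimes\triangleleft\otimes H)(B\otimes H\otimes\Phi_{H,B}\otimes B\otimes H)(B\otimes\Delta\otimes\Delta_B\otimes H)$; it is a Hopf algebra in $\mathcal C$. *)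

theory Defs
  imports Main
begin

section \<open>Strict braided monoidal categories\<close>

record ('o, 'm) braided_cat =
  Obj :: "'o set"
  Arr :: "'m set"
  Dom :: "'m \<Rightarrow> 'o"
  Cod :: "'m \<Rightarrow> 'o"
  Id :: "'o \<Rightarrow> 'm"
  Comp :: "'m \<Rightarrow> 'm \<Rightarrow> 'm"  (infixr "\<cdot>\<index>" 55)
  ObTensor :: "'o \<Rightarrow> 'o \<Rightarrow> 'o"  (infixr "\<boxtimes>\<index>" 70)
  UnitOb :: "'o"
  Tensor :: "'m \<Rightarrow> 'm \<Rightarrow> 'm"  (infixr "\<otimes>\<index>" 70)
  Braid :: "'o \<Rightarrow> 'o \<Rightarrow> 'm"

text \<open>
  Composition is in applicative order and binds weaker than the tensor product.
  Operations are only meaningful on \<open>Obj\<close> and \<open>Arr\<close> (and on composable arrows).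
\<close>

definition Hom :: "('o, 'm, 'r) braided_cat_scheme \<Rightarrow> 'o \<Rightarrow> 'o \<Rightarrow> 'm set" where
  "Hom C A B = {f \<in> Arr C. Dom C f = A \<and> Cod C f = B}"

locale category =
  fixes C :: "('o, 'm, 'r) braided_cat_scheme" (structure)
  assumes Dom_Obj: "f \<in> Arr C \<Longrightarrow> Dom C f \<in> Obj C"
    and Cod_Obj: "f \<in> Arr C \<Longrightarrow> Cod C f \<in> Obj C"
    and Id_Hom: "A \<in> Obj C \<Longrightarrow> Id C A \<in> Hom C A A"
    and Comp_Hom: "\<lbrakk>f \<in> Hom C A B; g \<in> Hom C B D\<rbrakk> \<Longrightarrow> g \<cdot> f \<in> Hom C A D"
    and Id_left: "f \<in> Hom C A B \<Longrightarrow> Id C B \<cdot> f = f"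
    and Id_right: "f \<in> Hom C A B \<Longrightarrow> f \<cdot> Id C A = f"
    and Comp_assoc: "\<lbrakk>f \<in> Hom C A B; g \<in> Hom C B D; h \<in> Hom C D E\<rbrakk>
      \<Longrightarrow> (h \<cdot> g) \<cdot> f = h \<cdot> (g \<cdot> f)"

locale strict_monoidal_category = category +
  assumes UnitOb_Obj: "UnitOb C \<in> Obj C"
    and ObTensor_Obj: "\<lbrakk>A \<in> Obj C; B \<in> Obj C\<rbrakk> \<Longrightarrow> A \<boxtimes> B \<in> Obj C"
    and ObTensor_assoc: "\<lbrakk>A \<in> Obj C; B \<in> Obj C; D \<in> Obj C\<rbrakk>
      \<Longrightarrow> (A \<boxtimes> B) \<boxtimes> D = A \<boxtimes> (B \<boxtimes> D)"
    and ObTensor_unit_left: "A \<in> Obj C \<Longrightarrow> UnitOb C \<boxtimes> A = A"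
    and ObTensor_unit_right: "A \<in> Obj C \<Longrightarrow> A \<boxtimes> UnitOb C = A"
    and Tensor_Hom: "\<lbrakk>f \<in> Hom C A B; g \<in> Hom C A' B'\<rbrakk>
      \<Longrightarrow> f \<otimes> g \<in> Hom C (A \<boxtimes> A') (B \<boxtimes> B')"
    and Tensor_Id: "\<lbrakk>A \<in> Obj C; B \<in> Obj C\<rbrakk> \<Longrightarrow> Id C A \<otimes> Id C B = Id C (A \<boxtimes> B)"
    and Tensor_Comp: "\<lbrakk>f \<in> Hom C A B; g \<in> Hom C B D; f' \<in> Hom C A' B'; g' \<in> Hom C B' D'\<rbrakk>
      \<Longrightarrow> (g \<cdot> f) \<otimes> (g' \<cdot> f') = (g \<otimes> g') \<cdot> (f \<otimes> f')"
    and Tensor_assoc: "\<lbrakk>f \<in> Arr C; g \<in> Arr C; h \<in> Arr C\<rbrakk>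
      \<Longrightarrow> (f \<otimes> g) \<otimes> h = f \<otimes> (g \<otimes> h)"
    and Tensor_unit_left: "f \<in> Arr C \<Longrightarrow> Id C (UnitOb C) \<otimes> f = f"
    and Tensor_unit_right: "f \<in> Arr C \<Longrightarrow> f \<otimes> Id C (UnitOb C) = f"

definition is_inverse :: "('o, 'm, 'r) braided_cat_scheme \<Rightarrow> 'm \<Rightarrow> 'm \<Rightarrow> bool" where
  "is_inverse C f g \<longleftrightarrow> f \<in> Arr C \<and> g \<in> Hom C (Cod C f) (Dom C f)
     \<and> g \<cdot> f = Id C (Dom C f) \<and> f \<cdot> g = Id C (Cod C f)" for C (structure)

definition is_iso :: "('o, 'm, 'r) braided_cat_scheme \<Rightarrow> 'm \<Rightarrow> bool" where
  "is_iso C f \<longleftrightarrow> (\<exists>g. is_inverse C f g)"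

definition inverse_of :: "('o, 'm, 'r) braided_cat_scheme \<Rightarrow> 'm \<Rightarrow> 'm" where
  "inverse_of C f = (THE g. is_inverse C f g)"

locale braided_monoidal_category = strict_monoidal_category +
  assumes Braid_Hom: "\<lbrakk>A \<in> Obj C; B \<in> Obj C\<rbrakk> \<Longrightarrow> Braid C A B \<in> Hom C (A \<boxtimes> B) (B \<boxtimes> A)"
    and Braid_iso: "\<lbrakk>A \<in> Obj C; B \<in> Obj C\<rbrakk> \<Longrightarrow> is_iso C (Braid C A B)"
    and Braid_natural: "\<lbrakk>f \<in> Hom C A A'; g \<in> Hom C B B'\<rbrakk>
      \<Longrightarrow> Braid C A' B' \<cdot> f \<otimes> g = g \<otimes> f \<cdot> Braid C A B"
    and Braid_tensor_left: "\<lbrakk>A \<in> Obj C; B \<in> Obj C; D \<in> Obj C\<rbrakk>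
      \<Longrightarrow> Braid C (A \<boxtimes> B) D = Braid C A D \<otimes> Id C B \<cdot> Id C A \<otimes> Braid C B D"
    and Braid_tensor_right: "\<lbrakk>A \<in> Obj C; B \<in> Obj C; D \<in> Obj C\<rbrakk>
      \<Longrightarrow> Braid C A (B \<boxtimes> D) = Id C B \<otimes> Braid C A D \<cdot> Braid C A B \<otimes> Id C D"

definition braid_symmetric :: "('o, 'm, 'r) braided_cat_scheme \<Rightarrow> 'o \<Rightarrow> 'o \<Rightarrow> bool" where
  "braid_symmetric C A B \<longleftrightarrow> Braid C A B = inverse_of C (Braid C B A)"


section \<open>Hopf algebras in a braided monoidal category\<close>

record ('o, 'm) bialg =
  ob :: "'o"
  mult :: "'m"
  unt :: "'m"
  comult :: "'m"
  counit :: "'m"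

record ('o, 'm) hopf = "('o, 'm) bialg" +
  antipode :: "'m"

definition is_algebra ::
  "('o, 'm, 'r) braided_cat_scheme \<Rightarrow> ('o, 'm, 's) bialg_scheme \<Rightarrow> bool" where
  "is_algebra C A \<longleftrightarrow> ob A \<in> Obj C
     \<and> mult A \<in> Hom C (ob A \<boxtimes> ob A) (ob A) \<and> unt A \<in> Hom C (UnitOb C) (ob A)
     \<and> mult A \<cdot> mult A \<otimes> Id C (ob A) = mult A \<cdot> Id C (ob A) \<otimes> mult A
     \<and> mult A \<cdot> unt A \<otimes> Id C (ob A) = Id C (ob A)
     \<and> mult A \<cdot> Id C (ob A) \<otimes> unt A = Id C (ob A)" for C (structure)

definition is_coalgebra ::
  "('o, 'm, 'r) braided_cat_scheme \<Rightarrow> ('o, 'm, 's) bialg_scheme \<Rightarrow> bool" where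
  "is_coalgebra C A \<longleftrightarrow> ob A \<in> Obj C
     \<and> comult A \<in> Hom C (ob A) (ob A \<boxtimes> ob A) \<and> counit A \<in> Hom C (ob A) (UnitOb C)
     \<and> comult A \<otimes> Id C (ob A) \<cdot> comult A = Id C (ob A) \<otimes> comult A \<cdot> comult A
     \<and> counit A \<otimes> Id C (ob A) \<cdot> comult A = Id C (ob A)
     \<and> Id C (ob A) \<otimes> counit A \<cdot> comult A = Id C (ob A)" for C (structure)

definition is_bialgebra ::
  "('o, 'm, 'r) braided_cat_scheme \<Rightarrow> ('o, 'm, 's) bialg_scheme \<Rightarrow> bool" where
  "is_bialgebra C A \<longleftrightarrow> is_algebra C A \<and> is_coalgebra C A
     \<and> comult A \<cdot> mult A =
         mult A \<otimes> mult A \<cdot> Id C (ob A) \<otimes> Braid C (ob A) (ob A) \<otimes> Id C (ob A)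
           \<cdot> comult A \<otimes> comult A
     \<and> comult A \<cdot> unt A = unt A \<otimes> unt A
     \<and> counit A \<cdot> mult A = counit A \<otimes> counit A
     \<and> counit A \<cdot> unt A = Id C (UnitOb C)" for C (structure)

definition is_hopf_algebra ::
  "('o, 'm, 'r) braided_cat_scheme \<Rightarrow> ('o, 'm, 's) hopf_scheme \<Rightarrow> bool" where
  "is_hopf_algebra C H \<longleftrightarrow> is_bialgebra C H
     \<and> antipode H \<in> Hom C (ob H) (ob H)
     \<and> mult H \<cdot> antipode H \<otimes> Id C (ob H) \<cdot> comult H = unt H \<cdot> counit H
     \<and> mult H \<cdot> Id C (ob H) \<otimes> antipode H \<cdot> comult H = unt H \<cdot> counit H" for C (structure)

definition is_commutative ::
  "('o, 'm, 'r) braided_cat_scheme \<Rightarrow> ('o, 'm, 's) bialg_scheme \<Rightarrow> bool" where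
  "is_commutative C A \<longleftrightarrow> mult A \<cdot> Braid C (ob A) (ob A) = mult A" for C (structure)

definition is_cocommutative ::
  "('o, 'm, 'r) braided_cat_scheme \<Rightarrow> ('o, 'm, 's) bialg_scheme \<Rightarrow> bool" where
  "is_cocommutative C A \<longleftrightarrow> Braid C (ob A) (ob A) \<cdot> comult A = comult A" for C (structure)


section \<open>Internal homs and finite objects\<close>

text \<open>
  The inner hom \<open>[X, Y]\<close> represents \<open>A \<mapsto> Hom (A \<otimes> X) Y\<close>: it is an object \<open>E\<close> with an
  evaluation \<open>e : E \<otimes> X \<rightarrow> Y\<close> that is universal among arrows of this shape.
\<close>

definition is_internal_hom ::
  "('o, 'm, 'r) braided_cat_scheme \<Rightarrow> 'o \<Rightarrow> 'o \<Rightarrow> 'o \<Rightarrow> 'm \<Rightarrow> bool" where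
  "is_internal_hom C X Y E e \<longleftrightarrow> E \<in> Obj C \<and> e \<in> Hom C (E \<boxtimes> X) Y
     \<and> (\<forall>A \<in> Obj C. \<forall>f \<in> Hom C (A \<boxtimes> X) Y. \<exists>!g. g \<in> Hom C A E \<and> e \<cdot> g \<otimes> Id C X = f)"
  for C (structure)

definition transpose ::
  "('o, 'm, 'r) braided_cat_scheme \<Rightarrow> 'o \<Rightarrow> 'o \<Rightarrow> 'm \<Rightarrow> 'o \<Rightarrow> 'm \<Rightarrow> 'm" where
  "transpose C X E e A f = (THE g. g \<in> Hom C A E \<and> e \<cdot> g \<otimes> Id C X = f)" for C (structure)

text \<open>The canonical arrow \<open>X \<otimes> [X, I] \<rightarrow> [X, X]\<close>, for \<open>[X, I] = (Xd, e)\<close> and \<open>[X, X] = (E, e')\<close>.\<close>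

definition dual_basis ::
  "('o, 'm, 'r) braided_cat_scheme \<Rightarrow> 'o \<Rightarrow> 'o \<Rightarrow> 'm \<Rightarrow> 'o \<Rightarrow> 'm \<Rightarrow> 'm" where
  "dual_basis C X Xd e E e' = transpose C X E e' (X \<boxtimes> Xd) (Id C X \<otimes> e)" for C (structure)

definition finite_object :: "('o, 'm, 'r) braided_cat_scheme \<Rightarrow> 'o \<Rightarrow> bool" where
  "finite_object C X \<longleftrightarrow> (\<exists>Xd e E e'. is_internal_hom C X (UnitOb C) Xd e
     \<and> is_internal_hom C X X E e' \<and> is_iso C (dual_basis C X Xd e E e'))"


section \<open>Opposite, dual and Drinfeld double\<close>

definition op_bialg ::
  "('o, 'm, 'r) braided_cat_scheme \<Rightarrow> ('o, 'm, 's) bialg_scheme \<Rightarrow> ('o, 'm) bialg" where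
  "op_bialg C H = \<lparr>ob = ob H, mult = mult H \<cdot> Braid C (ob H) (ob H), unt = unt H,
     comult = comult H, counit = counit H\<rparr>" for C (structure)

text \<open>
  In the following, \<open>[ob H, I] = (Hd, ev)\<close>.  For finite \<open>ob H\<close> the arrow \<open>(ev \<otimes> ev) (Hd \<otimes> \<Phi> \<otimes> H)\<close>
  makes \<open>Hd \<otimes> Hd\<close> an internal hom \<open>[H \<otimes> H, I]\<close>, so the comultiplication is well defined.
\<close>

definition dual_mult ::
  "('o, 'm, 'r) braided_cat_scheme \<Rightarrow> ('o, 'm, 's) bialg_scheme \<Rightarrow> 'o \<Rightarrow> 'm \<Rightarrow> 'm" where
  "dual_mult C H Hd ev = transpose C (ob H) Hd ev (Hd \<boxtimes> Hd)
     (ev \<otimes> ev \<cdot> Id C Hd \<otimes> Braid C Hd (ob H) \<otimes> Id C (ob H)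
       \<cdot> Id C Hd \<otimes> Id C Hd \<otimes> comult H)" for C (structure)

definition dual_unit ::
  "('o, 'm, 'r) braided_cat_scheme \<Rightarrow> ('o, 'm, 's) bialg_scheme \<Rightarrow> 'o \<Rightarrow> 'm \<Rightarrow> 'm" where
  "dual_unit C H Hd ev = transpose C (ob H) Hd ev (UnitOb C) (counit H)"

definition dual_comult ::
  "('o, 'm, 'r) braided_cat_scheme \<Rightarrow> ('o, 'm, 's) bialg_scheme \<Rightarrow> 'o \<Rightarrow> 'm \<Rightarrow> 'm" where
  "dual_comult C H Hd ev = (THE d. d \<in> Hom C Hd (Hd \<boxtimes> Hd)
     \<and> ev \<otimes> ev \<cdot> Id C Hd \<otimes> Braid C Hd (ob H) \<otimes> Id C (ob H) \<cdot> d \<otimes> Id C (ob H) \<otimes> Id C (ob H)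
       = ev \<cdot> Id C Hd \<otimes> mult H)" for C (structure)

definition dual_counit ::
  "('o, 'm, 'r) braided_cat_scheme \<Rightarrow> ('o, 'm, 's) bialg_scheme \<Rightarrow> 'o \<Rightarrow> 'm \<Rightarrow> 'm" where
  "dual_counit C H Hd ev = ev \<cdot> Id C Hd \<otimes> unt H" for C (structure)

definition dual_bialg ::
  "('o, 'm, 'r) braided_cat_scheme \<Rightarrow> ('o, 'm, 's) bialg_scheme \<Rightarrow> 'o \<Rightarrow> 'm \<Rightarrow> ('o, 'm) bialg"
  where
  "dual_bialg C H Hd ev = \<lparr>ob = Hd, mult = dual_mult C H Hd ev, unt = dual_unit C H Hd ev,
     comult = dual_comult C H Hd ev, counit = dual_counit C H Hd ev\<rparr>"

definition ev_bar ::
  "('o, 'm, 'r) braided_cat_scheme \<Rightarrow> ('o, 'm, 's) bialg_scheme \<Rightarrow> 'o \<Rightarrow> 'm \<Rightarrow> 'm" where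
  "ev_bar C H Hd ev = ev \<cdot> Braid C (ob H) Hd" for C (structure)

text \<open>
  The left action \<open>H \<otimes> B \<rightarrow> B\<close> and the right action \<open>H \<otimes> B \<rightarrow> H\<close> of the matched pair, where
  \<open>B\<close> is the dual of the opposite of \<open>H\<close>, with underlying object \<open>Hd\<close>.  As
  \<open>ev_bar (H \<otimes> t) = ev (t \<otimes> H) \<Phi>\<close>, the left action is determined by its defining equation.
\<close>

definition left_act ::
  "('o, 'm, 'r) braided_cat_scheme \<Rightarrow> ('o, 'm, 's) hopf_scheme \<Rightarrow> 'o \<Rightarrow> 'm \<Rightarrow> 'm" where
  "left_act C H Hd ev = (THE t. t \<in> Hom C (ob H \<boxtimes> Hd) Hd
     \<and> ev_bar C H Hd ev \<cdot> Id C (ob H) \<otimes> t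
       = ev_bar C H Hd ev
           \<cdot> (mult H \<cdot> Braid C (ob H) (ob H) \<cdot> mult H \<otimes> inverse_of C (antipode H)
                \<cdot> Id C (ob H) \<otimes> comult H) \<otimes> Id C Hd)" for C (structure)

definition right_act ::
  "('o, 'm, 'r) braided_cat_scheme \<Rightarrow> ('o, 'm, 's) hopf_scheme \<Rightarrow> 'o \<Rightarrow> 'm \<Rightarrow> 'm" where
  "right_act C H Hd ev =
     Id C (ob H) \<otimes> ev_bar C H Hd ev
       \<cdot> Id C (ob H) \<otimes> (mult H \<cdot> Braid C (ob H) (ob H)) \<otimes> Id C Hd
       \<cdot> inverse_of C (Braid C (ob H) (ob H)) \<otimes> inverse_of C (antipode H) \<otimes> Id C Hd
       \<cdot> (comult H \<otimes> Id C (ob H) \<cdot> comult H) \<otimes> Id C Hd" for C (structure)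

text \<open>Only the algebra and coalgebra structure of the double is recorded, not its antipode.\<close>

definition drinfeld_double ::
  "('o, 'm, 'r) braided_cat_scheme \<Rightarrow> ('o, 'm, 's) hopf_scheme \<Rightarrow> 'o \<Rightarrow> 'm \<Rightarrow> ('o, 'm) bialg"
  where
  "drinfeld_double C H Hd ev =
     (let B = dual_bialg C (op_bialg C H) Hd ev; h = Id C (ob H); b = Id C (ob B) in
      \<lparr>ob = ob B \<boxtimes> ob H,
       mult = mult B \<otimes> mult H
         \<cdot> b \<otimes> left_act C H Hd ev \<otimes> right_act C H Hd ev \<otimes> h
         \<cdot> b \<otimes> h \<otimes> Braid C (ob H) (ob B) \<otimes> b \<otimes> h
         \<cdot> b \<otimes> comult H \<otimes> comult B \<otimes> h,
       unt = unt B \<otimes> unt H,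
       comult = b \<otimes> Braid C (ob B) (ob H) \<otimes> h \<cdot> comult B \<otimes> comult H,
       counit = counit B \<otimes> counit H\<rparr>)" for C (structure)

end

theory Submission
  imports Defs
begin

text \<open>
  The dual of a finite bialgebra is commutative iff the bialgebra is cocommutative, and vice
  versa: \<open>(ev \<otimes> ev) (H\<^sup>* \<otimes> \<Phi> \<otimes> H)\<close> absorbs \<open>\<Phi>\<close> on \<open>H\<^sup>* \<otimes> H\<^sup>*\<close> and \<open>\<Phi>\<close> on \<open>H \<otimes> H\<close>
  alike, both giving the nested evaluation. Hence (ii) and (iii) agree, and each of them makes
  \<open>H\<close> commutative and cocommutative. Then \<open>S\<^sup>-\<^sup>1\<close> is a convolution inverse of the identity
  because \<open>S\<close> is multiplicative, so both actions of the matched pair are trivial, and the double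
  is the tensor product algebra and coalgebra of \<open>B\<close> and \<open>H\<close>; here symmetry of
  \<open>\<Phi>\<close> between \<open>H\<close> and \<open>H\<^sup>*\<close> gives (i) and (iv). Conversely \<open>B \<otimes> \<eta>\<close> and \<open>\<eta> \<otimes> H\<close> are split
  monomorphisms of algebras and of coalgebras into the double.

  All equations between composites are proved in a calculus of string diagrams, where an
  equation is applied inside a larger diagram after a computation that takes care of the
  interchange law.
\<close>

section \<open>String diagrams as lists of layers\<close>

text \<open>The equivalences mention the dual of \<open>H\<close>, whereas the double contains the
  dual of its opposite. The two duals agree except in the comultiplication, where the product of
  \<open>H\<close> is preceded by a crossing. As crossings are invertible, both duals are
  commutative, or cocommutative, under the same condition on \<open>H\<close>. The lemmas on duals
  are therefore stated for arbitrary structure maps and applied to both.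

  Two obstacles shape the middle part. The comultiplication of a dual and the left action are
  definite descriptions, known only after evaluation; and finiteness supplies internal homs of its
  own choice, not the prescribed \<open>Hd\<close> and \<open>ev\<close>. The inverse of the dual
  basis arrow yields a coevaluation for the prescribed pair. With the triangle identities an
  evaluation can then be cancelled even beside other wires, so an equation between described arrows
  is proved by evaluating both sides.

  Objects are represented by lists of wires, so that strict associativity and the unit laws become
  facts about append. Of the monoidal axioms only interchange remains to be computed, and
  \<open>sweep\<close> does so.\<close>

datatype ('a, 'b) node = Node (src: "'a list") (tgt: "'a list") (val: 'b)

text \<open>
  A diagram is a list of layers, the first layer being applied first. The layer \<open>(k, g)\<close>
  applies the node \<open>g\<close> to the wires \<open>k, k + 1, \<dots>\<close> (counted from \<open>0\<close>) and leaves the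
  other wires alone.
\<close>

type_synonym ('a, 'b) diagram = "(nat \<times> ('a, 'b) node) list"

definition layer_out :: "'a list \<Rightarrow> nat \<Rightarrow> ('a, 'b) node \<Rightarrow> 'a list" where
  "layer_out w k g = take k w @ tgt g @ drop (k + length (src g)) w"

fun out :: "'a list \<Rightarrow> ('a, 'b) diagram \<Rightarrow> 'a list" where
  "out w [] = w"
| "out w ((k, g) # p) = out (layer_out w k g) p"

fun shift :: "nat \<Rightarrow> ('a, 'b) diagram \<Rightarrow> ('a, 'b) diagram" where
  "shift n [] = []"
| "shift n ((k, g) # p) = (n + k, g) # shift n p"

text \<open>The earlier layer \<open>g\<close> moves past later layers that lie to the right of its
  outputs. Such a layer now acts before \<open>g\<close>, so its position is recomputed with the
  inputs of \<open>g\<close> in place of the outputs. The preferred order is thus rightmost layer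
  first.\<close>

fun insert_layer :: "nat \<Rightarrow> ('a, 'b) node \<Rightarrow> ('a, 'b) diagram \<Rightarrow> ('a, 'b) diagram" where
  "insert_layer j g [] = [(j, g)]"
| "insert_layer j g ((i, f) # p) =
    (if j + length (tgt g) \<le> i
     then (i - length (tgt g) + length (src g), f) # insert_layer j g p
     else (j, g) # (i, f) # p)"

fun sweep :: "('a, 'b) diagram \<Rightarrow> ('a, 'b) diagram" where
  "sweep [] = []"
| "sweep ((k, g) # p) = insert_layer k g (sweep p)"

text \<open>
  A second sweep is needed: it moves layers that become exchangeable in the first one.
  This is not claimed to be a normal form for all diagrams.
\<close>

definition nf :: "('a, 'b) diagram \<Rightarrow> ('a, 'b) diagram" where
  [simp]: "nf p = sweep (sweep p)"

lemma out_append [simp]: "out w (p @ q) = out (out w p) q"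
  by (induction p arbitrary: w) auto

lemma shift_append [simp]: "shift n (p @ q) = shift n p @ shift n q"
  by (induction p) auto

lemma shift_0 [simp]: "shift 0 p = p"
  by (induction p) auto

section \<open>Semantics of diagrams in a strict monoidal category\<close>

context strict_monoidal_category
begin

lemma HomD: "f \<in> Hom C A B \<Longrightarrow> f \<in> Arr C \<and> A \<in> Obj C \<and> B \<in> Obj C \<and> Dom C f = A \<and> Cod C f = B"
  using Dom_Obj Cod_Obj by (auto simp: Hom_def)

text \<open>The product ends in the unit object, so \<open>obs [A]\<close> is
  \<open>A \<boxtimes> UnitOb C\<close>. This is why the right unit law recurs wherever a single
  wire is read as an object.\<close>

fun obs :: "'a list \<Rightarrow> 'a" where
  "obs [] = UnitOb C"
| "obs (A # w) = A \<boxtimes> obs w"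

lemma obs_Obj [simp]: "set w \<subseteq> Obj C \<Longrightarrow> obs w \<in> Obj C"
  by (induction w) (auto intro: UnitOb_Obj ObTensor_Obj)

lemma obs_append: "set u \<subseteq> Obj C \<Longrightarrow> set v \<subseteq> Obj C \<Longrightarrow> obs (u @ v) = obs u \<boxtimes> obs v"
  by (induction u) (auto simp: ObTensor_unit_left ObTensor_assoc)

definition is_node :: "('a, 'b) node \<Rightarrow> bool" where
  "is_node g \<longleftrightarrow> set (src g) \<subseteq> Obj C \<and> set (tgt g) \<subseteq> Obj C
     \<and> val g \<in> Hom C (obs (src g)) (obs (tgt g))"

text \<open>The bound \<open>k \<le> length w\<close> matters for nodes without inputs: their empty
  source would match at every position, even beyond the end of the word.\<close>

definition layer_ok :: "'a list \<Rightarrow> nat \<Rightarrow> ('a, 'b) node \<Rightarrow> bool" where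
  "layer_ok w k g \<longleftrightarrow> is_node g \<and> k \<le> length w \<and> take (length (src g)) (drop k w) = src g"

definition layer_sem :: "'a list \<Rightarrow> nat \<Rightarrow> ('a, 'b) node \<Rightarrow> 'b" where
  "layer_sem w k g =
     Id C (obs (take k w)) \<otimes> val g \<otimes> Id C (obs (drop (k + length (src g)) w))"

fun wf :: "'a list \<Rightarrow> ('a, 'b) diagram \<Rightarrow> bool" where
  "wf w [] \<longleftrightarrow> set w \<subseteq> Obj C"
| "wf w ((k, g) # p) \<longleftrightarrow> set w \<subseteq> Obj C \<and> layer_ok w k g \<and> wf (layer_out w k g) p"

fun sem :: "'a list \<Rightarrow> ('a, 'b) diagram \<Rightarrow> 'b" where
  "sem w [] = Id C (obs w)"
| "sem w ((k, g) # p) = sem (layer_out w k g) p \<cdot> layer_sem w k g"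

text \<open>Well-formedness and the common output word are part of the relation, so that stacking
  and whiskering equations impose no further conditions on the diagrams. In exchange, reflexivity
  holds for well-formed diagrams only.\<close>

definition eqd :: "'a list \<Rightarrow> ('a, 'b) diagram \<Rightarrow> ('a, 'b) diagram \<Rightarrow> bool" where
  "eqd w p q \<longleftrightarrow> wf w p \<and> wf w q \<and> out w p = out w q \<and> sem w p = sem w q"

lemma wf_Obj: "wf w p \<Longrightarrow> set w \<subseteq> Obj C"
  by (cases p) auto

lemma layer_okE:
  assumes "layer_ok w k g" "set w \<subseteq> Obj C"
  obtains u v where "w = u @ src g @ v" "k = length u" "set u \<subseteq> Obj C" "set v \<subseteq> Obj C"
    "is_node g"
proof
  show "w = take k w @ src g @ drop (k + length (src g)) w"
    using assms unfolding layer_ok_def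
    by (metis append_take_drop_id drop_drop add.commute)
  show "k = length (take k w)" "is_node g"
    using assms unfolding layer_ok_def by auto
  show "set (take k w) \<subseteq> Obj C" "set (drop (k + length (src g)) w) \<subseteq> Obj C"
    using assms(2) by (meson order_trans set_take_subset set_drop_subset)+
qed

lemma layer_out_split [simp]: "layer_out (u @ src g @ v) (length u) g = u @ tgt g @ v"
  by (simp add: layer_out_def)

lemma layer_sem_split [simp]:
  "layer_sem (u @ src g @ v) (length u) g = Id C (obs u) \<otimes> val g \<otimes> Id C (obs v)"
  by (simp add: layer_sem_def)

lemma layer_ok_split [simp]: "layer_ok (u @ src g @ v) (length u) g \<longleftrightarrow> is_node g"
  by (simp add: layer_ok_def)

lemma is_nodeD:
  "is_node g \<Longrightarrow> set (src g) \<subseteq> Obj C" "is_node g \<Longrightarrow> set (tgt g) \<subseteq> Obj C"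
  "is_node g \<Longrightarrow> val g \<in> Hom C (obs (src g)) (obs (tgt g))"
  by (auto simp: is_node_def)

lemma out_Obj: "wf w p \<Longrightarrow> set (out w p) \<subseteq> Obj C"
  by (induction w p rule: out.induct) auto

lemma layer_Hom:
  assumes "is_node g" "set u \<subseteq> Obj C" "set v \<subseteq> Obj C"
  shows "Id C (obs u) \<otimes> val g \<otimes> Id C (obs v) \<in> Hom C (obs (u @ src g @ v)) (obs (u @ tgt g @ v))"
  using is_nodeD[OF assms(1)] assms(2,3)
  by (simp add: obs_append Tensor_Hom Id_Hom)

lemma sem_Hom: "wf w p \<Longrightarrow> sem w p \<in> Hom C (obs w) (obs (out w p))"
proof (induction w p rule: out.induct)
  case (1 w)
  then show ?case by (simp add: Id_Hom)
next
  case (2 w k g p)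
  then have ok: "layer_ok w k g" "set w \<subseteq> Obj C" and p: "wf (layer_out w k g) p" by auto
  obtain u v where uv: "w = u @ src g @ v" "k = length u" "set u \<subseteq> Obj C" "set v \<subseteq> Obj C"
    "is_node g"
    by (rule layer_okE[OF ok])
  show ?case
    using 2(1)[OF p] layer_Hom[OF uv(5,3,4)] unfolding uv(1,2) by (auto intro: Comp_Hom)
qed

lemma wf_append [simp]: "wf w (p @ q) \<longleftrightarrow> wf w p \<and> wf (out w p) q"
  using wf_Obj by (induction w p rule: out.induct) (simp_all, blast+)

lemma sem_append:
  assumes "wf w p" "wf (out w p) q"
  shows "sem w (p @ q) = sem (out w p) q \<cdot> sem w p"
  using assms
proof (induction w p rule: out.induct)
  case (1 w)
  then show ?case by (simp add: Id_right[OF sem_Hom])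
next
  case (2 w k g p)
  then have ok: "layer_ok w k g" "set w \<subseteq> Obj C" and p: "wf (layer_out w k g) p" by auto
  obtain u v where uv: "w = u @ src g @ v" "k = length u" "set u \<subseteq> Obj C" "set v \<subseteq> Obj C"
    "is_node g"
    by (rule layer_okE[OF ok])
  show ?case
    using 2(1) p 2(3) Comp_assoc[OF layer_Hom[OF uv(5,3,4)] sem_Hom sem_Hom] unfolding uv(1,2)
    by simp
qed

text \<open>Placing idle wires on both sides commutes with composition because the tensor product is
  a functor. This is what later allows an equation to be applied inside a larger diagram.\<close>

lemma whisker:
  assumes "wf w p" "set u \<subseteq> Obj C" "set v \<subseteq> Obj C"
  shows "wf (u @ w @ v) (shift (length u) p) \<and> out (u @ w @ v) (shift (length u) p) = u @ out w p @ v
    \<and> sem (u @ w @ v) (shift (length u) p) = Id C (obs u) \<otimes> sem w p \<otimes> Id C (obs v)"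
  using assms
proof (induction w p rule: out.induct)
  case (1 w)
  then show ?case by (simp add: obs_append Tensor_Id ObTensor_Obj)
next
  case (2 w k g p)
  then have ok: "layer_ok w k g" "set w \<subseteq> Obj C" and p: "wf (layer_out w k g) p" by auto
  obtain a b where ab: "w = a @ src g @ b" "k = length a" "set a \<subseteq> Obj C" "set b \<subseteq> Obj C"
    "is_node g"
    by (rule layer_okE[OF ok])
  note IH = 2(1)[OF p 2(3,4), unfolded ab(1,2)]
  note g = is_nodeD[OF ab(5)]
  let ?U = "Id C (obs u)" and ?V = "Id C (obs v)" and ?A = "Id C (obs a)" and ?B = "Id C (obs b)"
  have h: "?U \<in> Hom C (obs u) (obs u)" "?V \<in> Hom C (obs v) (obs v)"
    "?A \<in> Hom C (obs a) (obs a)" "?B \<in> Hom C (obs b) (obs b)"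
    using 2 ab by (auto intro: Id_Hom)
  have s: "sem (a @ tgt g @ b) p \<in> Hom C (obs (a @ tgt g @ b)) (obs (out (a @ tgt g @ b) p))"
    using p ab(1,2) by (simp add: sem_Hom)
  have l: "?A \<otimes> val g \<otimes> ?B \<in> Hom C (obs (a @ src g @ b)) (obs (a @ tgt g @ b))"
    using ab by (intro layer_Hom)
  have UA: "Id C (obs (u @ a)) = ?U \<otimes> ?A" "Id C (obs (b @ v)) = ?B \<otimes> ?V"
    using 2 ab by (auto simp: obs_append Tensor_Id)
  \<comment> \<open>Each identity is written as a composite of itself with itself, so that
    functoriality can split the tensor product into two layers.\<close>
  have idem: "?U = ?U \<cdot> ?U" "?V = ?V \<cdot> ?V"
    using Id_left h by metis+
  have arr: "?U \<in> Arr C" "?V \<in> Arr C" "?A \<in> Arr C" "?B \<in> Arr C" "val g \<in> Arr C"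
    "val g \<otimes> ?B \<in> Arr C" "val g \<otimes> ?B \<otimes> ?V \<in> Arr C" "?B \<otimes> ?V \<in> Arr C"
    using h g Tensor_Hom HomD by meson+
  have "?U \<otimes> (sem (a @ tgt g @ b) p \<cdot> ?A \<otimes> val g \<otimes> ?B) \<otimes> ?V
     = (?U \<cdot> ?U) \<otimes> (sem (a @ tgt g @ b) p \<cdot> ?A \<otimes> val g \<otimes> ?B) \<otimes> (?V \<cdot> ?V)"
    using idem by simp
  also have "\<dots> = ?U \<otimes> sem (a @ tgt g @ b) p \<otimes> ?V \<cdot> ?U \<otimes> (?A \<otimes> val g \<otimes> ?B) \<otimes> ?V"
    by (subst Tensor_Comp[OF l s h(2) h(2)], rule Tensor_Comp) (use h l s Tensor_Hom in blast)+
  also have "?U \<otimes> (?A \<otimes> val g \<otimes> ?B) \<otimes> ?V = (?U \<otimes> ?A) \<otimes> val g \<otimes> (?B \<otimes> ?V)"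
    using arr by (simp add: Tensor_assoc)
  finally have eq: "?U \<otimes> (sem (a @ tgt g @ b) p \<cdot> ?A \<otimes> val g \<otimes> ?B) \<otimes> ?V
     = ?U \<otimes> sem (a @ tgt g @ b) p \<otimes> ?V \<cdot> (?U \<otimes> ?A) \<otimes> val g \<otimes> (?B \<otimes> ?V)" .
  have wds: "layer_ok (u @ (a @ src g @ b) @ v) (length u + length a) g"
    "layer_out (u @ (a @ src g @ b) @ v) (length u + length a) g = u @ (a @ tgt g @ b) @ v"
    "layer_sem (u @ (a @ src g @ b) @ v) (length u + length a) g
      = Id C (obs (u @ a)) \<otimes> val g \<otimes> Id C (obs (b @ v))"
    using layer_ok_split[of "u @ a" g "b @ v"] layer_out_split[of "u @ a" g "b @ v"]
      layer_sem_split[of "u @ a" g "b @ v"] ab(5) by simp_all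
  have obj: "set (u @ (a @ src g @ b) @ v) \<subseteq> Obj C"
    using 2 ab g by auto
  have IH': "wf (u @ (a @ tgt g @ b) @ v) (shift (length u) p)"
    "out (u @ (a @ tgt g @ b) @ v) (shift (length u) p) = u @ out (a @ tgt g @ b) p @ v"
    "sem (u @ (a @ tgt g @ b) @ v) (shift (length u) p) = ?U \<otimes> sem (a @ tgt g @ b) p \<otimes> ?V"
    using IH unfolding layer_out_split by blast+
  show ?case
    unfolding ab(1,2) shift.simps wf.simps out.simps sem.simps wds UA layer_out_split
      layer_sem_split IH'(2,3) eq
    using IH'(1) obj wds(1) by blast
qed

lemma eqdI: "wf w p \<Longrightarrow> wf w q \<Longrightarrow> out w p = out w q \<Longrightarrow> sem w p = sem w q \<Longrightarrow> eqd w p q"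
  by (simp add: eqd_def)

lemma eqd_wf: "eqd w p q \<Longrightarrow> wf w p" "eqd w p q \<Longrightarrow> wf w q"
  by (simp_all add: eqd_def)

lemma eqd_cong:
  "eqd w p p' \<Longrightarrow> eqd w q q' \<Longrightarrow> eqd w p' q' \<Longrightarrow> eqd w p q"
  by (simp add: eqd_def)

lemma eqd_refl: "wf w p \<Longrightarrow> eqd w p p"
  by (simp add: eqd_def)

lemma eqd_sym: "eqd w p q \<Longrightarrow> eqd w q p"
  by (simp add: eqd_def)

lemma eqd_trans [trans]: "eqd w p q \<Longrightarrow> eqd w q r \<Longrightarrow> eqd w p r"
  by (simp add: eqd_def)

lemma eqd_append:
  assumes "eqd w p p'" "eqd (out w p) q q'"
  shows "eqd w (p @ q) (p' @ q')"
  using assms by (auto simp: eqd_def sem_append)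

lemma eqd_whisker:
  assumes "eqd w p q" "set u \<subseteq> Obj C" "set v \<subseteq> Obj C"
  shows "eqd (u @ w @ v) (shift (length u) p) (shift (length u) q)"
  using assms whisker[of w p u v] whisker[of w q u v] by (auto simp: eqd_def)

text \<open>A tensor product can be drawn with either factor acting first. If the left factor is
  first, the right one is shifted by the length of its output; otherwise by the length of its input.
  Comparing the two drawings is the interchange law.\<close>

lemma sem_tensor:
  assumes "wf w p" "wf v q"
  shows "sem w p \<otimes> sem v q = sem (w @ v) (p @ shift (length (out w p)) q)"
    and "sem w p \<otimes> sem v q = sem (w @ v) (shift (length w) q @ p)"
    and "wf (w @ v) (p @ shift (length (out w p)) q)"
    and "wf (w @ v) (shift (length w) q @ p)"
    and "out (w @ v) (p @ shift (length (out w p)) q) = out w p @ out v q"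
    and "out (w @ v) (shift (length w) q @ p) = out w p @ out v q"
proof -
  note ob = wf_Obj[OF assms(1)] wf_Obj[OF assms(2)] out_Obj[OF assms(1)] out_Obj[OF assms(2)]
  note p = sem_Hom[OF assms(1)] and q = sem_Hom[OF assms(2)]
  have arr: "sem w p \<in> Arr C" "sem v q \<in> Arr C" using p q by (auto dest: HomD)
  have unit: "f \<in> Arr C \<Longrightarrow> Id C (obs []) \<otimes> f = f" "f \<in> Arr C \<Longrightarrow> f \<otimes> Id C (obs []) = f" for f
    by (auto simp: Tensor_unit_left Tensor_unit_right)
  have ids: "Id C (obs u) \<in> Hom C (obs u) (obs u)" if "set u \<subseteq> Obj C" for u
    using that by (auto intro: Id_Hom)
  have arr': "sem w p \<otimes> Id C (obs u) \<in> Arr C" "Id C (obs u) \<otimes> sem v q \<in> Arr C"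
    if "set u \<subseteq> Obj C" for u
    using Tensor_Hom[OF p ids[OF that]] Tensor_Hom[OF ids[OF that] q] by (auto dest: HomD)
  have P: "wf (w @ u) p \<and> out (w @ u) p = out w p @ u \<and> sem (w @ u) p = sem w p \<otimes> Id C (obs u)"
    if "set u \<subseteq> Obj C" for u
    using whisker[OF assms(1), of "[]" u] that arr' by (simp add: unit del: obs.simps)
  have Q: "wf (u @ v) (shift (length u) q) \<and> out (u @ v) (shift (length u) q) = u @ out v q
     \<and> sem (u @ v) (shift (length u) q) = Id C (obs u) \<otimes> sem v q"
    if "set u \<subseteq> Obj C" for u
    using whisker[OF assms(2), of u "[]"] that arr by (simp add: unit del: obs.simps)
  show "wf (w @ v) (p @ shift (length (out w p)) q)" "wf (w @ v) (shift (length w) q @ p)"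
    "out (w @ v) (p @ shift (length (out w p)) q) = out w p @ out v q"
    "out (w @ v) (shift (length w) q @ p) = out w p @ out v q"
    using P[OF ob(2)] P[OF ob(4)] Q[OF ob(1)] Q[OF ob(3)] by auto
  have "sem (w @ v) (p @ shift (length (out w p)) q)
      = Id C (obs (out w p)) \<otimes> sem v q \<cdot> sem w p \<otimes> Id C (obs v)"
    using P[OF ob(2)] Q[OF ob(3)] by (simp add: sem_append)
  also have "\<dots> = sem w p \<otimes> sem v q"
    using Tensor_Comp[OF p ids[OF ob(3)] ids[OF ob(2)] q] Id_left[OF p] Id_right[OF q] by simp
  finally show "sem w p \<otimes> sem v q = sem (w @ v) (p @ shift (length (out w p)) q)" ..
  have "sem (w @ v) (shift (length w) q @ p)
      = sem w p \<otimes> Id C (obs (out v q)) \<cdot> Id C (obs w) \<otimes> sem v q"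
    using P[OF ob(4)] Q[OF ob(1)] by (simp add: sem_append)
  also have "\<dots> = sem w p \<otimes> sem v q"
    using Tensor_Comp[OF ids[OF ob(1)] p q ids[OF ob(4)]] Id_right[OF p] Id_left[OF q] by simp
  finally show "sem w p \<otimes> sem v q = sem (w @ v) (shift (length w) q @ p)" ..
qed

section \<open>Interchange and soundness of the sweep\<close>

lemma slide:
  assumes "wf w p" "wf v q"
  shows "eqd (w @ v) (p @ shift (length (out w p)) q) (shift (length w) q @ p)"
  using sem_tensor[OF assms] by (simp add: eqd_def del: wf_append out_append)

text \<open>All inputs of \<open>f\<close> lie to the right of the outputs of \<open>g\<close>,
  hence they were already present before \<open>g\<close>. After cutting away the idle wires
  \<open>a\<close> and \<open>e\<close>, the two layers are the factors of a tensor product and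
  \<open>slide\<close> applies.\<close>

lemma interchange:
  assumes "wf w [(j, g), (i, f)]" "j + length (tgt g) \<le> i"
  shows "eqd w [(j, g), (i, f)] [(i - length (tgt g) + length (src g), f), (j, g)]"
proof -
  have j: "layer_ok w j g" "set w \<subseteq> Obj C" and i: "layer_ok (layer_out w j g) i f"
    "set (layer_out w j g) \<subseteq> Obj C"
    using assms by auto
  obtain a b where ab: "w = a @ src g @ b" "j = length a" "set a \<subseteq> Obj C" "set b \<subseteq> Obj C"
    "is_node g"
    by (rule layer_okE[OF j])
  obtain c e where ce: "a @ tgt g @ b = c @ src f @ e" "i = length c" "set c \<subseteq> Obj C"
    "set e \<subseteq> Obj C" "is_node f"
    using layer_okE[OF i] unfolding ab layer_out_split by metis
  \<comment> \<open>The wires strictly between the outputs of \<open>g\<close> and the inputs of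
    \<open>f\<close>.\<close>
  define b' where "b' = drop (length a + length (tgt g)) c"
  have c: "c = (a @ tgt g) @ b'"
  proof -
    have "take (length (a @ tgt g)) c = a @ tgt g"
      using arg_cong[OF ce(1), of "take (length (a @ tgt g))"] assms(2) ab(2) ce(2) by simp
    then show ?thesis unfolding b'_def by (metis append_take_drop_id length_append)
  qed
  then have b: "b = b' @ src f @ e"
    using ce(1) by simp
  have obj: "set b' \<subseteq> Obj C" using ab(4) b by simp
  have 1: "wf (src g) [(0, g)]" "out (src g) [(0, g)] = tgt g"
    using ab(5) layer_out_split[of "[]" g "[]"] layer_ok_split[of "[]" g "[]"]
    by (simp_all add: is_nodeD)
  have 2: "wf (b' @ src f) [(length b', f)]"
    using ce(5) obj layer_out_split[of b' f "[]"] layer_ok_split[of b' f "[]"]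
    by (simp add: is_nodeD)
  have "eqd (a @ (src g @ b' @ src f) @ e)
     (shift (length a) ([(0, g)] @ shift (length (tgt g)) [(length b', f)]))
     (shift (length a) (shift (length (src g)) [(length b', f)] @ [(0, g)]))"
    using eqd_whisker[OF slide[OF 1(1) 2] ab(3) ce(4)] unfolding 1(2) .
  moreover have "i - length (tgt g) + length (src g) = length a + (length (src g) + length b')"
    "i = length a + (length (tgt g) + length b')"
    using ce(2) c by auto
  ultimately show ?thesis
    unfolding ab(1,2) b by (simp add: add_ac)
qed

lemma wf_ConsD: "wf w (l # p) \<Longrightarrow> wf w [l] \<and> wf (out w [l]) p"
  using wf_append[of w "[l]" p] by simp

lemma insert_layer_sound: "wf w ((j, g) # p) \<Longrightarrow> eqd w ((j, g) # p) (insert_layer j g p)"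
proof (induction j g p arbitrary: w rule: insert_layer.induct)
  case (1 j g)
  then show ?case by (simp add: eqd_refl)
next
  case (2 j g i f p)
  show ?case
  proof (cases "j + length (tgt g) \<le> i")
    case True
    let ?i = "i - length (tgt g) + length (src g)"
    have wf: "wf w ([(j, g), (i, f)] @ p)" using 2 by simp
    then have "wf w [(j, g), (i, f)]" and p: "wf (out w [(j, g), (i, f)]) p"
      using wf_append by blast+
    then have e: "eqd w [(j, g), (i, f)] [(?i, f), (j, g)]"
      using interchange True by blast
    then have a: "eqd w ((j, g) # (i, f) # p) ((?i, f) # (j, g) # p)"
      using eqd_append[OF e eqd_refl[OF p]] by simp
    then have "wf w ((?i, f) # (j, g) # p)" by (simp add: eqd_def)
    then have w: "wf w [(?i, f)]" "wf (out w [(?i, f)]) ((j, g) # p)"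
      using wf_ConsD by blast+
    have "eqd w ([(?i, f)] @ ((j, g) # p)) ([(?i, f)] @ insert_layer j g p)"
      by (rule eqd_append[OF eqd_refl[OF w(1)] 2(1)[OF True w(2)]])
    with a have "eqd w ((j, g) # (i, f) # p) ((?i, f) # insert_layer j g p)"
      using eqd_trans by simp
    with True show ?thesis by simp
  next
    case False
    with 2 show ?thesis by (simp add: eqd_refl)
  qed
qed

lemma sweep_sound: "wf w p \<Longrightarrow> eqd w p (sweep p)"
proof (induction p arbitrary: w)
  case Nil
  then show ?case by (simp add: eqd_refl)
next
  case (Cons l p)
  obtain k g where l: "l = (k, g)" by (cases l)
  have w: "wf w [l]" "wf (out w [l]) p" using Cons(2) wf_ConsD by blast+
  have "eqd w ([l] @ p) ([l] @ sweep p)"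
    by (rule eqd_append[OF eqd_refl[OF w(1)] Cons(1)[OF w(2)]])
  then have a: "eqd w (l # p) (l # sweep p)" by simp
  then have "wf w ((k, g) # sweep p)" by (simp add: eqd_def l)
  from eqd_trans[OF a[unfolded l] insert_layer_sound[OF this]] show ?case by (simp add: l)
qed

lemma nf_sound: "wf w p \<Longrightarrow> eqd w p (nf p)"
  unfolding nf_def using sweep_sound eqd_wf(2) eqd_trans by blast

lemma planar: "wf w p \<Longrightarrow> wf w q \<Longrightarrow> nf p = nf q \<Longrightarrow> eqd w p q"
  using nf_sound eqd_trans eqd_sym by metis

text \<open>
  Applies the equation \<open>l = r\<close> to the wires \<open>k, k + 1, \<dots>\<close> between \<open>pre\<close> and \<open>post\<close>, up to interchange.
\<close>

lemma rewrite:
  assumes e: "eqd v l r"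
    and p: "nf p = nf (pre @ shift k l @ post)"
    and q: "nf q = nf (pre @ shift k r @ post)"
    and wf: "wf w p" "wf w q" "wf w (pre @ shift k l @ post)"
    and k: "k \<le> length (out w pre)" "take (length v) (drop k (out w pre)) = v"
  shows "eqd w p q"
proof -
  define a b where "a = take k (out w pre)" and "b = drop (k + length v) (out w pre)"
  have ab: "out w pre = a @ v @ b" "length a = k"
    using k unfolding a_def b_def by (simp_all, metis append_take_drop_id drop_drop add.commute)
  have pre: "wf w pre" and post: "wf (out w (pre @ shift k l)) post"
    using wf(3) by auto
  have obj: "set a \<subseteq> Obj C" "set b \<subseteq> Obj C"
    using out_Obj[OF pre] ab(1) by auto
  have m: "eqd (out w pre) (shift k l) (shift k r)"
    using eqd_whisker[OF e obj] ab by simp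
  have *: "eqd w (pre @ shift k l @ post) (pre @ shift k r @ post)"
    using eqd_append[OF eqd_refl[OF pre] eqd_append[OF m eqd_refl]] post by simp
  then have "wf w (pre @ shift k r @ post)" by (simp add: eqd_def)
  with * show ?thesis
    using planar[OF wf(1) wf(3) p] planar[OF wf(2) _ q] eqd_trans eqd_sym by blast
qed

section \<open>From terms of the category to diagrams\<close>

lemma Id_sem: "A \<in> Obj C \<Longrightarrow> Id C A = sem [A] []"
  by (simp add: ObTensor_unit_right)

lemma Id_unit_sem: "Id C (UnitOb C) = sem [] []"
  by simp

lemma comp_sem: "wf w p \<Longrightarrow> out w p = v \<Longrightarrow> wf v q \<Longrightarrow> sem v q \<cdot> sem w p = sem w (p @ q)"
  by (simp add: sem_append)

lemma sem_node:
  assumes "is_node g"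
  shows "sem (src g) [(0, g)] = val g"
proof -
  have v: "val g \<in> Hom C (obs (src g)) (obs (tgt g))"
    using assms by (simp add: is_node_def)
  have "layer_sem (src g) 0 g = val g"
    using layer_sem_split[of "[]" g "[]"] HomD[OF v]
    by (simp add: Tensor_unit_left Tensor_unit_right)
  then show ?thesis
    using layer_out_split[of "[]" g "[]"] Id_left[OF v] by simp
qed

declare sem.simps [simp del]

text \<open>As rewrite rules these collapse a composite of structure maps into \<open>sem\<close> of
  one explicit list, with the left factor of each tensor product drawn first. For this reason
  \<open>sem.simps\<close> no longer unfolds automatically.\<close>

lemmas reify = Id_sem Id_unit_sem comp_sem sem_tensor(1)

lemmas diagram_simps = layer_ok_def layer_out_def eval_nat_numeral

lemma sem_NodeI:
  assumes "set a \<subseteq> Obj C" "set b \<subseteq> Obj C" "f \<in> Hom C (obs a) (obs b)" "g = Node a b f"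
  shows "is_node g" "src g = a" "tgt g = b" "f = sem a [(0, g)]"
proof -
  show g: "is_node g" "src g = a" "tgt g = b" using assms by (simp_all add: is_node_def)
  show "f = sem a [(0, g)]" using sem_node[OF g(1)] g(2) assms(4) by simp
qed

end

section \<open>Braidings\<close>

context braided_monoidal_category
begin

lemma is_inverse_inverse_of:
  assumes "is_iso C f"
  shows "is_inverse C f (inverse_of C f)"
proof -
  obtain g where g: "is_inverse C f g" using assms by (auto simp: is_iso_def)
  have "h = g" if "is_inverse C f h" for h
  proof -
    have gf: "g \<in> Hom C (Cod C f) (Dom C f)" "h \<in> Hom C (Cod C f) (Dom C f)"
      "f \<in> Hom C (Dom C f) (Cod C f)" "g \<cdot> f = Id C (Dom C f)" "f \<cdot> h = Id C (Cod C f)"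
      using g that by (auto simp: is_inverse_def Hom_def)
    have "h = (g \<cdot> f) \<cdot> h" using gf Id_left by metis
    also have "\<dots> = g" using gf Comp_assoc Id_right by metis
    finally show ?thesis .
  qed
  with g show ?thesis unfolding inverse_of_def by (rule theI)
qed

text \<open>The hexagon with two unit factors says that this braiding is idempotent, and an
  invertible idempotent is an identity. The same argument serves for
  \<open>Braid_unit_left\<close>.\<close>

lemma Braid_unit_right:
  assumes "A \<in> Obj C"
  shows "Braid C A (UnitOb C) = Id C A"
proof -
  let ?b = "Braid C A (UnitOb C)"
  obtain g where g: "is_inverse C ?b g" using Braid_iso[OF assms UnitOb_Obj] by (auto simp: is_iso_def)
  have b: "?b \<in> Hom C A A" using Braid_Hom[OF assms UnitOb_Obj] assms
    by (simp add: ObTensor_unit_left ObTensor_unit_right)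
  have gh: "g \<in> Hom C A A" "g \<cdot> ?b = Id C A" using g HomD[OF b] by (auto simp: is_inverse_def)
  have "?b = ?b \<cdot> ?b"
    using Braid_tensor_right[OF assms UnitOb_Obj UnitOb_Obj] HomD[OF b]
    by (simp add: ObTensor_unit_left UnitOb_Obj Tensor_unit_left Tensor_unit_right)
  then have "g \<cdot> ?b = g \<cdot> (?b \<cdot> ?b)" by simp
  also have "\<dots> = (g \<cdot> ?b) \<cdot> ?b" using Comp_assoc[OF b b gh(1)] ..
  also have "\<dots> = ?b" using gh(2) Id_left[OF b] by simp
  finally show ?thesis using gh(2) by simp
qed

lemma Braid_unit_left:
  assumes "A \<in> Obj C"
  shows "Braid C (UnitOb C) A = Id C A"
proof -
  let ?b = "Braid C (UnitOb C) A"
  obtain g where g: "is_inverse C ?b g" using Braid_iso[OF UnitOb_Obj assms] by (auto simp: is_iso_def)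
  have b: "?b \<in> Hom C A A" using Braid_Hom[OF UnitOb_Obj assms] assms
    by (simp add: ObTensor_unit_left ObTensor_unit_right)
  have gh: "g \<in> Hom C A A" "g \<cdot> ?b = Id C A" using g HomD[OF b] by (auto simp: is_inverse_def)
  have "?b = ?b \<cdot> ?b"
    using Braid_tensor_left[OF UnitOb_Obj UnitOb_Obj assms] HomD[OF b]
    by (simp add: ObTensor_unit_left UnitOb_Obj Tensor_unit_left Tensor_unit_right)
  then have "g \<cdot> ?b = g \<cdot> (?b \<cdot> ?b)" by simp
  also have "\<dots> = (g \<cdot> ?b) \<cdot> ?b" using Comp_assoc[OF b b gh(1)] ..
  also have "\<dots> = ?b" using gh(2) Id_left[OF b] by simp
  finally show ?thesis using gh(2) by simp
qed

definition br :: "'a \<Rightarrow> 'a \<Rightarrow> ('a, 'b) node" where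
  "br A B = Node [A, B] [B, A] (Braid C A B)"

definition bri :: "'a \<Rightarrow> 'a \<Rightarrow> ('a, 'b) node" where
  "bri A B = Node [B, A] [A, B] (inverse_of C (Braid C A B))"

lemma br_simps [simp]: "src (br A B) = [A, B]" "tgt (br A B) = [B, A]"
  "src (bri A B) = [B, A]" "tgt (bri A B) = [A, B]"
  by (simp_all add: br_def bri_def)

lemma br_node [simp]: "A \<in> Obj C \<Longrightarrow> B \<in> Obj C \<Longrightarrow> is_node (br A B)"
  using Braid_Hom by (simp add: is_node_def br_def ObTensor_unit_right)

lemma Braid_inverse:
  assumes "A \<in> Obj C" "B \<in> Obj C"
  shows "inverse_of C (Braid C A B) \<in> Hom C (B \<boxtimes> A) (A \<boxtimes> B)"
    "inverse_of C (Braid C A B) \<cdot> Braid C A B = Id C (A \<boxtimes> B)"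
    "Braid C A B \<cdot> inverse_of C (Braid C A B) = Id C (B \<boxtimes> A)"
  using is_inverse_inverse_of[OF Braid_iso[OF assms]] HomD[OF Braid_Hom[OF assms]]
  by (auto simp: is_inverse_def)

lemma bri_node [simp]: "A \<in> Obj C \<Longrightarrow> B \<in> Obj C \<Longrightarrow> is_node (bri A B)"
  using Braid_inverse(1) by (simp add: is_node_def bri_def ObTensor_unit_right)

text \<open>The second equation mentions \<open>sem\<close> on its left because the first one
  rewrites the argument of \<open>inverse_of\<close> beforehand; \<open>T_sem\<close> follows the
  same pattern.\<close>

lemma br_sem:
  assumes "A \<in> Obj C" "B \<in> Obj C"
  shows "Braid C A B = sem [A, B] [(0, br A B)]"
    "inverse_of C (sem [A, B] [(0, br A B)]) = sem [B, A] [(0, bri A B)]"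
  using sem_node[OF br_node[OF assms]] sem_node[OF bri_node[OF assms]] by (simp_all add: br_def bri_def)

lemma Id_pair_sem: "A \<in> Obj C \<Longrightarrow> B \<in> Obj C \<Longrightarrow> Id C (A \<boxtimes> B) = sem [A, B] []"
  by (simp add: sem.simps ObTensor_unit_right)

lemma br_bri:
  assumes "A \<in> Obj C" "B \<in> Obj C"
  shows "eqd [A, B] [(0, br A B), (0, bri A B)] []"
    "eqd [B, A] [(0, bri A B), (0, br A B)] []"
  using Braid_inverse(2,3)[OF assms] assms
  by (auto intro!: eqdI simp: diagram_simps br_sem reify Id_pair_sem)

text \<open>
  \<open>lbr B w\<close> moves the wire \<open>B\<close> from the left of \<open>w\<close> to its right; \<open>rbr w B\<close> moves it from right to left.
\<close>

fun lbr :: "'a \<Rightarrow> 'a list \<Rightarrow> ('a, 'b) diagram" where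
  "lbr B [] = []"
| "lbr B (A # w) = (0, br B A) # shift 1 (lbr B w)"

fun rbr :: "'a list \<Rightarrow> 'a \<Rightarrow> ('a, 'b) diagram" where
  "rbr [] B = []"
| "rbr (A # w) B = shift 1 (rbr w B) @ [(0, br A B)]"

text \<open>Iterated hexagon, starting from the trivial braiding with the unit object.\<close>

lemma lbr:
  assumes "B \<in> Obj C" "set w \<subseteq> Obj C"
  shows "wf (B # w) (lbr B w) \<and> out (B # w) (lbr B w) = w @ [B]
    \<and> sem (B # w) (lbr B w) = Braid C B (obs w)"
  using assms(2)
proof (induction w)
  case Nil
  then show ?case using assms(1) by (simp add: Braid_unit_right sem.simps ObTensor_unit_right)
next
  case (Cons A w)
  then have A: "A \<in> Obj C" "set w \<subseteq> Obj C" by auto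
  note IH = Cons(1)[OF A(2)]
  have s: "wf ([A] @ (B # w) @ []) (shift (length [A]) (lbr B w))"
    "out ([A] @ (B # w) @ []) (shift (length [A]) (lbr B w)) = A # w @ [B]"
    "sem ([A] @ (B # w) @ []) (shift (length [A]) (lbr B w)) = Id C A \<otimes> Braid C B (obs w)"
    using whisker[of "B # w" "lbr B w" "[A]" "[]"] IH A assms(1) HomD[OF Braid_Hom[OF assms(1)]]
    by (simp_all add: ObTensor_unit_right Tensor_unit_right)
  have b: "wf (B # A # w) [(0, br B A)]" "out (B # A # w) [(0, br B A)] = A # B # w"
    "sem (B # A # w) [(0, br B A)] = Braid C B A \<otimes> Id C (obs w)"
    using whisker[of "[B, A]" "[(0, br B A)]" "[]" w] A assms(1) HomD[OF Braid_Hom[OF assms(1) A(1)]]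
      HomD[OF Tensor_Hom[OF Braid_Hom[OF assms(1) A(1)] Id_Hom]]
    by (auto simp: diagram_simps br_sem[symmetric] Tensor_unit_left)
  show ?case
    using s b sem_append[of "B # A # w" "[(0, br B A)]" "shift 1 (lbr B w)"]
      Braid_tensor_right[OF assms(1) A(1), of "obs w"] A
    by (simp add: diagram_simps)
qed

lemma rbr:
  assumes "B \<in> Obj C" "set w \<subseteq> Obj C"
  shows "wf (w @ [B]) (rbr w B) \<and> out (w @ [B]) (rbr w B) = B # w
    \<and> sem (w @ [B]) (rbr w B) = Braid C (obs w) B"
  using assms(2)
proof (induction w)
  case Nil
  then show ?case using assms(1) by (simp add: Braid_unit_left sem.simps ObTensor_unit_right)
next
  case (Cons A w)
  then have A: "A \<in> Obj C" "set w \<subseteq> Obj C" by auto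
  note IH = Cons(1)[OF A(2)]
  have s: "wf ([A] @ (w @ [B]) @ []) (shift (length [A]) (rbr w B))"
    "out ([A] @ (w @ [B]) @ []) (shift (length [A]) (rbr w B)) = A # B # w"
    "sem ([A] @ (w @ [B]) @ []) (shift (length [A]) (rbr w B)) = Id C A \<otimes> Braid C (obs w) B"
    using whisker[of "w @ [B]" "rbr w B" "[A]" "[]"] IH A assms(1)
      HomD[OF Braid_Hom[OF _ assms(1), of "obs w"]]
    by (simp_all add: ObTensor_unit_right Tensor_unit_right)
  have b: "wf (A # B # w) [(0, br A B)]" "out (A # B # w) [(0, br A B)] = B # A # w"
    "sem (A # B # w) [(0, br A B)] = Braid C A B \<otimes> Id C (obs w)"
    using whisker[of "[A, B]" "[(0, br A B)]" "[]" w] A assms(1) HomD[OF Braid_Hom[OF A(1) assms(1)]]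
      HomD[OF Tensor_Hom[OF Braid_Hom[OF A(1) assms(1)] Id_Hom]]
    by (auto simp: diagram_simps br_sem[symmetric] Tensor_unit_left)
  show ?case
    using s b sem_append[of "A # w @ [B]" "shift 1 (rbr w B)" "[(0, br A B)]"]
      Braid_tensor_left[OF A(1) _ assms(1), of "obs w"] A
    by (simp add: diagram_simps)
qed

text \<open>For a node without inputs or without outputs, such as a unit, a counit or an evaluation,
  one of the two families of crossings is empty: the node then passes the wire \<open>B\<close> and
  creates or removes crossings on the way.\<close>

lemma br_natural_left:
  assumes "is_node g" "B \<in> Obj C"
  shows "eqd (src g @ [B]) ((0, g) # rbr (tgt g) B) (rbr (src g) B @ [(1, g)])"
proof -
  note g = is_nodeD[OF assms(1)]
  note s = rbr[OF assms(2) g(1)] and t = rbr[OF assms(2) g(2)]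
  have w: "wf (src g) [(0, g)]" "out (src g) [(0, g)] = tgt g"
    using assms(1) layer_out_split[of "[]" g "[]"] layer_ok_split[of "[]" g "[]"] g
    by simp_all
  have B: "obs [B] = B" "wf [B] []" using assms(2) by (simp_all add: ObTensor_unit_right)
  have r: "wf (src g @ [B]) [(0, g)]" "out (src g @ [B]) [(0, g)] = tgt g @ [B]"
    "sem (src g @ [B]) [(0, g)] = val g \<otimes> Id C B"
    using sem_tensor(1,3,5)[OF w(1) B(2)] sem_node[OF assms(1)] w(2) Id_sem[OF assms(2)] by simp_all
  have l: "wf (B # src g) [(1, g)]" "out (B # src g) [(1, g)] = B # tgt g"
    "sem (B # src g) [(1, g)] = Id C B \<otimes> val g"
    using sem_tensor(1,3,5)[OF B(2) w(1)] sem_node[OF assms(1)] w(2) Id_sem[OF assms(2)] by simp_all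
  have "sem (src g @ [B]) ([(0, g)] @ rbr (tgt g) B) = Braid C (obs (tgt g)) B \<cdot> val g \<otimes> Id C B"
    using r t by (subst sem_append) simp_all
  also have "\<dots> = Id C B \<otimes> val g \<cdot> Braid C (obs (src g)) B"
    using Braid_natural[OF g(3) Id_Hom[OF assms(2)]] .
  also have "\<dots> = sem (src g @ [B]) (rbr (src g) B @ [(1, g)])"
    using l s by (subst sem_append) simp_all
  finally show ?thesis
    using r l s t wf_append[of "src g @ [B]" "[(0, g)]" "rbr (tgt g) B"]
      out_append[of "src g @ [B]" "[(0, g)]" "rbr (tgt g) B"]
    by (intro eqdI) (simp_all del: wf.simps out.simps wf_append out_append, simp_all)
qed

lemma br_natural_right:
  assumes "is_node g" "B \<in> Obj C"
  shows "eqd (B # src g) ((1, g) # lbr B (tgt g)) (lbr B (src g) @ [(0, g)])"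
proof -
  note g = is_nodeD[OF assms(1)]
  note s = lbr[OF assms(2) g(1)] and t = lbr[OF assms(2) g(2)]
  have w: "wf (src g) [(0, g)]" "out (src g) [(0, g)] = tgt g"
    using assms(1) layer_out_split[of "[]" g "[]"] layer_ok_split[of "[]" g "[]"] g
    by simp_all
  have B: "obs [B] = B" "wf [B] []" using assms(2) by (simp_all add: ObTensor_unit_right)
  have r: "wf (src g @ [B]) [(0, g)]" "out (src g @ [B]) [(0, g)] = tgt g @ [B]"
    "sem (src g @ [B]) [(0, g)] = val g \<otimes> Id C B"
    using sem_tensor(1,3,5)[OF w(1) B(2)] sem_node[OF assms(1)] w(2) Id_sem[OF assms(2)] by simp_all
  have l: "wf (B # src g) [(1, g)]" "out (B # src g) [(1, g)] = B # tgt g"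
    "sem (B # src g) [(1, g)] = Id C B \<otimes> val g"
    using sem_tensor(1,3,5)[OF B(2) w(1)] sem_node[OF assms(1)] w(2) Id_sem[OF assms(2)] by simp_all
  have "sem (B # src g) ([(1, g)] @ lbr B (tgt g)) = Braid C B (obs (tgt g)) \<cdot> Id C B \<otimes> val g"
    using l t by (subst sem_append) simp_all
  also have "\<dots> = val g \<otimes> Id C B \<cdot> Braid C B (obs (src g))"
    using Braid_natural[OF Id_Hom[OF assms(2)] g(3)] .
  also have "\<dots> = sem (B # src g) (lbr B (src g) @ [(0, g)])"
    using r s by (subst sem_append) simp_all
  finally show ?thesis
    using r l s t wf_append[of "B # src g" "[(1, g)]" "lbr B (tgt g)"]
      out_append[of "B # src g" "[(1, g)]" "lbr B (tgt g)"]
    by (intro eqdI) (simp_all del: wf.simps out.simps wf_append out_append, simp_all)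
qed

end

section \<open>Finite objects and their duals\<close>

text \<open>\<open>EV\<close> and \<open>CV\<close> are nodes rather than arrows so that they can
  occur directly in diagrams. One triangle identity is assumed; the universal property of
  \<open>EV\<close> turns it into the other one in \<open>zag_eqd\<close>.\<close>

locale finite_dual = braided_monoidal_category C
  for C :: "('a, 'b, 'c) braided_cat_scheme" (structure) +
  fixes X Xd :: 'a and EV CV :: "('a, 'b) node"
  assumes X_Obj [simp]: "X \<in> Obj C"
    and EV_ports [simp]: "src EV = [Xd, X]" "tgt EV = []"
    and internal_hom: "is_internal_hom C X (UnitOb C) Xd (val EV)"
    and CV_ports [simp]: "src CV = []" "tgt CV = [X, Xd]"
    and cv_Hom: "val CV \<in> Hom C (UnitOb C) (X \<boxtimes> Xd)"
    and zig: "Id C X \<otimes> val EV \<cdot> val CV \<otimes> Id C X = Id C X"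
begin

abbreviation ev :: 'b where "ev \<equiv> val EV"
abbreviation cv :: 'b where "cv \<equiv> val CV"

lemma Xd_Obj [simp]: "Xd \<in> Obj C"
  and ev_Hom: "ev \<in> Hom C (Xd \<boxtimes> X) (UnitOb C)"
  using internal_hom by (auto simp: is_internal_hom_def)

lemma EV_node [simp]: "is_node EV" and ev_sem: "ev = sem [Xd, X] [(0, EV)]"
  using sem_NodeI[of "[Xd, X]" "[]" ev EV] ev_Hom node.collapse[of EV]
  by (simp_all add: ObTensor_unit_right)

lemma CV_node [simp]: "is_node CV" and cv_sem: "cv = sem [] [(0, CV)]"
  using sem_NodeI[of "[]" "[X, Xd]" cv CV] cv_Hom node.collapse[of CV]
  by (simp_all add: ObTensor_unit_right)

lemma transpose_unique:
  assumes "f \<in> Hom C A Xd" "g \<in> Hom C A Xd" "ev \<cdot> f \<otimes> Id C X = ev \<cdot> g \<otimes> Id C X"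
  shows "f = g"
proof -
  have A: "A \<in> Obj C" using HomD[OF assms(1)] by blast
  have "ev \<cdot> f \<otimes> Id C X \<in> Hom C (A \<boxtimes> X) (UnitOb C)"
    using Comp_Hom[OF Tensor_Hom[OF assms(1) Id_Hom[OF X_Obj]] ev_Hom] .
  with internal_hom A have "\<exists>!h. h \<in> Hom C A Xd \<and> ev \<cdot> h \<otimes> Id C X = ev \<cdot> f \<otimes> Id C X"
    by (auto simp: is_internal_hom_def)
  then show ?thesis using assms by metis
qed

lemma transpose_ex1:
  assumes "A \<in> Obj C" "f \<in> Hom C (A \<boxtimes> X) (UnitOb C)"
  shows "\<exists>!g. g \<in> Hom C A Xd \<and> ev \<cdot> g \<otimes> Id C X = f"
  using internal_hom assms by (auto simp: is_internal_hom_def)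

lemma transpose:
  assumes "A \<in> Obj C" "f \<in> Hom C (A \<boxtimes> X) (UnitOb C)"
  shows "transpose C X Xd ev A f \<in> Hom C A Xd \<and> ev \<cdot> transpose C X Xd ev A f \<otimes> Id C X = f"
  unfolding transpose_def by (rule theI'[OF transpose_ex1[OF assms]])

section \<open>Triangle identities and cancellation of evaluations\<close>

lemma zig_eqd: "eqd [X] [(0, CV), (1, EV)] []"
  using zig by (auto intro!: eqdI simp: diagram_simps ev_sem cv_sem reify)

text \<open>An arrow into \<open>Xd\<close> is determined by its evaluation. Evaluating the bent
  wire lets the first triangle identity straighten it on the \<open>X\<close> side.\<close>

lemma zag_eqd: "eqd [Xd] [(1, CV), (0, EV)] []"
proof -
  let ?f = "sem [Xd] [(1, CV), (0, EV)]"
  have w: "wf [Xd] [(1, CV), (0, EV)]" "wf [Xd] []"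
    by (simp_all add: diagram_simps)
  have "eqd [Xd, X] [(1, CV), (0, EV), (0, EV)] [(0, EV)]"
    by (rule rewrite[OF zig_eqd, where k = 1 and pre = "[]" and post = "[(0, EV)]"])
      (simp_all add: diagram_simps)
  then have "ev \<cdot> ?f \<otimes> Id C X = ev \<cdot> Id C Xd \<otimes> Id C X"
    by (simp add: diagram_simps ev_sem reify eqd_def)
  moreover have "?f \<in> Hom C Xd Xd" "Id C Xd \<in> Hom C Xd Xd"
    using sem_Hom[OF w(1)] sem_Hom[OF w(2)] by (simp_all add: diagram_simps ObTensor_unit_right Id_Hom)
  ultimately have "?f = Id C Xd" using transpose_unique by blast
  then show ?thesis using w by (auto intro!: eqdI simp: diagram_simps reify)
qed

text \<open>A wire \<open>Xd\<close> bent by an evaluation can be straightened again by a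
  coevaluation, so evaluating loses no information, whatever further outputs \<open>v\<close> there
  are. The universal property by itself covers the case \<open>v = []\<close>.\<close>

lemma ev_cancel:
  assumes "wf w p" "wf w q" "out w p = v @ [Xd]" "out w q = v @ [Xd]"
    and eq: "eqd (w @ [X]) (p @ [(length v, EV)]) (q @ [(length v, EV)])"
  shows "eqd w p q"
proof -
  have w: "set w \<subseteq> Obj C" using wf_Obj[OF assms(1)] .
  have v: "set v \<subseteq> Obj C" using out_Obj[OF assms(1)] assms(3) by simp
  have *: "eqd w r ((length w, CV) # r @ [(length v, EV)])"
    if r: "wf w r" "out w r = v @ [Xd]" for r
  proof -
    let ?n = "length v"
    have z: "eqd (v @ [Xd]) [(?n + 1, CV), (?n, EV)] []"
      using eqd_whisker[OF zag_eqd v, of "[]"] by simp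
    \<comment> \<open>The coevaluation touches no wire of \<open>r\<close> and slides in front of
      it; what follows it is \<open>r\<close> with an evaluation, the shape to which
      \<open>eq\<close> applies.\<close>
    have s: "eqd w (r @ [(?n + 1, CV)]) ((length w, CV) # r)"
      using slide[OF r(1), of "[]" "[(0, CV)]"] r by (simp add: diagram_simps)
    have out: "out w (r @ [(?n + 1, CV)]) = v @ [Xd, X, Xd]"
      using r(2) by (simp add: layer_out_def)
    have e: "wf (v @ [Xd, X, Xd]) [(?n, EV)]"
      using v by (auto simp: diagram_simps)
    have "eqd w r (r @ [(?n + 1, CV), (?n, EV)])"
      using eqd_append[OF eqd_refl[OF r(1)] eqd_sym[OF z, folded r(2)]] by simp
    also have "eqd w \<dots> ((length w, CV) # r @ [(?n, EV)])"
      using eqd_append[OF s, of "[(?n, EV)]" "[(?n, EV)]"] eqd_refl[OF e] out by simp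
    finally show ?thesis .
  qed
  have "eqd w ([(length w, CV)] @ p @ [(length v, EV)]) ([(length w, CV)] @ q @ [(length v, EV)])"
  proof (rule eqd_append[OF eqd_refl])
    show "wf w [(length w, CV)]" using w by (auto simp: diagram_simps)
    show "eqd (out w [(length w, CV)]) (p @ [(length v, EV)]) (q @ [(length v, EV)])"
      using eqd_whisker[OF eq, of "[]" "[Xd]"] by (simp add: diagram_simps)
  qed
  then show ?thesis
    using eqd_cong[OF *[OF assms(1,3)] *[OF assms(2,4)]] by simp
qed

text \<open>Mirror image of \<open>ev_cancel\<close>: an additional input \<open>Xd\<close> on the
  left tests the first output, and \<open>zig_eqd\<close> recovers that output.\<close>

lemma cv_cancel:
  assumes "wf w p" "wf w q" "out w p = X # v" "out w q = X # v"
    and eq: "eqd (Xd # w) (shift 1 p @ [(0, EV)]) (shift 1 q @ [(0, EV)])"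
  shows "eqd w p q"
proof -
  have w: "set w \<subseteq> Obj C" using wf_Obj[OF assms(1)] .
  have v: "set v \<subseteq> Obj C" using out_Obj[OF assms(1)] assms(3) by simp
  have *: "eqd w r ((0, CV) # shift 1 (shift 1 r @ [(0, EV)]))"
    if r: "wf w r" "out w r = X # v" for r
  proof -
    have z: "eqd (X # v) [(0, CV), (1, EV)] []"
      using eqd_whisker[OF zig_eqd _ v, of "[]"] by simp
    have c: "wf [] [(0, CV)]" "out [] [(0, CV)] = [X, Xd]" by (simp_all add: diagram_simps)
    have s: "eqd w (r @ [(0, CV)]) ((0, CV) # shift 2 r)"
      using eqd_sym[OF slide[OF c(1) r(1)]] c(2) by (simp add: eval_nat_numeral)
    have out: "out w (r @ [(0, CV)]) = X # Xd # X # v"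
      using r(2) by (simp add: layer_out_def)
    have e: "wf (X # Xd # X # v) [(1, EV)]"
      using v by (auto simp: diagram_simps)
    have "eqd w r (r @ [(0, CV), (1, EV)])"
      using eqd_append[OF eqd_refl[OF r(1)] eqd_sym[OF z, folded r(2)]] by simp
    also have "eqd w \<dots> ((0, CV) # shift 2 r @ [(1, EV)])"
      using eqd_append[OF s, of "[(1, EV)]" "[(1, EV)]"] eqd_refl[OF e] out by simp
    also have "shift 2 r = shift 1 (shift 1 r)"
      by (induction r) auto
    finally show ?thesis by simp
  qed
  have "eqd w ([(0, CV)] @ shift 1 (shift 1 p @ [(0, EV)])) ([(0, CV)] @ shift 1 (shift 1 q @ [(0, EV)]))"
  proof (rule eqd_append[OF eqd_refl])
    show "wf w [(0, CV)]" using w by (auto simp: diagram_simps)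
    show "eqd (out w [(0, CV)]) (shift 1 (shift 1 p @ [(0, EV)])) (shift 1 (shift 1 q @ [(0, EV)]))"
      using eqd_whisker[OF eq, of "[X]" "[]"] by (simp add: diagram_simps)
  qed
  then show ?thesis
    using eqd_cong[OF *[OF assms(1,3)] *[OF assms(2,4)]] by simp
qed

text \<open>This pairs the first dual wire with the first wire of \<open>X \<otimes> X\<close>, unlike the nested evaluation.\<close>

definition ev2 :: "('a, 'b) diagram" where
  "ev2 = [(1, br Xd X), (0, EV), (0, EV)]"

text \<open>The inner evaluation has no output, so by naturality it can be dragged across the outer
  wire \<open>X\<close>. The crossings that appear are \<open>br X X\<close> and the one inside
  \<open>ev2\<close>. In \<open>ev2_br_left\<close> it is dragged across the outer \<open>Xd\<close>
  instead.\<close>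

lemma ev2_br_right: "eqd [Xd, Xd, X, X] ((2, br X X) # ev2) [(1, EV), (0, EV)]"
  unfolding ev2_def
  by (rule eqd_sym, rule rewrite[OF br_natural_left[of EV X],
        where k = 1 and pre = "[]" and post = "[(0, EV)]"])
    (simp_all add: diagram_simps)

lemma ev2_br_left: "eqd [Xd, Xd, X, X] ((0, br Xd Xd) # ev2) [(1, EV), (0, EV)]"
  unfolding ev2_def
  by (rule eqd_sym, rule rewrite[OF br_natural_right[of EV Xd],
        where k = 0 and pre = "[]" and post = "[(0, EV)]"])
    (simp_all add: diagram_simps)

lemma ev2_bri: "eqd [Xd, Xd, X, X] ev2 [(2, bri X X), (1, EV), (0, EV)]"
proof -
  have "eqd [Xd, Xd, X, X] ev2 ((2, bri X X) # (2, br X X) # ev2)"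
    by (rule eqd_sym, rule rewrite[OF br_bri(2)[of X X], where k = 2 and pre = "[]" and post = ev2])
      (simp_all add: diagram_simps ev2_def)
  also have "eqd [Xd, Xd, X, X] \<dots> [(2, bri X X), (1, EV), (0, EV)]"
    by (rule rewrite[OF ev2_br_right, where k = 0 and pre = "[(2, bri X X)]" and post = "[]"])
      (simp_all add: diagram_simps ev2_def)
  finally show ?thesis .
qed

lemma ev_ev_cancel:
  assumes p: "wf w p" "out w p = [Xd, Xd]" and q: "wf w q" "out w q = [Xd, Xd]"
    and eq: "eqd (w @ [X, X]) (p @ [(1, EV), (0, EV)]) (q @ [(1, EV), (0, EV)])"
  shows "eqd w p q"
proof (rule ev_cancel[OF p(1) q(1), of "[Xd]"])
  have *: "wf (w @ [X]) r \<and> out (w @ [X]) r = out w r @ [X]" if "wf w r" for r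
    using whisker[OF that, of "[]" "[X]"] by simp
  show "eqd (w @ [X]) (p @ [(length [Xd], EV)]) (q @ [(length [Xd], EV)])"
    by (rule ev_cancel[where v = "[]"])
      (use eq *[OF p(1)] *[OF q(1)] p(2) q(2) in \<open>simp_all add: diagram_simps\<close>)
qed (use p q in simp_all)

text \<open>Nested evaluations are cancelled by \<open>ev_ev_cancel\<close>, and they equal
  \<open>ev2\<close> after a crossing of the two \<open>X\<close> wires. These wires are inputs, so
  the crossing slides in front of the diagram and is common to both sides.\<close>

lemma ev2_cancel:
  assumes p: "wf w p" "out w p = [Xd, Xd]" and q: "wf w q" "out w q = [Xd, Xd]"
    and eq: "eqd (w @ [X, X]) (p @ ev2) (q @ ev2)"
  shows "eqd w p q"
proof (rule ev_ev_cancel[OF p q])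
  have *: "eqd (w @ [X, X]) (r @ [(1, EV), (0, EV)]) ((length w, br X X) # r @ ev2)"
    if r: "wf w r" "out w r = [Xd, Xd]" for r
  proof -
    have r': "wf (w @ [X, X]) r" "out (w @ [X, X]) r = [Xd, Xd, X, X]"
      using whisker[OF r(1), of "[]" "[X, X]"] r(2) by simp_all
    have s: "eqd (w @ [X, X]) (r @ [(2, br X X)]) ((length w, br X X) # r)"
      using slide[OF r(1), of "[X, X]" "[(0, br X X)]"] r(2) by (simp add: diagram_simps)
    have "eqd (w @ [X, X]) (r @ [(1, EV), (0, EV)]) (r @ (2, br X X) # ev2)"
      using eqd_append[OF eqd_refl[OF r'(1)], of "[(1, EV), (0, EV)]"] eqd_sym[OF ev2_br_right] r'(2)
      by simp
    also have "eqd (w @ [X, X]) \<dots> ((length w, br X X) # r @ ev2)"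
      using eqd_append[OF s eqd_refl[of _ ev2]] r'(2) by (simp add: diagram_simps ev2_def)
    finally show ?thesis .
  qed
  have "eqd (w @ [X, X]) ([(length w, br X X)] @ p @ ev2) ([(length w, br X X)] @ q @ ev2)"
    by (rule eqd_append[OF eqd_refl]) (use eq wf_Obj[OF p(1)] in \<open>auto simp: diagram_simps\<close>)
  then show "eqd (w @ [X, X]) (p @ [(1, EV), (0, EV)]) (q @ [(1, EV), (0, EV)])"
    using eqd_cong[OF *[OF p] *[OF q]] by simp
qed

text \<open>Now the tested wires are outputs, so \<open>ev2\<close> is replaced by the nested
  evaluation after an inverse crossing. That crossing is kept as part of \<open>?p\<close> and
  \<open>?q\<close> through both cancellations and undone at the end.\<close>

lemma ev2_cancel_right:
  assumes p: "wf w p" "out w p = [X, X]" and q: "wf w q" "out w q = [X, X]"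
    and eq: "eqd ([Xd, Xd] @ w) (shift 2 p @ ev2) (shift 2 q @ ev2)"
  shows "eqd w p q"
proof -
  have w: "set w \<subseteq> Obj C" using wf_Obj[OF p(1)] .
  have two: "shift (Suc (Suc 0)) r = shift (Suc 0) (shift (Suc 0) r)" for r :: "('a, 'b) diagram"
    by (induction r) auto
  have sh: "wf ([Xd, Xd] @ w) (shift 2 r) \<and> out ([Xd, Xd] @ w) (shift 2 r) = Xd # Xd # out w r"
    "wf (Xd # w) (shift 1 r) \<and> out (Xd # w) (shift 1 r) = Xd # out w r" if "wf w r" for r
    using whisker[OF that, of "[Xd, Xd]" "[]"] whisker[OF that, of "[Xd]" "[]"]
    by (simp_all add: eval_nat_numeral)
  let ?p = "p @ [(0, bri X X)]" and ?q = "q @ [(0, bri X X)]"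
  have wf: "wf w ?p" "wf w ?q" "out w ?p = [X, X]" "out w ?q = [X, X]"
    using p q by (simp_all add: diagram_simps)
  have *: "eqd ([Xd, Xd] @ w) (shift 2 r @ ev2)
     (shift 1 (shift 1 (r @ [(0, bri X X)]) @ [(0, EV)]) @ [(0, EV)])"
    if r: "wf w r" "out w r = [X, X]" for r
    using eqd_append[of "[Xd, Xd] @ w" "shift 2 r" "shift 2 r" ev2
        "[(2, bri X X), (1, EV), (0, EV)]"] sh[OF r(1)] ev2_bri r(2) w
    by (simp add: eqd_refl two eval_nat_numeral)
  have "eqd (Xd # Xd # w) (shift 1 (shift 1 ?p @ [(0, EV)]) @ [(0, EV)])
     (shift 1 (shift 1 ?q @ [(0, EV)]) @ [(0, EV)])"
    using eqd_cong[OF eqd_sym[OF *[OF p]] eqd_sym[OF *[OF q]] eq] by simp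
  then have "eqd (Xd # w) (shift 1 ?p @ [(0, EV)]) (shift 1 ?q @ [(0, EV)])"
    using sh(2)[OF wf(1)] sh(2)[OF wf(2)] wf(3,4)
    by (intro cv_cancel[where v = "[]" and w = "Xd # w"])
      (simp_all add: diagram_simps del: shift_append)
  then have "eqd w ?p ?q"
    using wf by (intro cv_cancel[where v = "[X]" and w = w]) simp_all
  then have c: "eqd w (?p @ [(0, br X X)]) (?q @ [(0, br X X)])"
    using wf by (intro eqd_append[of w ?p ?q]) (simp_all add: diagram_simps eqd_refl)
  have d: "eqd w r (r @ [(0, bri X X), (0, br X X)])" if r: "wf w r" "out w r = [X, X]" for r
    using eqd_append[OF eqd_refl[OF r(1)], of "[]" "[(0, bri X X), (0, br X X)]"]
      eqd_sym[OF br_bri(2)[of X X]] r(2) by simp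
  show ?thesis
    using eqd_cong[OF d[OF p] d[OF q]] c by simp
qed

end

section \<open>Structure maps of bialgebras as nodes\<close>

definition mult_node :: "('a, 'b, 's) bialg_scheme \<Rightarrow> ('a, 'b) node" where
  "mult_node K = Node [ob K, ob K] [ob K] (mult K)"

definition unt_node :: "('a, 'b, 's) bialg_scheme \<Rightarrow> ('a, 'b) node" where
  "unt_node K = Node [] [ob K] (unt K)"

definition comult_node :: "('a, 'b, 's) bialg_scheme \<Rightarrow> ('a, 'b) node" where
  "comult_node K = Node [ob K] [ob K, ob K] (comult K)"

definition counit_node :: "('a, 'b, 's) bialg_scheme \<Rightarrow> ('a, 'b) node" where
  "counit_node K = Node [ob K] [] (counit K)"

lemma node_ports [simp]:
  "src (mult_node K) = [ob K, ob K]" "tgt (mult_node K) = [ob K]"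
  "src (unt_node K) = []" "tgt (unt_node K) = [ob K]"
  "src (comult_node K) = [ob K]" "tgt (comult_node K) = [ob K, ob K]"
  "src (counit_node K) = [ob K]" "tgt (counit_node K) = []"
  by (simp_all add: mult_node_def unt_node_def comult_node_def counit_node_def)

context strict_monoidal_category
begin

text \<open>This records just the types, which is what drawing the structure maps as nodes requires.
  The axioms enter singly, as hypotheses of the lemmas on the dual.\<close>

definition is_prebialgebra :: "('a, 'b, 's) bialg_scheme \<Rightarrow> bool" where
  "is_prebialgebra K \<longleftrightarrow> ob K \<in> Obj C
     \<and> mult K \<in> Hom C (ob K \<boxtimes> ob K) (ob K) \<and> unt K \<in> Hom C (UnitOb C) (ob K)
     \<and> comult K \<in> Hom C (ob K) (ob K \<boxtimes> ob K) \<and> counit K \<in> Hom C (ob K) (UnitOb C)"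

lemma prebialgebra:
  assumes "is_prebialgebra K"
  shows "ob K \<in> Obj C" "is_node (mult_node K)" "is_node (unt_node K)"
    "is_node (comult_node K)" "is_node (counit_node K)"
    "mult K = sem [ob K, ob K] [(0, mult_node K)]"
    "unt K = sem [] [(0, unt_node K)]"
    "comult K = sem [ob K] [(0, comult_node K)]"
    "counit K = sem [ob K] [(0, counit_node K)]"
proof -
  have K: "ob K \<in> Obj C" "mult K \<in> Hom C (ob K \<boxtimes> ob K) (ob K)" "unt K \<in> Hom C (UnitOb C) (ob K)"
     "comult K \<in> Hom C (ob K) (ob K \<boxtimes> ob K)" "counit K \<in> Hom C (ob K) (UnitOb C)"
    using assms by (auto simp: is_prebialgebra_def)
  then show "ob K \<in> Obj C" by blast
  show "is_node (mult_node K)" "mult K = sem [ob K, ob K] [(0, mult_node K)]"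
    using K sem_NodeI[OF _ _ _ mult_node_def[of K]] by (simp_all add: ObTensor_unit_right)
  show "is_node (unt_node K)" "unt K = sem [] [(0, unt_node K)]"
    using K sem_NodeI[OF _ _ _ unt_node_def[of K]] by (simp_all add: ObTensor_unit_right)
  show "is_node (comult_node K)" "comult K = sem [ob K] [(0, comult_node K)]"
    using K sem_NodeI[OF _ _ _ comult_node_def[of K]] by (simp_all add: ObTensor_unit_right)
  show "is_node (counit_node K)" "counit K = sem [ob K] [(0, counit_node K)]"
    using K sem_NodeI[OF _ _ _ counit_node_def[of K]] by (simp_all add: ObTensor_unit_right)
qed

end

context braided_monoidal_category
begin

lemma is_commutative_eqd:
  assumes "is_prebialgebra K"
  shows "is_commutative C K
    \<longleftrightarrow> eqd [ob K, ob K] [(0, br (ob K) (ob K)), (0, mult_node K)] [(0, mult_node K)]"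
  using prebialgebra[OF assms]
  by (simp add: is_commutative_def eqd_def diagram_simps br_sem reify)

lemma is_cocommutative_eqd:
  assumes "is_prebialgebra K"
  shows "is_cocommutative C K
    \<longleftrightarrow> eqd [ob K] [(0, comult_node K), (0, br (ob K) (ob K))] [(0, comult_node K)]"
  using prebialgebra[OF assms]
  by (simp add: is_cocommutative_def eqd_def diagram_simps br_sem reify)

end

context finite_dual
begin

text \<open>The comultiplication is a definite description, so its defining equation has to be
  earned: existence comes from the diagram \<open>?d\<close>, uniqueness from
  \<open>ev2_cancel\<close>.\<close>

lemma dual_comult:
  assumes "is_prebialgebra K" "ob K = X"
  shows "dual_comult C K Xd ev \<in> Hom C Xd (Xd \<boxtimes> Xd)
     \<and> ev \<otimes> ev \<cdot> Id C Xd \<otimes> Braid C Xd X \<otimes> Id C X \<cdot> dual_comult C K Xd ev \<otimes> Id C X \<otimes> Id C X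
       = ev \<cdot> Id C Xd \<otimes> mult K"
proof -
  note K = prebialgebra[OF assms(1), unfolded assms(2)]
  note [simp] = K(1-5) assms(2)
  let ?m = "mult_node K"
  let ?P = "\<lambda>d. d \<in> Hom C Xd (Xd \<boxtimes> Xd)
     \<and> ev \<otimes> ev \<cdot> Id C Xd \<otimes> Braid C Xd X \<otimes> Id C X \<cdot> d \<otimes> Id C X \<otimes> Id C X
       = ev \<cdot> Id C Xd \<otimes> mult K"
  have P: "?P (sem [Xd] p) \<longleftrightarrow> eqd [Xd, X, X] (p @ ev2) [(1, ?m), (0, EV)]"
    if p: "wf [Xd] p" "out [Xd] p = [Xd, Xd]" for p
  proof -
    have "sem [Xd] p \<in> Hom C Xd (Xd \<boxtimes> Xd)"
      using sem_Hom[OF p(1)] p(2) by (simp add: ObTensor_unit_right)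
    moreover have "wf [Xd, X, X] p" "out [Xd, X, X] p = [Xd, Xd, X, X]"
      using whisker[OF p(1), of "[]" "[X, X]"] p(2) by simp_all
    ultimately show ?thesis
      using p by (simp add: diagram_simps ev_sem K(6) br_sem reify eqd_def ev2_def)
  qed
  \<comment> \<open>Two coevaluations supply the inputs of the multiplication, and the product is
    evaluated. The crossing makes up for the inverse crossing by which \<open>ev2\<close> differs
    from the nested evaluation.\<close>
  let ?d = "[(1, CV), (2, CV), (1, br X X), (1, ?m), (0, EV)]"
  have d: "wf [Xd] ?d" "out [Xd] ?d = [Xd, Xd]"
    by (simp_all add: diagram_simps)
  have "eqd [Xd, X, X] (?d @ ev2) [(1, bri X X), (2, CV), (3, EV), (1, CV), (2, EV), (1, br X X), (1, ?m), (0, EV)]"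
    by (rule rewrite[OF ev2_bri[unfolded ev2_def], where k = 0 and pre = "[(1, CV), (2, CV), (1, br X X), (1, ?m), (0, EV)]"
        and post = "[]"]) (simp_all add: diagram_simps ev2_def)
  also have "eqd [Xd, X, X] \<dots> [(1, bri X X), (1, CV), (2, EV), (1, br X X), (1, ?m), (0, EV)]"
    by (rule rewrite[OF zig_eqd, where k = 2 and pre = "[(1, CV), (3, bri X X), (2, EV)]"
        and post = "[(1, br X X), (1, ?m), (0, EV)]"]) (simp_all add: diagram_simps)
  also have "eqd [Xd, X, X] \<dots> [(1, bri X X), (1, br X X), (1, ?m), (0, EV)]"
    by (rule rewrite[OF zig_eqd, where k = 1 and pre = "[(1, bri X X)]"
        and post = "[(1, br X X), (1, ?m), (0, EV)]"]) (simp_all add: diagram_simps)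
  also have "eqd [Xd, X, X] \<dots> [(1, ?m), (0, EV)]"
    by (rule rewrite[OF br_bri(2)[OF X_Obj X_Obj], where k = 1 and pre = "[]"
        and post = "[(1, ?m), (0, EV)]"]) (simp_all add: diagram_simps)
  finally have d_eqd: "eqd [Xd, X, X] (?d @ ev2) [(1, ?m), (0, EV)]" .
  then have ex: "?P (sem [Xd] ?d)"
    using P[OF d] by blast
  have "d' = sem [Xd] ?d" if "?P d'" for d'
  proof -
    define g where "g = Node [Xd] [Xd, Xd] d'"
    have g: "is_node g" "src g = [Xd]" "tgt g = [Xd, Xd]" "d' = sem [Xd] [(0, g)]"
      using sem_NodeI[OF _ _ _ g_def] that by (simp_all add: ObTensor_unit_right)
    have w: "wf [Xd] [(0, g)]" "out [Xd] [(0, g)] = [Xd, Xd]"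
      using g by (simp_all add: diagram_simps)
    have "eqd [Xd] [(0, g)] ?d"
    proof (rule ev2_cancel[OF w d])
      show "eqd ([Xd] @ [X, X]) ([(0, g)] @ ev2) (?d @ ev2)"
        using eqd_trans[OF _ eqd_sym[OF d_eqd]] P[OF w] that[unfolded g(4)] by simp
    qed
    then show ?thesis using g(4) by (simp add: eqd_def)
  qed
  with ex have "?P (THE d. ?P d)"
    by (intro theI[of ?P])
  then show ?thesis
    unfolding dual_comult_def assms(2) .
qed

section \<open>Structure maps of a dual, tested by evaluation\<close>

context
  fixes K :: "('a, 'b, 's) bialg_scheme" and L :: "('a, 'b) bialg"
  assumes K: "is_prebialgebra K" and ob_K [simp]: "ob K = X"
    and L: "L = dual_bialg C K Xd ev"
begin

lemmas K_nodes = prebialgebra[OF K, unfolded ob_K]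

lemma ob_L [simp]: "ob L = Xd"
  by (simp add: L dual_bialg_def)

lemma dual_mult_aux:
  "dual_mult C K Xd ev \<in> Hom C (Xd \<boxtimes> Xd) Xd \<and> ev \<cdot> dual_mult C K Xd ev \<otimes> Id C X
    = (ev \<otimes> ev \<cdot> Id C Xd \<otimes> Braid C Xd X \<otimes> Id C X \<cdot> Id C Xd \<otimes> Id C Xd \<otimes> comult K)"
  unfolding dual_mult_def ob_K
proof (rule transpose)
  let ?p = "[(2, comult_node K), (1, br Xd X), (0, EV), (0, EV)]"
  have "ev \<otimes> ev \<cdot> Id C Xd \<otimes> Braid C Xd X \<otimes> Id C X \<cdot> Id C Xd \<otimes> Id C Xd \<otimes> comult K
      = sem [Xd, Xd, X] ?p"
    using K_nodes by (simp add: diagram_simps ev_sem br_sem reify)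
  moreover have "wf [Xd, Xd, X] ?p" "out [Xd, Xd, X] ?p = []"
    using K_nodes by (simp_all add: diagram_simps)
  ultimately show "ev \<otimes> ev \<cdot> Id C Xd \<otimes> Braid C Xd X \<otimes> Id C X \<cdot> Id C Xd \<otimes> Id C Xd \<otimes> comult K
      \<in> Hom C ((Xd \<boxtimes> Xd) \<boxtimes> X) (UnitOb C)"
    using sem_Hom[of "[Xd, Xd, X]" ?p] by (simp add: ObTensor_unit_right ObTensor_assoc)
qed (simp add: ObTensor_Obj)

lemma dual_unit_aux:
  "dual_unit C K Xd ev \<in> Hom C (UnitOb C) Xd \<and> ev \<cdot> dual_unit C K Xd ev \<otimes> Id C X = counit K"
  unfolding dual_unit_def ob_K
  using K by (intro transpose) (simp_all add: UnitOb_Obj ObTensor_unit_left is_prebialgebra_def)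

lemma dual_prebialgebra: "is_prebialgebra L"
  unfolding is_prebialgebra_def
proof (intro conjI)
  show "counit L \<in> Hom C (ob L) (UnitOb C)"
    using Comp_Hom[OF Tensor_Hom[OF Id_Hom[OF Xd_Obj], of "unt K" "UnitOb C" X] ev_Hom] K
    by (simp add: is_prebialgebra_def L dual_bialg_def dual_counit_def ObTensor_unit_right)
qed (use dual_mult_aux dual_unit_aux dual_comult[OF K ob_K] in \<open>simp_all add: L dual_bialg_def\<close>)

lemmas L_nodes = prebialgebra[OF dual_prebialgebra, unfolded ob_L]

lemma L_simps [simp]:
  "is_node (mult_node K)" "is_node (unt_node K)" "is_node (comult_node K)" "is_node (counit_node K)"
  "is_node (mult_node L)" "is_node (unt_node L)" "is_node (comult_node L)" "is_node (counit_node L)"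
  using K_nodes L_nodes by simp_all

lemma dual_mult_eqd: "eqd [Xd, Xd, X] [(0, mult_node L), (0, EV)] ((2, comult_node K) # ev2)"
proof -
  have "ev \<cdot> mult L \<otimes> Id C X
    = (ev \<otimes> ev \<cdot> Id C Xd \<otimes> Braid C Xd X \<otimes> Id C X \<cdot> Id C Xd \<otimes> Id C Xd \<otimes> comult K)"
    using dual_mult_aux by (simp add: L dual_bialg_def)
  then show ?thesis
    by (simp add: eqd_def diagram_simps ev_sem br_sem reify K_nodes(6-9) L_nodes(6-9) ev2_def)
qed

lemma dual_unt_eqd: "eqd [X] [(0, unt_node L), (0, EV)] [(0, counit_node K)]"
proof -
  have "ev \<cdot> unt L \<otimes> Id C X = counit K"
    using dual_unit_aux by (simp add: L dual_bialg_def)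
  then show ?thesis
    by (simp add: eqd_def diagram_simps ev_sem br_sem reify K_nodes(6-9) L_nodes(6-9))
qed

lemma dual_comult_eqd: "eqd [Xd, X, X] ((0, comult_node L) # ev2) [(1, mult_node K), (0, EV)]"
proof -
  have "ev \<otimes> ev \<cdot> Id C Xd \<otimes> Braid C Xd X \<otimes> Id C X \<cdot> comult L \<otimes> Id C X \<otimes> Id C X
       = ev \<cdot> Id C Xd \<otimes> mult K"
    using dual_comult[OF K ob_K] by (simp add: L dual_bialg_def)
  then show ?thesis
    by (simp add: eqd_def diagram_simps ev_sem br_sem reify K_nodes(6-9) L_nodes(6-9) ev2_def)
qed

lemma dual_counit_eqd: "eqd [Xd] [(0, counit_node L)] [(1, unt_node K), (0, EV)]"
proof -
  have "counit L = ev \<cdot> Id C Xd \<otimes> unt K"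
    by (simp add: L dual_bialg_def dual_counit_def)
  then show ?thesis
    by (simp add: eqd_def diagram_simps ev_sem br_sem reify K_nodes(6-9) L_nodes(6-9))
qed

lemma ev2_br: "eqd [Xd, Xd, X, X] ((0, br Xd Xd) # ev2) ((2, br X X) # ev2)"
  using ev2_br_left ev2_br_right eqd_sym eqd_trans by blast

lemma dual_commutative_iff: "is_commutative C L \<longleftrightarrow> is_cocommutative C K"
proof -
  let ?c = "comult_node K" and ?m = "mult_node L"
  have 1: "eqd [Xd, Xd, X] [(0, br Xd Xd), (0, ?m), (0, EV)] ([(2, ?c), (2, br X X)] @ ev2)"
  proof -
    have "eqd [Xd, Xd, X] [(0, br Xd Xd), (0, ?m), (0, EV)] ([(2, ?c), (0, br Xd Xd)] @ ev2)"
      by (rule rewrite[OF dual_mult_eqd, where k = 0 and pre = "[(0, br Xd Xd)]" and post = "[]"])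
        (simp_all add: diagram_simps ev2_def)
    also have "eqd [Xd, Xd, X] \<dots> ([(2, ?c), (2, br X X)] @ ev2)"
      by (rule rewrite[OF ev2_br, where k = 0 and pre = "[(2, ?c)]" and post = "[]"])
        (simp_all add: diagram_simps ev2_def)
    finally show ?thesis .
  qed
  have "is_commutative C L \<longleftrightarrow> eqd [Xd, Xd] [(0, br Xd Xd), (0, ?m)] [(0, ?m)]"
    using is_commutative_eqd[OF dual_prebialgebra] by simp
  also have "\<dots> \<longleftrightarrow> eqd [Xd, Xd, X] [(0, br Xd Xd), (0, ?m), (0, EV)] [(0, ?m), (0, EV)]"
  proof
    assume "eqd [Xd, Xd] [(0, br Xd Xd), (0, ?m)] [(0, ?m)]"
    then show "eqd [Xd, Xd, X] [(0, br Xd Xd), (0, ?m), (0, EV)] [(0, ?m), (0, EV)]"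
      by (rule rewrite[where k = 0 and pre = "[]" and post = "[(0, EV)]"])
        (simp_all add: diagram_simps)
  next
    assume "eqd [Xd, Xd, X] [(0, br Xd Xd), (0, ?m), (0, EV)] [(0, ?m), (0, EV)]"
    then show "eqd [Xd, Xd] [(0, br Xd Xd), (0, ?m)] [(0, ?m)]"
      by (intro ev_cancel[where v = "[]" and w = "[Xd, Xd]"]) (simp_all add: diagram_simps)
  qed
  also have "\<dots> \<longleftrightarrow> eqd [Xd, Xd, X] ([(2, ?c), (2, br X X)] @ ev2) ((2, ?c) # ev2)"
    using 1 dual_mult_eqd eqd_sym eqd_trans by meson
  also have "\<dots> \<longleftrightarrow> eqd [X] [(0, ?c), (0, br X X)] [(0, ?c)]"
  proof
    assume "eqd [Xd, Xd, X] ([(2, ?c), (2, br X X)] @ ev2) ((2, ?c) # ev2)"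
    then show "eqd [X] [(0, ?c), (0, br X X)] [(0, ?c)]"
      by (intro ev2_cancel_right[where w = "[X]"]) (simp_all add: diagram_simps)
  next
    assume "eqd [X] [(0, ?c), (0, br X X)] [(0, ?c)]"
    then show "eqd [Xd, Xd, X] ([(2, ?c), (2, br X X)] @ ev2) ((2, ?c) # ev2)"
      by (rule rewrite[where k = 2 and pre = "[]" and post = ev2])
        (simp_all add: diagram_simps ev2_def)
  qed
  also have "\<dots> \<longleftrightarrow> is_cocommutative C K"
    using is_cocommutative_eqd[OF K] by simp
  finally show ?thesis .
qed

lemma dual_cocommutative_iff: "is_cocommutative C L \<longleftrightarrow> is_commutative C K"
proof -
  let ?c = "comult_node L" and ?m = "mult_node K"
  have 1: "eqd [Xd, X, X] ([(0, ?c), (0, br Xd Xd)] @ ev2) [(1, br X X), (1, ?m), (0, EV)]"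
  proof -
    have "eqd [Xd, X, X] ([(0, ?c), (0, br Xd Xd)] @ ev2) ([(0, ?c), (2, br X X)] @ ev2)"
      by (rule rewrite[OF ev2_br, where k = 0 and pre = "[(0, ?c)]" and post = "[]"])
        (simp_all add: diagram_simps ev2_def)
    also have "eqd [Xd, X, X] \<dots> [(1, br X X), (1, ?m), (0, EV)]"
      by (rule rewrite[OF dual_comult_eqd, where k = 0 and pre = "[(1, br X X)]" and post = "[]"])
        (simp_all add: diagram_simps ev2_def)
    finally show ?thesis .
  qed
  have "is_cocommutative C L \<longleftrightarrow> eqd [Xd] [(0, ?c), (0, br Xd Xd)] [(0, ?c)]"
    using is_cocommutative_eqd[OF dual_prebialgebra] by simp
  also have "\<dots> \<longleftrightarrow> eqd [Xd, X, X] ([(0, ?c), (0, br Xd Xd)] @ ev2) ((0, ?c) # ev2)"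
  proof
    assume "eqd [Xd] [(0, ?c), (0, br Xd Xd)] [(0, ?c)]"
    then show "eqd [Xd, X, X] ([(0, ?c), (0, br Xd Xd)] @ ev2) ((0, ?c) # ev2)"
      by (rule rewrite[where k = 0 and pre = "[]" and post = ev2])
        (simp_all add: diagram_simps ev2_def)
  next
    assume "eqd [Xd, X, X] ([(0, ?c), (0, br Xd Xd)] @ ev2) ((0, ?c) # ev2)"
    then show "eqd [Xd] [(0, ?c), (0, br Xd Xd)] [(0, ?c)]"
      by (intro ev2_cancel[where w = "[Xd]"]) (simp_all add: diagram_simps)
  qed
  also have "\<dots> \<longleftrightarrow> eqd [Xd, X, X] [(1, br X X), (1, ?m), (0, EV)] [(1, ?m), (0, EV)]"
    using 1 dual_comult_eqd eqd_sym eqd_trans by meson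
  also have "\<dots> \<longleftrightarrow> eqd [X, X] [(0, br X X), (0, ?m)] [(0, ?m)]"
  proof
    assume "eqd [Xd, X, X] [(1, br X X), (1, ?m), (0, EV)] [(1, ?m), (0, EV)]"
    then show "eqd [X, X] [(0, br X X), (0, ?m)] [(0, ?m)]"
      by (intro cv_cancel[where w = "[X, X]" and v = "[]"]) (simp_all add: diagram_simps)
  next
    assume "eqd [X, X] [(0, br X X), (0, ?m)] [(0, ?m)]"
    then show "eqd [Xd, X, X] [(1, br X X), (1, ?m), (0, EV)] [(1, ?m), (0, EV)]"
      by (rule rewrite[where k = 1 and pre = "[]" and post = "[(0, EV)]"])
        (simp_all add: diagram_simps)
  qed
  also have "\<dots> \<longleftrightarrow> is_commutative C K"
    using is_commutative_eqd[OF K] by simp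
  finally show ?thesis .
qed

text \<open>Here and in the next three lemmas a law of the dual is derived from the one law of
  \<open>K\<close> that appears as the hypothesis. In this form they apply to the opposite of
  \<open>H\<close> once the law in question is checked there.\<close>

lemma dual_unit_idem:
  assumes "eqd [X] [(0, comult_node K), (0, counit_node K)] []"
  shows "eqd [] [(0, unt_node L), (0, unt_node L), (0, mult_node L)] [(0, unt_node L)]"
proof -
  have "eqd [X] [(0, unt_node L), (0, unt_node L), (0, mult_node L), (0, EV)] [(0, unt_node L), (0, EV)]"
  proof -
    have "eqd [X] [(0, unt_node L), (0, unt_node L), (0, mult_node L), (0, EV)] [(0, comult_node K), (0, unt_node L), (0, br Xd X), (1, EV), (0, unt_node L), (0, EV)]"
      by (rule rewrite[OF dual_mult_eqd[unfolded ev2_def], where k = 0 and pre = "[(0, unt_node L), (0, unt_node L)]"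
          and post = "[]"]) (simp_all add: diagram_simps)
    also have "eqd [X] \<dots> [(0, comult_node K), (1, unt_node L), (1, EV), (0, unt_node L), (0, EV)]"
      by (rule rewrite[OF br_natural_left[of "unt_node L" X, simplified], where k = 0 and pre = "[(0, comult_node K)]"
          and post = "[(0, unt_node L), (0, EV), (0, EV)]"]) (simp_all add: diagram_simps)
    also have "eqd [X] \<dots> [(0, comult_node K), (1, unt_node L), (1, EV), (0, counit_node K)]"
      by (rule rewrite[OF dual_unt_eqd, where k = 0 and pre = "[(0, comult_node K)]"
          and post = "[(0, unt_node L), (0, EV)]"]) (simp_all add: diagram_simps)
    also have "eqd [X] \<dots> [(0, comult_node K), (1, counit_node K), (0, counit_node K)]"
      by (rule rewrite[OF dual_unt_eqd, where k = 0 and pre = "[(0, comult_node K), (0, counit_node K)]"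
          and post = "[]"]) (simp_all add: diagram_simps)
    also have "eqd [X] \<dots> [(0, counit_node K)]"
      by (rule rewrite[OF assms, where k = 0 and pre = "[]"
          and post = "[(0, counit_node K)]"]) (simp_all add: diagram_simps)
    also have "eqd [X] \<dots> [(0, unt_node L), (0, EV)]"
      by (rule rewrite[OF eqd_sym[OF dual_unt_eqd], where k = 0 and pre = "[]"
          and post = "[]"]) (simp_all add: diagram_simps)
    finally show ?thesis .
  qed
  then show ?thesis
    by (intro ev_cancel[where v = "[]" and w = "[]"]) (simp_all add: diagram_simps)
qed

lemma dual_counit_unit:
  assumes "eqd [] [(0, unt_node K), (0, counit_node K)] []"
  shows "eqd [] [(0, unt_node L), (0, counit_node L)] []"
proof -
  have "eqd [] [(0, unt_node L), (0, counit_node L)] [(0, unt_node K), (0, unt_node L), (0, EV)]"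
    by (rule rewrite[OF dual_counit_eqd, where k = 0 and pre = "[(0, unt_node L)]"
        and post = "[]"]) (simp_all add: diagram_simps)
  also have "eqd [] \<dots> [(0, unt_node K), (0, counit_node K)]"
    by (rule rewrite[OF dual_unt_eqd, where k = 0 and pre = "[(0, unt_node K)]"
        and post = "[]"]) (simp_all add: diagram_simps)
  also have "eqd [] \<dots> []"
    by (rule rewrite[OF assms, where k = 0 and pre = "[]"
        and post = "[]"]) (simp_all add: diagram_simps)
  finally show ?thesis .
qed

lemma dual_counit_right:
  assumes "eqd [X] [(1, unt_node K), (0, mult_node K)] []"
  shows "eqd [Xd] [(0, comult_node L), (1, counit_node L)] []"
proof -
  have "eqd [Xd, X] [(0, comult_node L), (1, counit_node L), (0, EV)] [(0, EV)]"
  proof -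
    have "eqd [Xd, X] [(0, comult_node L), (1, counit_node L), (0, EV)] [(0, comult_node L), (1, br Xd X), (2, counit_node L), (0, EV)]"
      by (rule rewrite[OF br_natural_left[of "counit_node L" X, simplified], where k = 1 and pre = "[(0, comult_node L)]"
          and post = "[(0, EV)]"]) (simp_all add: diagram_simps)
    also have "eqd [Xd, X] \<dots> [(2, unt_node K), (0, comult_node L), (1, br Xd X), (2, EV), (0, EV)]"
      by (rule rewrite[OF dual_counit_eqd, where k = 0 and pre = "[(0, comult_node L), (1, br Xd X), (0, EV)]"
          and post = "[]"]) (simp_all add: diagram_simps)
    also have "eqd [Xd, X] \<dots> [(2, unt_node K), (1, mult_node K), (0, EV)]"
      by (rule rewrite[OF dual_comult_eqd[unfolded ev2_def], where k = 0 and pre = "[(2, unt_node K)]"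
          and post = "[]"]) (simp_all add: diagram_simps)
    also have "eqd [Xd, X] \<dots> [(0, EV)]"
      by (rule rewrite[OF assms, where k = 1 and pre = "[]"
          and post = "[(0, EV)]"]) (simp_all add: diagram_simps)
    finally show ?thesis .
  qed
  then show ?thesis
    by (intro ev_cancel[where v = "[]" and w = "[Xd]"]) (simp_all add: diagram_simps)
qed

lemma dual_comult_unit:
  assumes "eqd [X, X] [(0, mult_node K), (0, counit_node K)] [(0, counit_node K), (0, counit_node K)]"
  shows "eqd [] [(0, unt_node L), (0, comult_node L)] [(0, unt_node L), (0, unt_node L)]"
proof -
  have "eqd [X, X] [(0, unt_node L), (0, comult_node L), (1, br Xd X), (0, EV), (0, EV)] [(0, unt_node L), (0, unt_node L), (1, br Xd X), (0, EV), (0, EV)]"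
  proof -
    have "eqd [X, X] [(0, unt_node L), (0, comult_node L), (1, br Xd X), (0, EV), (0, EV)] [(0, mult_node K), (0, unt_node L), (0, EV)]"
      by (rule rewrite[OF dual_comult_eqd[unfolded ev2_def], where k = 0 and pre = "[(0, unt_node L)]"
          and post = "[]"]) (simp_all add: diagram_simps)
    also have "eqd [X, X] \<dots> [(0, mult_node K), (0, counit_node K)]"
      by (rule rewrite[OF dual_unt_eqd, where k = 0 and pre = "[(0, mult_node K)]"
          and post = "[]"]) (simp_all add: diagram_simps)
    also have "eqd [X, X] \<dots> [(1, counit_node K), (0, counit_node K)]"
      by (rule rewrite[OF assms, where k = 0 and pre = "[]"
          and post = "[]"]) (simp_all add: diagram_simps)
    also have "eqd [X, X] \<dots> [(1, counit_node K), (0, unt_node L), (0, EV)]"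
      by (rule rewrite[OF eqd_sym[OF dual_unt_eqd], where k = 0 and pre = "[]"
          and post = "[(0, counit_node K)]"]) (simp_all add: diagram_simps)
    also have "eqd [X, X] \<dots> [(1, unt_node L), (1, EV), (0, unt_node L), (0, EV)]"
      by (rule rewrite[OF eqd_sym[OF dual_unt_eqd], where k = 0 and pre = "[(0, unt_node L), (0, EV)]"
          and post = "[]"]) (simp_all add: diagram_simps)
    also have "eqd [X, X] \<dots> [(0, unt_node L), (0, unt_node L), (1, br Xd X), (0, EV), (0, EV)]"
      by (rule rewrite[OF eqd_sym[OF br_natural_left[of "unt_node L" X, simplified]], where k = 1 and pre = "[(0, unt_node L)]"
          and post = "[(0, EV), (0, EV)]"]) (simp_all add: diagram_simps)
    finally show ?thesis .
  qed
  then show ?thesis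
    by (intro ev2_cancel[where w = "[]"]) (simp_all add: diagram_simps ev2_def)
qed

end

end

section \<open>Coevaluations of finite objects, and retracts\<close>

context braided_monoidal_category
begin

text \<open>The coevaluation is the preimage of the identity under the dual basis isomorphism.
  Finiteness provides it for some internal hom \<open>Y\<close>; the comparison arrow
  \<open>\<phi>\<close> carries it over to the prescribed \<open>Xd\<close>.\<close>

lemma finite_dual_exists:
  assumes X: "X \<in> Obj C" and fin: "finite_object C X"
    and hom: "is_internal_hom C X (UnitOb C) Xd ev"
  shows "\<exists>CV. finite_dual C X Xd (Node [Xd, X] [] ev) CV"
proof -
  obtain Y e E e' where Y: "is_internal_hom C X (UnitOb C) Y e" and E: "is_internal_hom C X X E e'"
    and iso: "is_iso C (dual_basis C X Y e E e')"
    using fin by (auto simp: finite_object_def)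
  let ?I = "UnitOb C"
  note [simp] = ObTensor_unit_right ObTensor_unit_left ObTensor_Obj UnitOb_Obj
  have obj [simp]: "X \<in> Obj C" "Y \<in> Obj C" "E \<in> Obj C" "Xd \<in> Obj C"
    and homs: "e \<in> Hom C (Y \<boxtimes> X) ?I" "e' \<in> Hom C (E \<boxtimes> X) X" "ev \<in> Hom C (Xd \<boxtimes> X) ?I"
    using X Y E hom by (auto simp: is_internal_hom_def)
  define b where "b = dual_basis C X Y e E e'"
  have "Id C X \<otimes> e \<in> Hom C ((X \<boxtimes> Y) \<boxtimes> X) X"
    using Tensor_Hom[OF Id_Hom[OF X] homs(1)] by (simp add: ObTensor_assoc)
  then have "\<exists>!g. g \<in> Hom C (X \<boxtimes> Y) E \<and> e' \<cdot> g \<otimes> Id C X = Id C X \<otimes> e"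
    using E by (simp add: is_internal_hom_def)
  then have "b \<in> Hom C (X \<boxtimes> Y) E \<and> e' \<cdot> b \<otimes> Id C X = Id C X \<otimes> e"
    unfolding b_def dual_basis_def transpose_def by (rule theI')
  then have b: "b \<in> Hom C (X \<boxtimes> Y) E" "e' \<cdot> b \<otimes> Id C X = Id C X \<otimes> e" by blast+
  obtain i where i: "i \<in> Hom C E (X \<boxtimes> Y)" "b \<cdot> i = Id C E"
    using iso HomD[OF b(1)] unfolding is_iso_def is_inverse_def b_def by metis
  \<comment> \<open>The arrow \<open>j\<close> obtained from this is the identity of
    \<open>X\<close>, seen as a point of the internal hom \<open>E\<close>.\<close>
  have "\<exists>!g. g \<in> Hom C ?I E \<and> e' \<cdot> g \<otimes> Id C X = Id C X"
    using E Id_Hom[OF X] by (simp add: is_internal_hom_def)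
  then obtain j where j: "j \<in> Hom C ?I E" "e' \<cdot> j \<otimes> Id C X = Id C X" by blast
  obtain \<phi> where \<phi>: "\<phi> \<in> Hom C Y Xd" "ev \<cdot> \<phi> \<otimes> Id C X = e"
    using hom homs(1) obj(2) unfolding is_internal_hom_def by blast
  define gj gb gi ge gf gp gv
    where defs: "gj = Node [] [E] j" "gb = Node [X, Y] [E] b" "gi = Node [E] [X, Y] i"
      "ge = Node [Y, X] [] e" "gf = Node [E, X] [X] e'" "gp = Node [Y] [Xd] \<phi>"
      "gv = Node [Xd, X] [] ev"
  have ports [simp]: "src gj = []" "tgt gj = [E]" "src gb = [X, Y]" "tgt gb = [E]"
    "src gi = [E]" "tgt gi = [X, Y]" "src ge = [Y, X]" "tgt ge = []" "src gf = [E, X]" "tgt gf = [X]"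
    "src gp = [Y]" "tgt gp = [Xd]" "src gv = [Xd, X]" "tgt gv = []"
    by (simp_all add: defs)
  have nodes [simp]: "is_node gj" "is_node gb" "is_node gi" "is_node ge" "is_node gf" "is_node gp"
    "is_node gv"
    using b i j \<phi> homs by (simp_all add: defs is_node_def)
  have sems: "j = sem [] [(0, gj)]" "b = sem [X, Y] [(0, gb)]" "i = sem [E] [(0, gi)]"
    "e = sem [Y, X] [(0, ge)]" "e' = sem [E, X] [(0, gf)]" "\<phi> = sem [Y] [(0, gp)]"
    "ev = sem [Xd, X] [(0, gv)]"
    using nodes[THEN sem_node] by (simp_all add: defs)
  have R1: "eqd [X, Y, X] [(0, gb), (0, gf)] [(1, ge)]"
    using b(2) by (simp add: eqd_def diagram_simps sems reify)
  have R2: "eqd [X] [(0, gj), (0, gf)] []"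
    using j(2) by (simp add: eqd_def diagram_simps sems reify)
  have R3: "eqd [Y, X] [(0, gp), (0, gv)] [(0, ge)]"
    using \<phi>(2) by (simp add: eqd_def diagram_simps sems reify)
  have R4: "eqd [E] [(0, gi), (0, gb)] []"
    using i(2) by (simp add: eqd_def diagram_simps sems reify)
  have z: "eqd [X] [(0, gj), (0, gi), (1, gp), (1, gv)] []"
  proof -
    have "eqd [X] [(0, gj), (0, gi), (1, gp), (1, gv)] [(0, gj), (0, gi), (1, ge)]"
      by (rule rewrite[OF R3, where k = 1 and pre = "[(0, gj), (0, gi)]"
          and post = "[]"]) (simp_all add: diagram_simps)
    also have "eqd [X] \<dots> [(0, gj), (0, gi), (0, gb), (0, gf)]"
      by (rule rewrite[OF eqd_sym[OF R1], where k = 0 and pre = "[(0, gj), (0, gi)]"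
          and post = "[]"]) (simp_all add: diagram_simps)
    also have "eqd [X] \<dots> [(0, gj), (0, gf)]"
      by (rule rewrite[OF R4, where k = 0 and pre = "[(0, gj)]"
          and post = "[(0, gf)]"]) (simp_all add: diagram_simps)
    also have "eqd [X] \<dots> []"
      by (rule rewrite[OF R2, where k = 0 and pre = "[]"
          and post = "[]"]) (simp_all add: diagram_simps)
    finally show ?thesis .
  qed
  \<comment> \<open>The point \<open>j\<close> is pulled back along the dual basis arrow by
    \<open>i\<close>, and its second leg is moved from \<open>Y\<close> to
    \<open>Xd\<close>.\<close>
  let ?cv = "sem [] [(0, gj), (0, gi), (1, gp)]"
  have "?cv \<in> Hom C ?I (X \<boxtimes> Xd)"
    using sem_Hom[of "[]" "[(0, gj), (0, gi), (1, gp)]"] by (simp add: diagram_simps)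
  moreover have "Id C X \<otimes> ev \<cdot> ?cv \<otimes> Id C X = Id C X"
    using z by (simp add: eqd_def diagram_simps sems(7) reify)
  ultimately have "finite_dual C X Xd gv (Node [] [X, Xd] ?cv)"
    using hom by unfold_locales (simp_all add: defs)
  then show ?thesis unfolding defs by blast
qed

text \<open>Naturality moves the crossing through \<open>i \<otimes> i\<close>, so commutativity of
  \<open>m'\<close> gives that of \<open>m\<close> after composition with \<open>i\<close>; the left
  inverse \<open>r\<close> then cancels \<open>i\<close>.\<close>

lemma commutative_retract:
  assumes m: "m \<in> Hom C (A \<boxtimes> A) A" "m' \<in> Hom C (D \<boxtimes> D) D" and i: "i \<in> Hom C A D"
    and r: "r \<in> Hom C D A" "r \<cdot> i = Id C A"
    and mi: "m' \<cdot> i \<otimes> i = i \<cdot> m" and comm: "m' \<cdot> Braid C D D = m'"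
  shows "m \<cdot> Braid C A A = m"
proof -
  have obj: "A \<in> Obj C" "D \<in> Obj C" using HomD[OF i] by auto
  note b = Braid_Hom[OF obj(1,1)] Braid_Hom[OF obj(2,2)] and ii = Tensor_Hom[OF i i]
  have "i \<cdot> (m \<cdot> Braid C A A) = (i \<cdot> m) \<cdot> Braid C A A"
    using Comp_assoc[OF b(1) m(1) i] ..
  also have "\<dots> = m' \<cdot> (i \<otimes> i \<cdot> Braid C A A)"
    unfolding mi[symmetric] by (rule Comp_assoc[OF b(1) ii m(2)])
  also have "\<dots> = (m' \<cdot> Braid C D D) \<cdot> i \<otimes> i"
    unfolding Braid_natural[OF i i, symmetric] by (rule Comp_assoc[OF ii b(2) m(2), symmetric])
  also have "\<dots> = i \<cdot> m"
    unfolding comm by (rule mi)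
  finally have "r \<cdot> (i \<cdot> (m \<cdot> Braid C A A)) = r \<cdot> (i \<cdot> m)" by simp
  then show ?thesis
    using Comp_assoc[OF Comp_Hom[OF b(1) m(1)] i r(1)] Comp_assoc[OF m(1) i r(1)]
      Id_left[OF m(1)] Id_left[OF Comp_Hom[OF b(1) m(1)]] r(2) by simp
qed

text \<open>Here it is \<open>i \<otimes> i\<close> that has to be cancelled, and
  \<open>r \<otimes> r\<close> does so.\<close>

lemma cocommutative_retract:
  assumes d: "d \<in> Hom C A (A \<boxtimes> A)" "d' \<in> Hom C D (D \<boxtimes> D)" and i: "i \<in> Hom C A D"
    and r: "r \<in> Hom C D A" "r \<cdot> i = Id C A"
    and di: "d' \<cdot> i = i \<otimes> i \<cdot> d" and cocomm: "Braid C D D \<cdot> d' = d'"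
  shows "Braid C A A \<cdot> d = d"
proof -
  have obj: "A \<in> Obj C" "D \<in> Obj C" using HomD[OF i] by auto
  note b = Braid_Hom[OF obj(1,1)] Braid_Hom[OF obj(2,2)] and ii = Tensor_Hom[OF i i]
    and rr = Tensor_Hom[OF r(1) r(1)]
  have ri: "r \<otimes> r \<cdot> i \<otimes> i = Id C (A \<boxtimes> A)"
    using Tensor_Comp[OF i r(1) i r(1)] r(2) Tensor_Id[OF obj(1,1)] by simp
  have "i \<otimes> i \<cdot> (Braid C A A \<cdot> d) = (i \<otimes> i \<cdot> Braid C A A) \<cdot> d"
    using Comp_assoc[OF d(1) b(1) ii] ..
  also have "\<dots> = Braid C D D \<cdot> (i \<otimes> i \<cdot> d)"
    unfolding Braid_natural[OF i i, symmetric] by (rule Comp_assoc[OF d(1) ii b(2)])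
  also have "\<dots> = (Braid C D D \<cdot> d') \<cdot> i"
    unfolding di[symmetric] by (rule Comp_assoc[OF i d(2) b(2), symmetric])
  also have "\<dots> = i \<otimes> i \<cdot> d"
    unfolding cocomm by (rule di)
  finally have "r \<otimes> r \<cdot> (i \<otimes> i \<cdot> (Braid C A A \<cdot> d)) = r \<otimes> r \<cdot> (i \<otimes> i \<cdot> d)" by simp
  then show ?thesis
    using Comp_assoc[OF Comp_Hom[OF d(1) b(1)] ii rr] Comp_assoc[OF d(1) ii rr]
      Id_left[OF d(1)] Id_left[OF Comp_Hom[OF d(1) b(1)]] ri by simp
qed

end

section \<open>Evaluation with the dual on the right\<close>

context finite_dual
begin

lemma ev_bar_transpose:
  assumes "A \<in> Obj C" "t \<in> Hom C A Xd"
  shows "(ev \<cdot> Braid C X Xd) \<cdot> Id C X \<otimes> t = (ev \<cdot> t \<otimes> Id C X) \<cdot> Braid C X A"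
proof -
  note b = Braid_Hom[OF X_Obj Xd_Obj] Braid_Hom[OF X_Obj assms(1)]
    and t = Tensor_Hom[OF Id_Hom[OF X_Obj] assms(2)] Tensor_Hom[OF assms(2) Id_Hom[OF X_Obj]]
  show ?thesis
    using Comp_assoc[OF t(1) b(1) ev_Hom] Comp_assoc[OF b(2) t(2) ev_Hom]
      Braid_natural[OF Id_Hom[OF X_Obj] assms(2)] by simp
qed

text \<open>Composing with an invertible crossing is a bijection, so the evaluation with exchanged
  arguments inherits the universal property. This justifies the definite description in
  \<open>left_act\<close>.\<close>

lemma ev_bar_ex1:
  assumes "A \<in> Obj C" "f \<in> Hom C (X \<boxtimes> A) (UnitOb C)"
  shows "\<exists>!t. t \<in> Hom C A Xd \<and> (ev \<cdot> Braid C X Xd) \<cdot> Id C X \<otimes> t = f"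
proof -
  let ?b = "Braid C X A" and ?i = "inverse_of C (Braid C X A)"
  note b = Braid_Hom[OF X_Obj assms(1)] and i = Braid_inverse[OF X_Obj assms(1)]
  have "h \<cdot> ?b = f \<longleftrightarrow> h = f \<cdot> ?i" if h: "h \<in> Hom C (A \<boxtimes> X) (UnitOb C)" for h
  proof
    assume "h \<cdot> ?b = f"
    then show "h = f \<cdot> ?i"
      using Comp_assoc[OF i(1) b h] i(3) Id_right[OF h] by simp
  next
    assume "h = f \<cdot> ?i"
    then show "h \<cdot> ?b = f"
      using Comp_assoc[OF b i(1) assms(2)] i(2) Id_right[OF assms(2)] by simp
  qed
  then have "t \<in> Hom C A Xd \<and> (ev \<cdot> Braid C X Xd) \<cdot> Id C X \<otimes> t = f
      \<longleftrightarrow> t \<in> Hom C A Xd \<and> ev \<cdot> t \<otimes> Id C X = f \<cdot> ?i" for t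
    using ev_bar_transpose[OF assms(1)] Comp_Hom[OF Tensor_Hom[OF _ Id_Hom[OF X_Obj]] ev_Hom]
    by metis
  then show ?thesis
    using transpose_ex1[OF assms(1) Comp_Hom[OF i(1) assms(2)]] by simp
qed

lemma ev_bar_cancel:
  assumes "wf w p" "wf w q" "out w p = [Xd]" "out w q = [Xd]"
    and eq: "eqd (X # w) (shift 1 p @ [(0, br X Xd), (0, EV)]) (shift 1 q @ [(0, br X Xd), (0, EV)])"
  shows "eqd w p q"
proof -
  have w: "set w \<subseteq> Obj C" using wf_Obj[OF assms(1)] .
  have *: "sem (X # w) (shift 1 r @ [(0, br X Xd), (0, EV)]) = (ev \<cdot> Braid C X Xd) \<cdot> Id C X \<otimes> sem w r
     \<and> sem w r \<in> Hom C (obs w) Xd"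
    if r: "wf w r" "out w r = [Xd]" for r
  proof
    show h: "sem w r \<in> Hom C (obs w) Xd"
      using sem_Hom[OF r(1)] r(2) by (simp add: ObTensor_unit_right)
    have "wf (X # w) (shift 1 r)" "out (X # w) (shift 1 r) = [X, Xd]"
      "sem (X # w) (shift 1 r) = Id C X \<otimes> sem w r"
      using whisker[OF r(1), of "[X]" "[]"] r(2) HomD[OF h] HomD[OF Tensor_Hom[OF Id_Hom[OF X_Obj] h]]
      by (simp_all add: ObTensor_unit_right Tensor_unit_right)
    moreover have "ev \<cdot> Braid C X Xd = sem [X, Xd] [(0, br X Xd), (0, EV)]"
      by (simp add: diagram_simps ev_sem br_sem reify)
    ultimately show "sem (X # w) (shift 1 r @ [(0, br X Xd), (0, EV)])
      = (ev \<cdot> Braid C X Xd) \<cdot> Id C X \<otimes> sem w r"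
      using sem_append[of "X # w" "shift 1 r" "[(0, br X Xd), (0, EV)]"]
      by (simp add: diagram_simps)
  qed
  have "(ev \<cdot> Braid C X Xd) \<cdot> Id C X \<otimes> sem w p \<in> Hom C (X \<boxtimes> obs w) (UnitOb C)"
    using *[OF assms(1,3)] Comp_Hom[OF Tensor_Hom[OF Id_Hom[OF X_Obj]]
        Comp_Hom[OF Braid_Hom[OF X_Obj Xd_Obj] ev_Hom]] by blast
  then have "sem w p = sem w q"
    using ev_bar_ex1[OF obs_Obj[OF w]] *[OF assms(1,3)] *[OF assms(2,4)] eq unfolding eqd_def by metis
  then show ?thesis using assms by (simp add: eqd_def)
qed

end

section \<open>The Drinfeld double\<close>

locale hopf_double = finite_dual C X Xd EV CV
  for C :: "('a, 'b, 'c) braided_cat_scheme" (structure)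
    and X Xd :: 'a and EV CV :: "('a, 'b) node" +
  fixes H :: "('a, 'b, 's) hopf_scheme"
  assumes hopf: "is_hopf_algebra C H"
    and ob_H [simp]: "ob H = X"
    and antipode_iso: "is_iso C (antipode H)"
    and symmetric: "braid_symmetric C X Xd"
begin

abbreviation m where "m \<equiv> mult_node H"
abbreviation u where "u \<equiv> unt_node H"
abbreviation d where "d \<equiv> comult_node H"
abbreviation e where "e \<equiv> counit_node H"

definition S :: "('a, 'b) node" where "S = Node [X] [X] (antipode H)"
definition T :: "('a, 'b) node" where "T = Node [X] [X] (inverse_of C (antipode H))"

lemma bialgebra: "is_algebra C H" "is_coalgebra C H" "is_bialgebra C H"
  using hopf by (auto simp: is_hopf_algebra_def is_bialgebra_def)

lemma H_prebialgebra: "is_prebialgebra H"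
  using bialgebra by (auto simp: is_prebialgebra_def is_algebra_def is_coalgebra_def)

lemmas H_facts = prebialgebra[OF H_prebialgebra, unfolded ob_H]
lemmas H_node [simp] = H_facts(2-5)
lemmas H_sem = H_facts(6-9)

lemma antipode_Hom: "antipode H \<in> Hom C X X"
  using hopf by (simp add: is_hopf_algebra_def)

lemma antipode_inverse:
  "inverse_of C (antipode H) \<in> Hom C X X"
  "inverse_of C (antipode H) \<cdot> antipode H = Id C X" "antipode H \<cdot> inverse_of C (antipode H) = Id C X"
  using is_inverse_inverse_of[OF antipode_iso] HomD[OF antipode_Hom] by (auto simp: is_inverse_def)

lemma S_node [simp]: "is_node S" "src S = [X]" "tgt S = [X]"
  and S_sem: "antipode H = sem [X] [(0, S)]"
  using sem_NodeI[OF _ _ _ S_def] antipode_Hom by (simp_all add: ObTensor_unit_right)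

lemma T_node [simp]: "is_node T" "src T = [X]" "tgt T = [X]"
  and T_sem: "inverse_of C (sem [X] [(0, S)]) = sem [X] [(0, T)]"
  using sem_NodeI[OF _ _ _ T_def] antipode_inverse(1)
  by (simp_all add: ObTensor_unit_right S_sem[symmetric])

lemmas H_reify = eqd_def diagram_simps H_sem S_sem T_sem br_sem reify

section \<open>The Hopf algebra axioms as equations of diagrams\<close>

lemma H_axioms:
  "mult H \<cdot> mult H \<otimes> Id C X = mult H \<cdot> Id C X \<otimes> mult H"
  "mult H \<cdot> unt H \<otimes> Id C X = Id C X"
  "mult H \<cdot> Id C X \<otimes> unt H = Id C X"
  "comult H \<otimes> Id C X \<cdot> comult H = Id C X \<otimes> comult H \<cdot> comult H"
  "counit H \<otimes> Id C X \<cdot> comult H = Id C X"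
  "Id C X \<otimes> counit H \<cdot> comult H = Id C X"
  "comult H \<cdot> mult H = mult H \<otimes> mult H \<cdot> Id C X \<otimes> Braid C X X \<otimes> Id C X \<cdot> comult H \<otimes> comult H"
  "comult H \<cdot> unt H = unt H \<otimes> unt H"
  "counit H \<cdot> mult H = counit H \<otimes> counit H"
  "counit H \<cdot> unt H = Id C (UnitOb C)"
  "mult H \<cdot> antipode H \<otimes> Id C X \<cdot> comult H = unt H \<cdot> counit H"
  "mult H \<cdot> Id C X \<otimes> antipode H \<cdot> comult H = unt H \<cdot> counit H"
  using hopf by (simp_all add: is_hopf_algebra_def is_bialgebra_def is_algebra_def is_coalgebra_def)

lemma assoc: "eqd [X, X, X] [(0, m), (0, m)] [(1, m), (0, m)]"
  using H_axioms(1) by (simp add: H_reify)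

lemma unit_left: "eqd [X] [(0, u), (0, m)] []"
  using H_axioms(2) by (simp add: H_reify)

lemma unit_right: "eqd [X] [(1, u), (0, m)] []"
  using H_axioms(3) by (simp add: H_reify)

lemma coassoc: "eqd [X] [(0, d), (0, d)] [(0, d), (1, d)]"
  using H_axioms(4) by (simp add: H_reify)

lemma counit_left: "eqd [X] [(0, d), (0, e)] []"
  using H_axioms(5) by (simp add: H_reify)

lemma counit_right: "eqd [X] [(0, d), (1, e)] []"
  using H_axioms(6) by (simp add: H_reify)

lemma comult_mult: "eqd [X, X] [(0, m), (0, d)] [(0, d), (2, d), (1, br X X), (0, m), (1, m)]"
  using H_axioms(7) by (simp add: H_reify)

lemma comult_unit: "eqd [] [(0, u), (0, d)] [(0, u), (1, u)]"
  using H_axioms(8) by (simp add: H_reify)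

lemma counit_mult: "eqd [X, X] [(0, m), (0, e)] [(0, e), (0, e)]"
  using H_axioms(9) by (simp add: H_reify)

lemma counit_unit: "eqd [] [(0, u), (0, e)] []"
  using H_axioms(10) by (simp add: H_reify)

lemma antipode_left: "eqd [X] [(0, d), (0, S), (0, m)] [(0, e), (0, u)]"
  using H_axioms(11) by (simp add: H_reify)

lemma antipode_right: "eqd [X] [(0, d), (1, S), (0, m)] [(0, e), (0, u)]"
  using H_axioms(12) by (simp add: H_reify)

lemma S_T: "eqd [X] [(0, S), (0, T)] []"
  using antipode_inverse(2) by (simp add: H_reify)

lemma T_S: "eqd [X] [(0, T), (0, S)] []"
  using antipode_inverse(3) by (simp add: H_reify)

text \<open>The symmetry assumption as an equation between nodes. Its consequence
  \<open>dx_xd\<close> cancels a crossing in the braiding of the double against one in its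
  multiplication or comultiplication.\<close>

lemma br_X_Xd: "br X Xd = bri Xd X"
  using symmetric by (simp add: br_def bri_def braid_symmetric_def)

lemma dx_xd: "eqd [Xd, X] [(0, br Xd X), (0, br X Xd)] []"
  unfolding br_X_Xd by (rule br_bri; simp)

section \<open>The antipode and its inverse\<close>

lemma S_unit: "eqd [] [(0, u), (0, S)] [(0, u)]"
proof -
  have "eqd [] [(0, u), (0, S)] [(0, u), (0, u), (0, S), (0, m)]"
    by (rule rewrite[OF eqd_sym[OF unit_right], where k = 0 and pre = "[(0, u), (0, S)]"
        and post = "[]"]) (simp_all add: diagram_simps)
  \<comment> \<open>The unit is group-like, so \<open>S (1) 1\<close> is the left side of the
    antipode axiom at \<open>1\<close>.\<close>
  also have "eqd [] \<dots> [(0, u), (0, d), (0, S), (0, m)]"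
    by (rule rewrite[OF eqd_sym[OF comult_unit], where k = 0 and pre = "[]"
        and post = "[(0, S), (0, m)]"]) (simp_all add: diagram_simps)
  also have "eqd [] \<dots> [(0, u), (0, u), (0, e)]"
    by (rule rewrite[OF antipode_left, where k = 0 and pre = "[(0, u)]"
        and post = "[]"]) (simp_all add: diagram_simps)
  also have "eqd [] \<dots> [(0, u)]"
    by (rule rewrite[OF counit_unit, where k = 0 and pre = "[]"
        and post = "[(0, u)]"]) (simp_all add: diagram_simps)
  finally show ?thesis .
qed

lemma T_unit: "eqd [] [(0, u), (0, T)] [(0, u)]"
proof -
  have "eqd [] [(0, u), (0, T)] [(0, u), (0, S), (0, T)]"
    by (rule rewrite[OF eqd_sym[OF S_unit], where k = 0 and pre = "[]"
        and post = "[(0, T)]"]) (simp_all add: diagram_simps)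
  also have "eqd [] \<dots> [(0, u)]"
    by (rule rewrite[OF S_T, where k = 0 and pre = "[(0, u)]"
        and post = "[]"]) (simp_all add: diagram_simps)
  finally show ?thesis .
qed

lemma S_counit: "eqd [X] [(0, S), (0, e)] [(0, e)]"
proof -
  have "eqd [X] [(0, S), (0, e)] [(0, d), (1, e), (0, S), (0, e)]"
    by (rule rewrite[OF eqd_sym[OF counit_right], where k = 0 and pre = "[]"
        and post = "[(0, S), (0, e)]"]) (simp_all add: diagram_simps)
  also have "eqd [X] \<dots> [(0, d), (0, S), (0, m), (0, e)]"
    by (rule rewrite[OF eqd_sym[OF counit_mult], where k = 0 and pre = "[(0, d), (0, S)]"
        and post = "[]"]) (simp_all add: diagram_simps)
  also have "eqd [X] \<dots> [(1, u), (1, e), (0, e)]"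
    by (rule rewrite[OF antipode_left, where k = 0 and pre = "[]"
        and post = "[(0, e)]"]) (simp_all add: diagram_simps)
  also have "eqd [X] \<dots> [(0, e)]"
    by (rule rewrite[OF counit_unit, where k = 0 and pre = "[(0, e)]"
        and post = "[]"]) (simp_all add: diagram_simps)
  finally show ?thesis .
qed

lemma T_counit: "eqd [X] [(0, T), (0, e)] [(0, e)]"
proof -
  have "eqd [X] [(0, T), (0, e)] [(0, T), (0, S), (0, e)]"
    by (rule rewrite[OF eqd_sym[OF S_counit], where k = 0 and pre = "[(0, T)]"
        and post = "[]"]) (simp_all add: diagram_simps)
  also have "eqd [X] \<dots> [(0, e)]"
    by (rule rewrite[OF T_S, where k = 0 and pre = "[]"
        and post = "[(0, e)]"]) (simp_all add: diagram_simps)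
  finally show ?thesis .
qed

text \<open>The left antipode axiom for a product, with the coproduct of the product expanded as it
  occurs in the next lemma.\<close>

lemma antipode_convolution: "eqd [X, X] [(0, d), (2, d), (1, br X X), (0, m), (1, m), (0, S), (0, m)] [(0, e), (0, e), (0, u)]"
proof -
  have "eqd [X, X] [(0, d), (2, d), (1, br X X), (0, m), (1, m), (0, S), (0, m)] [(0, m), (0, d), (0, S), (0, m)]"
    by (rule rewrite[OF eqd_sym[OF comult_mult], where k = 0 and pre = "[]"
        and post = "[(0, S), (0, m)]"]) (simp_all add: diagram_simps)
  also have "eqd [X, X] \<dots> [(2, u), (0, m), (0, e)]"
    by (rule rewrite[OF antipode_left, where k = 0 and pre = "[(0, m)]"
        and post = "[]"]) (simp_all add: diagram_simps)
  also have "eqd [X, X] \<dots> [(0, e), (0, e), (0, u)]"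
    by (rule rewrite[OF counit_mult, where k = 0 and pre = "[]"
        and post = "[(0, u)]"]) (simp_all add: diagram_simps)
  finally show ?thesis .
qed

text \<open>
  \<open>S (x\<^sub>1 y) x\<^sub>2 = \<epsilon> (x) S (y)\<close>: both sides come from \<open>S (x\<^sub>1 y\<^sub>1) x\<^sub>2 y\<^sub>2 S (y\<^sub>3)\<close>. The same trick
  with \<open>S (x\<^sub>1 y) x\<^sub>2 S (x\<^sub>3)\<close> then shows that \<open>S\<close> is antimultiplicative.
\<close>

lemma antipode_mult_counit: "eqd [X, X] [(0, d), (1, br X X), (0, m), (0, S), (0, m)] [(0, e), (0, S)]"
proof -
  have 1: "eqd [X, X] [(1, d), (0, d), (2, d), (1, br X X), (0, m), (1, m), (0, S), (0, m), (1, S), (0, m)] [(0, d), (1, br X X), (0, m), (0, S), (0, m)]"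
  proof -
    have "eqd [X, X] [(1, d), (0, d), (2, d), (1, br X X), (0, m), (1, m), (0, S), (0, m), (1, S), (0, m)] [(1, d), (2, S), (1, d), (0, d), (1, br X X), (2, m), (2, m), (0, m), (0, S), (0, m)]"
      by (rule rewrite[OF assoc, where k = 0 and pre = "[(0, d), (2, d), (2, d), (1, br X X), (0, m), (0, S), (1, m), (2, S)]"
          and post = "[]"]) (simp_all add: diagram_simps)
    also have "eqd [X, X] \<dots> [(1, d), (2, S), (1, d), (2, m), (0, d), (1, br X X), (2, m), (0, m), (0, S), (0, m)]"
      by (rule rewrite[OF assoc, where k = 1 and pre = "[(0, d), (2, d), (2, d), (1, br X X), (0, m), (0, S), (3, S)]"
          and post = "[(0, m)]"]) (simp_all add: diagram_simps)
    also have "eqd [X, X] \<dots> [(1, d), (2, d), (3, S), (2, m), (0, d), (1, br X X), (2, m), (0, m), (0, S), (0, m)]"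
      by (rule rewrite[OF coassoc, where k = 2 and pre = "[(0, d)]"
          and post = "[(1, br X X), (0, m), (0, S), (3, S), (2, m), (1, m), (0, m)]"]) (simp_all add: diagram_simps)
    also have "eqd [X, X] \<dots> [(2, u), (1, d), (2, e), (0, d), (1, br X X), (2, m), (0, m), (0, S), (0, m)]"
      by (rule rewrite[OF antipode_right, where k = 2 and pre = "[(0, d), (2, d), (1, br X X), (0, m), (0, S)]"
          and post = "[(1, m), (0, m)]"]) (simp_all add: diagram_simps)
    also have "eqd [X, X] \<dots> [(2, u), (0, d), (1, br X X), (2, m), (0, m), (0, S), (0, m)]"
      by (rule rewrite[OF counit_right, where k = 2 and pre = "[(0, d)]"
          and post = "[(1, br X X), (0, m), (0, S), (2, u), (1, m), (0, m)]"]) (simp_all add: diagram_simps)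
    also have "eqd [X, X] \<dots> [(0, d), (1, br X X), (0, m), (0, S), (0, m)]"
      by (rule rewrite[OF unit_right, where k = 1 and pre = "[(0, d), (1, br X X), (0, m), (0, S)]"
          and post = "[(0, m)]"]) (simp_all add: diagram_simps)
    finally show ?thesis .
  qed
  have 2: "eqd [X, X] [(1, d), (0, d), (2, d), (1, br X X), (0, m), (1, m), (0, S), (0, m), (1, S), (0, m)] [(0, e), (0, S)]"
  proof -
    have "eqd [X, X] [(1, d), (0, d), (2, d), (1, br X X), (0, m), (1, m), (0, S), (0, m), (1, S), (0, m)] [(1, d), (2, S), (2, u), (2, m), (1, e), (0, e)]"
      by (rule rewrite[OF antipode_convolution, where k = 0 and pre = "[(1, d)]"
          and post = "[(1, S), (0, m)]"]) (simp_all add: diagram_simps)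
    also have "eqd [X, X] \<dots> [(1, S), (1, u), (1, m), (0, e)]"
      by (rule rewrite[OF counit_left, where k = 0 and pre = "[(0, e)]"
          and post = "[(0, S), (0, u), (0, m)]"]) (simp_all add: diagram_simps)
    also have "eqd [X, X] \<dots> [(0, e), (0, S)]"
      by (rule rewrite[OF unit_left, where k = 0 and pre = "[(0, e), (0, S)]"
          and post = "[]"]) (simp_all add: diagram_simps)
    finally show ?thesis .
  qed
  show ?thesis
    using eqd_trans[OF eqd_sym[OF 1] 2] .
qed

lemma antipode_mult: "eqd [X, X] [(0, m), (0, S)] [(0, br X X), (0, S), (1, S), (0, m)]"
proof -
  have 1: "eqd [X, X] [(0, d), (1, br X X), (0, d), (1, br X X), (0, m), (0, S), (0, m), (1, S), (0, m)] [(0, m), (0, S)]"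
  proof -
    have "eqd [X, X] [(0, d), (1, br X X), (0, d), (1, br X X), (0, m), (0, S), (0, m), (1, S), (0, m)] [(0, d), (1, br X X), (2, S), (0, d), (1, br X X), (2, m), (0, m), (0, S), (0, m)]"
      by (rule rewrite[OF assoc, where k = 0 and pre = "[(0, d), (0, d), (2, br X X), (1, br X X), (0, m), (0, S), (2, S)]"
          and post = "[]"]) (simp_all add: diagram_simps)
    also have "eqd [X, X] \<dots> [(0, d), (1, d), (2, br X X), (3, S), (1, br X X), (2, m), (0, m), (0, S), (0, m)]"
      by (rule rewrite[OF coassoc, where k = 0 and pre = "[]"
          and post = "[(2, br X X), (1, br X X), (0, m), (0, S), (2, S), (1, m), (0, m)]"]) (simp_all add: diagram_simps)
    also have "eqd [X, X] \<dots> [(0, d), (1, br X X), (2, d), (3, S), (2, m), (0, m), (0, S), (0, m)]"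
      by (rule rewrite[OF br_natural_left[of d X, simplified], where k = 1 and pre = "[(0, d)]"
          and post = "[(0, m), (0, S), (2, S), (1, m), (0, m)]"]) (simp_all add: diagram_simps)
    also have "eqd [X, X] \<dots> [(2, u), (0, d), (1, br X X), (2, e), (0, m), (0, S), (0, m)]"
      by (rule rewrite[OF antipode_right, where k = 1 and pre = "[(0, d), (1, br X X), (0, m), (0, S)]"
          and post = "[(0, m)]"]) (simp_all add: diagram_simps)
    also have "eqd [X, X] \<dots> [(2, u), (0, d), (1, e), (0, m), (0, S), (0, m)]"
      by (rule rewrite[OF eqd_sym[OF br_natural_left[of e X, simplified]], where k = 1 and pre = "[(0, d)]"
          and post = "[(0, m), (0, S), (1, u), (0, m)]"]) (simp_all add: diagram_simps)
    also have "eqd [X, X] \<dots> [(2, u), (0, m), (0, S), (0, m)]"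
      by (rule rewrite[OF counit_right, where k = 0 and pre = "[]"
          and post = "[(0, m), (0, S), (1, u), (0, m)]"]) (simp_all add: diagram_simps)
    also have "eqd [X, X] \<dots> [(0, m), (0, S)]"
      by (rule rewrite[OF unit_right, where k = 0 and pre = "[(0, m), (0, S)]"
          and post = "[]"]) (simp_all add: diagram_simps)
    finally show ?thesis .
  qed
  have 2: "eqd [X, X] [(0, d), (1, br X X), (0, d), (1, br X X), (0, m), (0, S), (0, m), (1, S), (0, m)] [(0, br X X), (0, S), (1, S), (0, m)]"
  proof -
    have "eqd [X, X] [(0, d), (1, br X X), (0, d), (1, br X X), (0, m), (0, S), (0, m), (1, S), (0, m)] [(0, d), (1, br X X), (2, S), (1, S), (1, m), (0, e)]"
      by (rule rewrite[OF antipode_mult_counit, where k = 0 and pre = "[(0, d), (1, br X X)]"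
          and post = "[(1, S), (0, m)]"]) (simp_all add: diagram_simps)
    also have "eqd [X, X] \<dots> [(0, br X X), (0, S), (1, S), (0, m)]"
      by (rule rewrite[OF counit_left, where k = 0 and pre = "[]"
          and post = "[(0, br X X), (0, S), (1, S), (0, m)]"]) (simp_all add: diagram_simps)
    finally show ?thesis .
  qed
  show ?thesis
    using eqd_trans[OF eqd_sym[OF 1] 2] .
qed

section \<open>The dual of the opposite Hopf algebra\<close>

definition B :: "('a, 'b) bialg" where "B = dual_bialg C (op_bialg C H) Xd ev"

abbreviation bm where "bm \<equiv> mult_node B"
abbreviation bu where "bu \<equiv> unt_node B"
abbreviation bd where "bd \<equiv> comult_node B"
abbreviation be where "be \<equiv> counit_node B"

lemma op_nodes [simp]: "ob (op_bialg C H) = X" "unt_node (op_bialg C H) = u"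
  "comult_node (op_bialg C H) = d" "counit_node (op_bialg C H) = e"
  by (simp_all add: op_bialg_def unt_node_def comult_node_def counit_node_def)

lemma op_prebialgebra: "is_prebialgebra (op_bialg C H)"
  using H_prebialgebra Comp_Hom[OF Braid_Hom[OF X_Obj X_Obj], of "mult H" X]
  by (simp add: is_prebialgebra_def op_bialg_def)

lemmas op_facts = prebialgebra[OF op_prebialgebra, unfolded op_nodes]
lemmas op_node [simp] = op_facts(2)

lemma op_mult: "eqd [X, X] [(0, mult_node (op_bialg C H))] [(0, br X X), (0, m)]"
proof -
  have "mult (op_bialg C H) = mult H \<cdot> Braid C X X"
    by (simp add: op_bialg_def)
  then show ?thesis by (simp add: op_facts(6) H_reify)
qed

lemma ob_B [simp]: "ob B = Xd"
  by (simp add: B_def dual_bialg_def)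

lemmas op_dual = op_prebialgebra op_nodes(1) B_def
lemmas B_prebialgebra = dual_prebialgebra[OF op_dual]
lemmas B_facts = prebialgebra[OF B_prebialgebra, unfolded ob_B]
lemmas B_node [simp] = B_facts(2-5)
lemmas B_sem = B_facts(6-9)

lemmas bu_ev = dual_unt_eqd[OF op_dual, unfolded op_nodes]
lemmas be_ev = dual_counit_eqd[OF op_dual, unfolded op_nodes]
lemmas b_unit_idem = dual_unit_idem[OF op_dual, unfolded op_nodes, OF counit_left]
lemmas b_counit_unit = dual_counit_unit[OF op_dual, unfolded op_nodes, OF counit_unit]

text \<open>The unit slides through the crossing of the opposite product and comes out on the
  left.\<close>

lemma op_unit_right: "eqd [X] [(1, u), (0, mult_node (op_bialg C H))] []"
proof -
  have "eqd [X] [(1, u), (0, mult_node (op_bialg C H))] [(1, u), (0, br X X), (0, m)]"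
    by (rule rewrite[OF op_mult, where k = 0 and pre = "[(1, u)]"
        and post = "[]"]) (simp_all add: diagram_simps)
  also have "eqd [X] \<dots> [(0, u), (0, m)]"
    by (rule rewrite[OF br_natural_right[of u X, simplified], where k = 0 and pre = "[]"
        and post = "[(0, m)]"]) (simp_all add: diagram_simps)
  also have "eqd [X] \<dots> []"
    by (rule rewrite[OF unit_left, where k = 0 and pre = "[]"
        and post = "[]"]) (simp_all add: diagram_simps)
  finally show ?thesis .
qed

lemma op_counit_mult: "eqd [X, X] [(0, mult_node (op_bialg C H)), (0, e)] [(0, e), (0, e)]"
proof -
  have "eqd [X, X] [(0, mult_node (op_bialg C H)), (0, e)] [(0, br X X), (0, m), (0, e)]"
    by (rule rewrite[OF op_mult, where k = 0 and pre = "[]"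
        and post = "[(0, e)]"]) (simp_all add: diagram_simps)
  also have "eqd [X, X] \<dots> [(0, br X X), (1, e), (0, e)]"
    by (rule rewrite[OF counit_mult, where k = 0 and pre = "[(0, br X X)]"
        and post = "[]"]) (simp_all add: diagram_simps)
  also have "eqd [X, X] \<dots> [(0, e), (0, e)]"
    by (rule rewrite[OF eqd_sym[OF br_natural_right[of e X, simplified]], where k = 0 and pre = "[]"
        and post = "[(0, e)]"]) (simp_all add: diagram_simps)
  finally show ?thesis .
qed

lemmas b_counit_right = dual_counit_right[OF op_dual, unfolded op_nodes, OF op_unit_right]
lemmas b_comult_unit = dual_comult_unit[OF op_dual, unfolded op_nodes, OF op_counit_mult]

section \<open>The two actions of the matched pair\<close>

definition LA :: "('a, 'b) node" where "LA = Node [X, Xd] [Xd] (left_act C H Xd ev)"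
definition RA :: "('a, 'b) node" where "RA = Node [X, Xd] [X] (right_act C H Xd ev)"

lemma left_act:
  "left_act C H Xd ev \<in> Hom C (X \<boxtimes> Xd) Xd
    \<and> (ev \<cdot> Braid C X Xd) \<cdot> Id C X \<otimes> left_act C H Xd ev
      = sem [X, X, Xd] [(1, d), (0, m), (1, T), (0, br X X), (0, m), (0, br X Xd), (0, EV)]"
proof -
  have eq: "(ev \<cdot> Braid C X Xd) \<cdot> (mult H \<cdot> Braid C X X \<cdot> mult H \<otimes> inverse_of C (antipode H)
       \<cdot> Id C X \<otimes> comult H) \<otimes> Id C Xd = sem [X, X, Xd] [(1, d), (0, m), (1, T), (0, br X X), (0, m), (0, br X Xd), (0, EV)]" (is "?f = _")
    by (simp add: ev_sem H_reify)
  have "?f \<in> Hom C (X \<boxtimes> (X \<boxtimes> Xd)) (UnitOb C)"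
    unfolding eq
    using sem_Hom[of "[X, X, Xd]" "[(1, d), (0, m), (1, T), (0, br X X), (0, m), (0, br X Xd), (0, EV)]"]
    by (simp add: diagram_simps ObTensor_unit_right)
  from theI'[OF ev_bar_ex1[OF _ this]] show ?thesis
    unfolding left_act_def ev_bar_def ob_H by (simp add: ObTensor_Obj eq)
qed

lemma LA_node [simp]: "is_node LA" "src LA = [X, Xd]" "tgt LA = [Xd]"
  and LA_sem: "left_act C H Xd ev = sem [X, Xd] [(0, LA)]"
  using sem_NodeI[OF _ _ _ LA_def] left_act by (simp_all add: ObTensor_unit_right)

text \<open>In terms of elements, up to the braiding: \<open>y\<close> acts on a functional by
  precomposition with \<open>x \<mapsto> T (y\<^sub>2) (x y\<^sub>1)\<close>, a coadjoint
  action.\<close>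

lemma LA_eqd: "eqd [X, X, Xd] [(1, LA), (0, br X Xd), (0, EV)] [(1, d), (0, m), (1, T), (0, br X X), (0, m), (0, br X Xd), (0, EV)]"
  using left_act unfolding LA_sem by (simp add: ev_sem H_reify)

lemma right_act: "right_act C H Xd ev = sem [X, Xd] [(0, d), (0, d), (0, bri X X), (2, T), (1, br X X), (1, m), (1, br X Xd), (1, EV)]"
  by (simp add: right_act_def ev_bar_def ev_sem H_reify)

lemma RA_node [simp]: "is_node RA" "src RA = [X, Xd]" "tgt RA = [X]"
  and RA_sem: "right_act C H Xd ev = sem [X, Xd] [(0, RA)]"
  using sem_NodeI[OF _ _ _ RA_def] sem_Hom[of "[X, Xd]" "[(0, d), (0, d), (0, bri X X), (2, T), (1, br X X), (1, m), (1, br X Xd), (1, EV)]"]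
  by (simp_all add: right_act diagram_simps ObTensor_unit_right)

text \<open>In terms of elements, up to the braiding: \<open>x\<close> and \<open>f\<close> are sent
  to \<open>x\<^sub>2\<close> weighted by \<open>f (T (x\<^sub>3) x\<^sub>1)\<close>.\<close>

lemma RA_eqd: "eqd [X, Xd] [(0, RA)] [(0, d), (0, d), (0, bri X X), (2, T), (1, br X X), (1, m), (1, br X Xd), (1, EV)]"
  using right_act unfolding RA_sem by (intro eqdI) (simp_all add: diagram_simps)

lemma u_bri: "eqd [X] [(0, u), (0, bri X X)] [(1, u)]"
proof -
  have "eqd [X] [(0, u), (0, bri X X)] [(1, u), (0, br X X), (0, bri X X)]"
    by (rule rewrite[OF eqd_sym[OF br_natural_right[of u X, simplified]], where k = 0 and pre = "[]"
        and post = "[(0, bri X X)]"]) (simp_all add: diagram_simps)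
  also have "eqd [X] \<dots> [(1, u)]"
    by (rule rewrite[OF br_bri(1)[OF X_Obj X_Obj], where k = 0 and pre = "[(1, u)]"
        and post = "[]"]) (simp_all add: diagram_simps)
  finally show ?thesis .
qed

lemma bri_counit: "eqd [X, X] [(0, bri X X), (1, e)] [(0, e)]"
proof -
  have "eqd [X, X] [(0, bri X X), (1, e)] [(0, bri X X), (0, br X X), (0, e)]"
    by (rule rewrite[OF br_natural_right[of e X, simplified], where k = 0 and pre = "[(0, bri X X)]"
        and post = "[]"]) (simp_all add: diagram_simps)
  also have "eqd [X, X] \<dots> [(0, e)]"
    by (rule rewrite[OF br_bri(2)[OF X_Obj X_Obj], where k = 0 and pre = "[]"
        and post = "[(0, e)]"]) (simp_all add: diagram_simps)
  finally show ?thesis .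
qed

lemma bu_ev_bar: "eqd [X] [(1, bu), (0, br X Xd), (0, EV)] [(0, e)]"
proof -
  have "eqd [X] [(1, bu), (0, br X Xd), (0, EV)] [(0, bu), (0, EV)]"
    by (rule rewrite[OF br_natural_right[of bu X, simplified], where k = 0 and pre = "[]"
        and post = "[(0, EV)]"]) (simp_all add: diagram_simps)
  also have "eqd [X] \<dots> [(0, e)]"
    by (rule rewrite[OF bu_ev, where k = 0 and pre = "[]"
        and post = "[]"]) (simp_all add: diagram_simps)
  finally show ?thesis .
qed

lemma u_ev_bar: "eqd [Xd] [(0, u), (0, br X Xd), (0, EV)] [(0, be)]"
proof -
  have "eqd [Xd] [(0, u), (0, br X Xd), (0, EV)] [(1, u), (0, EV)]"
    by (rule rewrite[OF br_natural_left[of u Xd, simplified], where k = 0 and pre = "[]"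
        and post = "[(0, EV)]"]) (simp_all add: diagram_simps)
  also have "eqd [Xd] \<dots> [(0, be)]"
    by (rule rewrite[OF eqd_sym[OF be_ev], where k = 0 and pre = "[]"
        and post = "[]"]) (simp_all add: diagram_simps)
  finally show ?thesis .
qed

text \<open>This and the next three lemmas are the unit laws that make the inclusions of
  \<open>H\<close> and \<open>B\<close> multiplicative. \<open>LA\<close> is known only through its
  evaluation, so its two laws are tested with \<open>ev_bar_cancel\<close>; \<open>RA\<close> is an
  explicit diagram.\<close>

lemma left_act_unit: "eqd [Xd] [(0, u), (0, LA)] []"
proof -
  have "eqd [X, Xd] [(1, u), (1, LA), (0, br X Xd), (0, EV)] [(0, br X Xd), (0, EV)]"
  proof -
    have "eqd [X, Xd] [(1, u), (1, LA), (0, br X Xd), (0, EV)] [(1, u), (1, d), (2, T), (0, m), (0, br X X), (0, m), (0, br X Xd), (0, EV)]"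
      by (rule rewrite[OF LA_eqd, where k = 0 and pre = "[(1, u)]"
          and post = "[]"]) (simp_all add: diagram_simps)
    also have "eqd [X, Xd] \<dots> [(1, u), (1, T), (1, u), (0, m), (0, br X X), (0, m), (0, br X Xd), (0, EV)]"
      by (rule rewrite[OF comult_unit, where k = 1 and pre = "[]"
          and post = "[(0, m), (1, T), (0, br X X), (0, m), (0, br X Xd), (0, EV)]"]) (simp_all add: diagram_simps)
    also have "eqd [X, Xd] \<dots> [(1, u), (1, T), (0, br X X), (0, m), (0, br X Xd), (0, EV)]"
      by (rule rewrite[OF unit_right, where k = 0 and pre = "[]"
          and post = "[(1, u), (1, T), (0, br X X), (0, m), (0, br X Xd), (0, EV)]"]) (simp_all add: diagram_simps)
    also have "eqd [X, Xd] \<dots> [(1, u), (0, br X X), (0, m), (0, br X Xd), (0, EV)]"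
      by (rule rewrite[OF T_unit, where k = 1 and pre = "[]"
          and post = "[(0, br X X), (0, m), (0, br X Xd), (0, EV)]"]) (simp_all add: diagram_simps)
    also have "eqd [X, Xd] \<dots> [(0, u), (0, m), (0, br X Xd), (0, EV)]"
      by (rule rewrite[OF br_natural_right[of u X, simplified], where k = 0 and pre = "[]"
          and post = "[(0, m), (0, br X Xd), (0, EV)]"]) (simp_all add: diagram_simps)
    also have "eqd [X, Xd] \<dots> [(0, br X Xd), (0, EV)]"
      by (rule rewrite[OF unit_left, where k = 0 and pre = "[]"
          and post = "[(0, br X Xd), (0, EV)]"]) (simp_all add: diagram_simps)
    finally show ?thesis .
  qed
  then show ?thesis
    by (intro ev_bar_cancel[where w = "[Xd]"]) (simp_all add: diagram_simps)
qed

text \<open>The unit of \<open>B\<close> evaluates as the counit of \<open>H\<close>, which is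
  multiplicative and invariant under \<open>T\<close>; on \<open>T (y\<^sub>2) (x y\<^sub>1)\<close>
  it therefore gives \<open>\<epsilon> (x) \<epsilon> (y)\<close>.\<close>

lemma left_act_bunit: "eqd [X] [(1, bu), (0, LA)] [(0, e), (0, bu)]"
proof -
  have "eqd [X, X] [(2, bu), (1, LA), (0, br X Xd), (0, EV)] [(1, e), (1, bu), (0, br X Xd), (0, EV)]"
  proof -
    have "eqd [X, X] [(2, bu), (1, LA), (0, br X Xd), (0, EV)] [(2, bu), (1, d), (2, T), (0, m), (0, br X X), (0, m), (0, br X Xd), (0, EV)]"
      by (rule rewrite[OF LA_eqd, where k = 0 and pre = "[(2, bu)]"
          and post = "[]"]) (simp_all add: diagram_simps)
    also have "eqd [X, X] \<dots> [(1, d), (2, T), (0, m), (0, br X X), (0, m), (0, e)]"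
      by (rule rewrite[OF bu_ev_bar, where k = 0 and pre = "[(1, d), (0, m), (1, T), (0, br X X), (0, m)]"
          and post = "[]"]) (simp_all add: diagram_simps)
    also have "eqd [X, X] \<dots> [(1, d), (2, T), (0, m), (0, br X X), (1, e), (0, e)]"
      by (rule rewrite[OF counit_mult, where k = 0 and pre = "[(1, d), (0, m), (1, T), (0, br X X)]"
          and post = "[]"]) (simp_all add: diagram_simps)
    also have "eqd [X, X] \<dots> [(1, d), (2, T), (2, e), (0, m), (0, e)]"
      by (rule rewrite[OF eqd_sym[OF br_natural_right[of e X, simplified]], where k = 0 and pre = "[(1, d), (0, m), (1, T)]"
          and post = "[(0, e)]"]) (simp_all add: diagram_simps)
    also have "eqd [X, X] \<dots> [(1, d), (2, e), (0, m), (0, e)]"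
      by (rule rewrite[OF T_counit, where k = 0 and pre = "[(1, d), (0, m), (0, e)]"
          and post = "[]"]) (simp_all add: diagram_simps)
    also have "eqd [X, X] \<dots> [(0, m), (0, e)]"
      by (rule rewrite[OF counit_right, where k = 1 and pre = "[]"
          and post = "[(0, m), (0, e)]"]) (simp_all add: diagram_simps)
    also have "eqd [X, X] \<dots> [(1, e), (0, e)]"
      by (rule rewrite[OF counit_mult, where k = 0 and pre = "[]"
          and post = "[]"]) (simp_all add: diagram_simps)
    also have "eqd [X, X] \<dots> [(1, e), (1, bu), (0, br X Xd), (0, EV)]"
      by (rule rewrite[OF eqd_sym[OF bu_ev_bar], where k = 0 and pre = "[]"
          and post = "[(0, e)]"]) (simp_all add: diagram_simps)
    finally show ?thesis .
  qed
  then show ?thesis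
    by (intro ev_bar_cancel[where w = "[X]"]) (simp_all add: diagram_simps)
qed

lemma right_act_unit: "eqd [Xd] [(0, u), (0, RA)] [(0, be), (0, u)]"
proof -
  have "eqd [Xd] [(0, u), (0, RA)] [(0, u), (0, d), (1, T), (0, d), (0, bri X X), (1, br X X), (1, m), (1, br X Xd), (1, EV)]"
    by (rule rewrite[OF RA_eqd, where k = 0 and pre = "[(0, u)]"
        and post = "[]"]) (simp_all add: diagram_simps)
  also have "eqd [Xd] \<dots> [(0, u), (0, T), (0, u), (0, d), (0, bri X X), (1, br X X), (1, m), (1, br X Xd), (1, EV)]"
    by (rule rewrite[OF comult_unit, where k = 0 and pre = "[]"
        and post = "[(0, d), (0, bri X X), (2, T), (1, br X X), (1, m), (1, br X Xd), (1, EV)]"]) (simp_all add: diagram_simps)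
  also have "eqd [Xd] \<dots> [(0, u), (0, T), (0, u), (0, u), (0, bri X X), (1, br X X), (1, m), (1, br X Xd), (1, EV)]"
    by (rule rewrite[OF comult_unit, where k = 0 and pre = "[(0, u), (0, T)]"
        and post = "[(0, bri X X), (1, br X X), (1, m), (1, br X Xd), (1, EV)]"]) (simp_all add: diagram_simps)
  also have "eqd [Xd] \<dots> [(1, u), (0, u), (0, T), (0, u), (0, br X X), (0, m), (0, br X Xd), (0, EV)]"
    by (rule rewrite[OF u_bri, where k = 0 and pre = "[(0, u), (0, T), (0, u)]"
        and post = "[(1, br X X), (1, m), (1, br X Xd), (1, EV)]"]) (simp_all add: diagram_simps)
  also have "eqd [Xd] \<dots> [(1, u), (0, u), (0, u), (0, br X X), (0, m), (0, br X Xd), (0, EV)]"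
    by (rule rewrite[OF T_unit, where k = 0 and pre = "[]"
        and post = "[(0, u), (0, u), (1, br X X), (1, m), (1, br X Xd), (1, EV)]"]) (simp_all add: diagram_simps)
  also have "eqd [Xd] \<dots> [(1, u), (0, u), (0, u), (0, m), (0, br X Xd), (0, EV)]"
    by (rule rewrite[OF br_natural_left[of u X, simplified], where k = 0 and pre = "[(0, u)]"
        and post = "[(0, m), (0, u), (1, br X Xd), (1, EV)]"]) (simp_all add: diagram_simps)
  also have "eqd [Xd] \<dots> [(1, u), (0, u), (0, br X Xd), (0, EV)]"
    by (rule rewrite[OF unit_left, where k = 0 and pre = "[(0, u)]"
        and post = "[(0, u), (1, br X Xd), (1, EV)]"]) (simp_all add: diagram_simps)
  also have "eqd [Xd] \<dots> [(0, be), (0, u)]"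
    by (rule rewrite[OF u_ev_bar, where k = 0 and pre = "[]"
        and post = "[(0, u)]"]) (simp_all add: diagram_simps)
  finally show ?thesis .
qed

lemma right_act_bunit: "eqd [X] [(1, bu), (0, RA)] []"
proof -
  have "eqd [X] [(1, bu), (0, RA)] [(1, bu), (0, d), (1, T), (0, d), (0, bri X X), (1, br X X), (1, m), (1, br X Xd), (1, EV)]"
    by (rule rewrite[OF RA_eqd, where k = 0 and pre = "[(1, bu)]"
        and post = "[]"]) (simp_all add: diagram_simps)
  also have "eqd [X] \<dots> [(0, d), (1, T), (0, d), (0, bri X X), (1, br X X), (1, m), (1, e)]"
    by (rule rewrite[OF bu_ev_bar, where k = 1 and pre = "[(0, d), (0, d), (0, bri X X), (2, T), (1, br X X), (1, m)]"
        and post = "[]"]) (simp_all add: diagram_simps)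
  also have "eqd [X] \<dots> [(0, d), (1, T), (0, d), (0, bri X X), (1, br X X), (2, e), (1, e)]"
    by (rule rewrite[OF counit_mult, where k = 1 and pre = "[(0, d), (0, d), (0, bri X X), (2, T), (1, br X X)]"
        and post = "[]"]) (simp_all add: diagram_simps)
  also have "eqd [X] \<dots> [(0, d), (1, T), (1, e), (0, d), (0, bri X X), (1, e)]"
    by (rule rewrite[OF eqd_sym[OF br_natural_right[of e X, simplified]], where k = 1 and pre = "[(0, d), (0, d), (0, bri X X), (2, T)]"
        and post = "[(1, e)]"]) (simp_all add: diagram_simps)
  also have "eqd [X] \<dots> [(0, d), (1, e), (0, d), (0, bri X X), (1, e)]"
    by (rule rewrite[OF T_counit, where k = 1 and pre = "[(0, d), (0, d), (0, bri X X), (1, e)]"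
        and post = "[]"]) (simp_all add: diagram_simps)
  also have "eqd [X] \<dots> [(0, d), (1, e), (0, d), (0, e)]"
    by (rule rewrite[OF bri_counit, where k = 0 and pre = "[(0, d), (0, d)]"
        and post = "[(1, e)]"]) (simp_all add: diagram_simps)
  also have "eqd [X] \<dots> [(0, d), (0, e)]"
    by (rule rewrite[OF counit_right, where k = 0 and pre = "[]"
        and post = "[(0, d), (0, e)]"]) (simp_all add: diagram_simps)
  also have "eqd [X] \<dots> []"
    by (rule rewrite[OF counit_left, where k = 0 and pre = "[]"
        and post = "[]"]) (simp_all add: diagram_simps)
  finally show ?thesis .
qed

section \<open>The inclusions of H and B into the double\<close>

lemma mult_double_H: "eqd [X, X] [(0, bu), (2, bu), (1, d), (3, bd), (2, br X Xd), (1, LA), (2, RA), (0, bm), (1, m)] [(0, m), (0, bu)]"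
proof -
  \<comment> \<open>The coproduct of \<open>bu\<close> is \<open>bu\<close> twice, so each action
    meets a unit of \<open>B\<close>: the left action becomes a counit followed by
    \<open>bu\<close>, the right one an identity wire.\<close>
  have "eqd [X, X] [(0, bu), (2, bu), (1, d), (3, bd), (2, br X Xd), (1, LA), (2, RA), (0, bm), (1, m)] [(1, bu), (1, bu), (0, d), (1, br X Xd), (2, RA), (2, m), (0, LA), (0, bu), (0, bm)]"
    by (rule rewrite[OF b_comult_unit, where k = 3 and pre = "[(0, bu), (1, d)]"
        and post = "[(2, br X Xd), (1, LA), (0, bm), (1, RA), (1, m)]"]) (simp_all add: diagram_simps)
  also have "eqd [X, X] \<dots> [(1, bu), (0, d), (1, RA), (1, m), (1, bu), (0, LA), (0, bu), (0, bm)]"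
    by (rule rewrite[OF br_natural_right[of bu X, simplified], where k = 2 and pre = "[(0, bu), (1, d)]"
        and post = "[(1, LA), (0, bm), (2, bu), (1, RA), (1, m)]"]) (simp_all add: diagram_simps)
  also have "eqd [X, X] \<dots> [(1, bu), (0, d), (1, RA), (1, m), (1, bu), (1, bu), (1, bm), (0, e)]"
    by (rule rewrite[OF left_act_bunit, where k = 1 and pre = "[(0, bu), (1, d)]"
        and post = "[(0, bm), (2, bu), (1, RA), (1, m)]"]) (simp_all add: diagram_simps)
  also have "eqd [X, X] \<dots> [(0, d), (1, m), (1, bu), (1, bu), (1, bm), (0, e)]"
    by (rule rewrite[OF right_act_bunit, where k = 1 and pre = "[(0, bu), (0, bu), (0, bm), (1, d), (1, e)]"
        and post = "[(1, m)]"]) (simp_all add: diagram_simps)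
  also have "eqd [X, X] \<dots> [(0, m), (0, bu), (0, bu), (0, bm)]"
    by (rule rewrite[OF counit_left, where k = 1 and pre = "[(0, bu), (0, bu), (0, bm)]"
        and post = "[(1, m)]"]) (simp_all add: diagram_simps)
  also have "eqd [X, X] \<dots> [(0, m), (0, bu)]"
    by (rule rewrite[OF b_unit_idem, where k = 0 and pre = "[]"
        and post = "[(1, m)]"]) (simp_all add: diagram_simps)
  finally show ?thesis .
qed

lemma mult_double_B: "eqd [Xd, Xd] [(1, u), (3, u), (1, d), (3, bd), (2, br X Xd), (1, LA), (2, RA), (0, bm), (1, m)] [(0, bm), (1, u)]"
proof -
  have "eqd [Xd, Xd] [(1, u), (3, u), (1, d), (3, bd), (2, br X Xd), (1, LA), (2, RA), (0, bm), (1, m)] [(2, u), (1, bd), (1, u), (1, br X Xd), (2, RA), (2, m), (1, u), (1, LA), (0, bm)]"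
    by (rule rewrite[OF comult_unit, where k = 1 and pre = "[(1, bd)]"
        and post = "[(2, br X Xd), (1, LA), (0, bm), (1, RA), (2, u), (1, m)]"]) (simp_all add: diagram_simps)
  also have "eqd [Xd, Xd] \<dots> [(2, u), (1, bd), (2, u), (2, RA), (2, m), (1, u), (1, LA), (0, bm)]"
    by (rule rewrite[OF br_natural_left[of u Xd, simplified], where k = 1 and pre = "[(1, bd)]"
        and post = "[(1, u), (1, LA), (0, bm), (1, RA), (2, u), (1, m)]"]) (simp_all add: diagram_simps)
  also have "eqd [Xd, Xd] \<dots> [(2, u), (1, bd), (2, u), (2, RA), (2, m), (0, bm)]"
    by (rule rewrite[OF left_act_unit, where k = 1 and pre = "[(1, bd)]"
        and post = "[(0, bm), (1, u), (1, RA), (2, u), (1, m)]"]) (simp_all add: diagram_simps)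
  also have "eqd [Xd, Xd] \<dots> [(2, u), (2, u), (2, m), (1, bd), (2, be), (0, bm)]"
    by (rule rewrite[OF right_act_unit, where k = 1 and pre = "[(1, bd), (0, bm)]"
        and post = "[(2, u), (1, m)]"]) (simp_all add: diagram_simps)
  also have "eqd [Xd, Xd] \<dots> [(2, u), (2, u), (2, m), (0, bm)]"
    by (rule rewrite[OF b_counit_right, where k = 1 and pre = "[]"
        and post = "[(0, bm), (1, u), (1, u), (1, m)]"]) (simp_all add: diagram_simps)
  also have "eqd [Xd, Xd] \<dots> [(0, bm), (1, u)]"
    by (rule rewrite[OF unit_left, where k = 1 and pre = "[(0, bm), (1, u)]"
        and post = "[]"]) (simp_all add: diagram_simps)
  finally show ?thesis .
qed

lemma comult_double_H: "eqd [X] [(0, bu), (0, bd), (2, d), (1, br Xd X)] [(0, d), (0, bu), (2, bu)]"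
proof -
  have "eqd [X] [(0, bu), (0, bd), (2, d), (1, br Xd X)] [(0, d), (0, bu), (0, br Xd X), (0, bu)]"
    by (rule rewrite[OF b_comult_unit, where k = 0 and pre = "[]"
        and post = "[(2, d), (1, br Xd X)]"]) (simp_all add: diagram_simps)
  also have "eqd [X] \<dots> [(0, d), (0, bu), (2, bu)]"
    by (rule rewrite[OF br_natural_left[of bu X, simplified], where k = 1 and pre = "[(0, bu), (1, d)]"
        and post = "[]"]) (simp_all add: diagram_simps)
  finally show ?thesis .
qed

lemma comult_double_B: "eqd [Xd] [(1, u), (0, bd), (2, d), (1, br Xd X)] [(0, bd), (1, u), (3, u)]"
proof -
  have "eqd [Xd] [(1, u), (0, bd), (2, d), (1, br Xd X)] [(1, u), (1, u), (0, bd), (1, br Xd X)]"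
    by (rule rewrite[OF comult_unit, where k = 2 and pre = "[(0, bd)]"
        and post = "[(1, br Xd X)]"]) (simp_all add: diagram_simps)
  also have "eqd [Xd] \<dots> [(0, bd), (1, u), (3, u)]"
    by (rule rewrite[OF br_natural_right[of u Xd, simplified], where k = 1 and pre = "[(0, bd)]"
        and post = "[(3, u)]"]) (simp_all add: diagram_simps)
  finally show ?thesis .
qed

section \<open>Trivial actions in the commutative and cocommutative case\<close>

lemma antipode_mult_comm:
  assumes comm: "eqd [X, X] [(0, br X X), (0, m)] [(0, m)]"
  shows "eqd [X, X] [(0, m), (0, S)] [(0, S), (1, S), (0, m)]"
proof -
  have "eqd [X, X] [(0, m), (0, S)] [(0, br X X), (1, S), (0, S), (0, m)]"
    by (rule rewrite[OF antipode_mult, where k = 0 and pre = "[]"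
        and post = "[]"]) (simp_all add: diagram_simps)
  \<comment> \<open>Naturality moves the antipodes in front of the crossing one by one, until the
    crossing meets \<open>m\<close> and commutativity absorbs it.\<close>
  also have "eqd [X, X] \<dots> [(0, S), (0, br X X), (0, S), (0, m)]"
    by (rule rewrite[OF eqd_sym[OF br_natural_left[of S X, simplified]], where k = 0 and pre = "[]"
        and post = "[(0, S), (0, m)]"]) (simp_all add: diagram_simps)
  also have "eqd [X, X] \<dots> [(1, S), (0, S), (0, br X X), (0, m)]"
    by (rule rewrite[OF eqd_sym[OF br_natural_right[of S X, simplified]], where k = 0 and pre = "[(0, S)]"
        and post = "[(0, m)]"]) (simp_all add: diagram_simps)
  also have "eqd [X, X] \<dots> [(0, S), (1, S), (0, m)]"
    by (rule rewrite[OF comm, where k = 0 and pre = "[(0, S), (1, S)]"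
        and post = "[]"]) (simp_all add: diagram_simps)
  finally show ?thesis .
qed

text \<open>Applying the now multiplicative \<open>S\<close> turns
  \<open>x\<^sub>1 T (x\<^sub>2)\<close> into \<open>S (x\<^sub>1) x\<^sub>2\<close>, where the left
  antipode axiom applies. The next lemma strips \<open>S\<close> off again by \<open>T\<close>,
  which fixes the unit.\<close>

lemma antipode_inv_convolution_S:
  assumes comm: "eqd [X, X] [(0, br X X), (0, m)] [(0, m)]"
    and cocomm: "eqd [X] [(0, d), (0, br X X)] [(0, d)]"
  shows "eqd [X] [(0, d), (1, T), (0, m), (0, S)] [(0, e), (0, u)]"
proof -
  have "eqd [X] [(0, d), (1, T), (0, m), (0, S)] [(0, d), (1, T), (1, S), (0, S), (0, m)]"
    by (rule rewrite[OF antipode_mult_comm[OF comm], where k = 0 and pre = "[(0, d), (1, T)]"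
        and post = "[]"]) (simp_all add: diagram_simps)
  also have "eqd [X] \<dots> [(0, d), (0, S), (0, m)]"
    by (rule rewrite[OF T_S, where k = 1 and pre = "[(0, d), (0, S)]"
        and post = "[(0, m)]"]) (simp_all add: diagram_simps)
  also have "eqd [X] \<dots> [(0, e), (0, u)]"
    by (rule rewrite[OF antipode_left, where k = 0 and pre = "[]"
        and post = "[]"]) (simp_all add: diagram_simps)
  finally show ?thesis .
qed

lemma antipode_inv_convolution:
  assumes comm: "eqd [X, X] [(0, br X X), (0, m)] [(0, m)]"
    and cocomm: "eqd [X] [(0, d), (0, br X X)] [(0, d)]"
  shows "eqd [X] [(0, d), (1, T), (0, m)] [(0, e), (0, u)]"
proof -
  have "eqd [X] [(0, d), (1, T), (0, m)] [(0, d), (1, T), (0, m), (0, S), (0, T)]"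
    by (rule rewrite[OF eqd_sym[OF S_T], where k = 0 and pre = "[(0, d), (1, T), (0, m)]"
        and post = "[]"]) (simp_all add: diagram_simps)
  also have "eqd [X] \<dots> [(1, u), (1, T), (0, e)]"
    by (rule rewrite[OF antipode_inv_convolution_S[OF comm cocomm], where k = 0 and pre = "[]"
        and post = "[(0, T)]"]) (simp_all add: diagram_simps)
  also have "eqd [X] \<dots> [(0, e), (0, u)]"
    by (rule rewrite[OF T_unit, where k = 0 and pre = "[(0, e)]"
        and post = "[]"]) (simp_all add: diagram_simps)
  finally show ?thesis .
qed

text \<open>Commutativity and associativity rewrite \<open>T (y\<^sub>2) (x y\<^sub>1)\<close> as
  \<open>x (y\<^sub>1 T (y\<^sub>2))\<close>, which collapses to
  \<open>\<epsilon> (y) x\<close>.\<close>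

lemma left_act_trivial:
  assumes comm: "eqd [X, X] [(0, br X X), (0, m)] [(0, m)]"
    and cocomm: "eqd [X] [(0, d), (0, br X X)] [(0, d)]"
  shows "eqd [X, Xd] [(0, LA)] [(0, e)]"
proof -
  have "eqd [X, X, Xd] [(1, LA), (0, br X Xd), (0, EV)] [(1, e), (0, br X Xd), (0, EV)]"
  proof -
    have "eqd [X, X, Xd] [(1, LA), (0, br X Xd), (0, EV)] [(1, d), (2, T), (0, m), (0, br X X), (0, m), (0, br X Xd), (0, EV)]"
      by (rule rewrite[OF LA_eqd, where k = 0 and pre = "[]"
          and post = "[]"]) (simp_all add: diagram_simps)
    also have "eqd [X, X, Xd] \<dots> [(1, d), (2, T), (0, m), (0, m), (0, br X Xd), (0, EV)]"
      by (rule rewrite[OF comm, where k = 0 and pre = "[(1, d), (0, m), (1, T)]"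
          and post = "[(0, br X Xd), (0, EV)]"]) (simp_all add: diagram_simps)
    also have "eqd [X, X, Xd] \<dots> [(1, d), (2, T), (1, m), (0, m), (0, br X Xd), (0, EV)]"
      by (rule rewrite[OF assoc, where k = 0 and pre = "[(1, d), (2, T)]"
          and post = "[(0, br X Xd), (0, EV)]"]) (simp_all add: diagram_simps)
    also have "eqd [X, X, Xd] \<dots> [(2, u), (1, e), (0, m), (0, br X Xd), (0, EV)]"
      by (rule rewrite[OF antipode_inv_convolution[OF comm cocomm], where k = 1 and pre = "[]"
          and post = "[(0, m), (0, br X Xd), (0, EV)]"]) (simp_all add: diagram_simps)
    also have "eqd [X, X, Xd] \<dots> [(1, e), (0, br X Xd), (0, EV)]"
      by (rule rewrite[OF unit_right, where k = 0 and pre = "[(1, e)]"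
          and post = "[(0, br X Xd), (0, EV)]"]) (simp_all add: diagram_simps)
    finally show ?thesis .
  qed
  then show ?thesis
    by (intro ev_bar_cancel[where w = "[X, Xd]"]) (simp_all add: diagram_simps)
qed

lemma cocomm_bri:
  assumes cocomm: "eqd [X] [(0, d), (0, br X X)] [(0, d)]"
  shows "eqd [X] [(0, d), (0, bri X X)] [(0, d)]"
proof -
  have "eqd [X] [(0, d), (0, bri X X)] [(0, d), (0, br X X), (0, bri X X)]"
    by (rule rewrite[OF eqd_sym[OF cocomm], where k = 0 and pre = "[]"
        and post = "[(0, bri X X)]"]) (simp_all add: diagram_simps)
  also have "eqd [X] \<dots> [(0, d)]"
    by (rule rewrite[OF br_bri(1)[OF X_Obj X_Obj], where k = 0 and pre = "[(0, d)]"
        and post = "[]"]) (simp_all add: diagram_simps)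
  finally show ?thesis .
qed

text \<open>Cocommutativity absorbs the inverse crossing and commutativity the other one, which
  leaves \<open>x\<^sub>1\<close> weighted by \<open>f (x\<^sub>2 T (x\<^sub>3))\<close>.
  Coassociativity brings the last two legs together; they collapse to the unit, at which
  \<open>f\<close> gives the counit of \<open>B\<close>.\<close>

lemma right_act_trivial:
  assumes comm: "eqd [X, X] [(0, br X X), (0, m)] [(0, m)]"
    and cocomm: "eqd [X] [(0, d), (0, br X X)] [(0, d)]"
  shows "eqd [X, Xd] [(0, RA)] [(1, be)]"
proof -
  have "eqd [X, Xd] [(0, RA)] [(0, d), (1, T), (0, d), (0, bri X X), (1, br X X), (1, m), (1, br X Xd), (1, EV)]"
    by (rule rewrite[OF RA_eqd, where k = 0 and pre = "[]"
        and post = "[]"]) (simp_all add: diagram_simps)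
  also have "eqd [X, Xd] \<dots> [(0, d), (1, T), (0, d), (1, br X X), (1, m), (1, br X Xd), (1, EV)]"
    by (rule rewrite[OF cocomm_bri[OF cocomm], where k = 0 and pre = "[(0, d)]"
        and post = "[(2, T), (1, br X X), (1, m), (1, br X Xd), (1, EV)]"]) (simp_all add: diagram_simps)
  also have "eqd [X, Xd] \<dots> [(0, d), (1, T), (0, d), (1, m), (1, br X Xd), (1, EV)]"
    by (rule rewrite[OF comm, where k = 1 and pre = "[(0, d), (0, d), (2, T)]"
        and post = "[(1, br X Xd), (1, EV)]"]) (simp_all add: diagram_simps)
  also have "eqd [X, Xd] \<dots> [(0, d), (1, d), (2, T), (1, m), (1, br X Xd), (1, EV)]"
    by (rule rewrite[OF coassoc, where k = 0 and pre = "[]"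
        and post = "[(2, T), (1, m), (1, br X Xd), (1, EV)]"]) (simp_all add: diagram_simps)
  also have "eqd [X, Xd] \<dots> [(1, u), (1, br X Xd), (1, EV), (0, d), (1, e)]"
    by (rule rewrite[OF antipode_inv_convolution[OF comm cocomm], where k = 1 and pre = "[(0, d)]"
        and post = "[(1, br X Xd), (1, EV)]"]) (simp_all add: diagram_simps)
  also have "eqd [X, Xd] \<dots> [(1, u), (1, br X Xd), (1, EV)]"
    by (rule rewrite[OF counit_right, where k = 0 and pre = "[]"
        and post = "[(1, u), (1, br X Xd), (1, EV)]"]) (simp_all add: diagram_simps)
  also have "eqd [X, Xd] \<dots> [(1, be)]"
    by (rule rewrite[OF u_ev_bar, where k = 1 and pre = "[]"
        and post = "[]"]) (simp_all add: diagram_simps)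
  finally show ?thesis .
qed

text \<open>The counits left by the trivial actions absorb both coproducts, and the multiplication
  of a braided tensor product remains.\<close>

lemma mult_double_trivial:
  assumes comm: "eqd [X, X] [(0, br X X), (0, m)] [(0, m)]"
    and cocomm: "eqd [X] [(0, d), (0, br X X)] [(0, d)]"
  shows "eqd [Xd, X, Xd, X] [(1, d), (3, bd), (2, br X Xd), (1, LA), (2, RA), (0, bm), (1, m)] [(1, br X Xd), (0, bm), (1, m)]"
proof -
  have "eqd [Xd, X, Xd, X] [(1, d), (3, bd), (2, br X Xd), (1, LA), (2, RA), (0, bm), (1, m)] [(2, bd), (1, d), (2, br X Xd), (3, RA), (3, m), (1, e), (0, bm)]"
    by (rule rewrite[OF left_act_trivial[OF comm cocomm], where k = 1 and pre = "[(1, d), (3, bd), (2, br X Xd)]"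
        and post = "[(0, bm), (1, RA), (1, m)]"]) (simp_all add: diagram_simps)
  also have "eqd [Xd, X, Xd, X] \<dots> [(2, bd), (3, be), (1, d), (2, br X Xd), (3, m), (1, e), (0, bm)]"
    by (rule rewrite[OF right_act_trivial[OF comm cocomm], where k = 1 and pre = "[(1, d), (1, e), (2, bd), (1, br X Xd), (0, bm)]"
        and post = "[(1, m)]"]) (simp_all add: diagram_simps)
  also have "eqd [Xd, X, Xd, X] \<dots> [(2, bd), (3, be), (1, br X Xd), (2, m), (0, bm)]"
    by (rule rewrite[OF counit_left, where k = 1 and pre = "[]"
        and post = "[(2, bd), (1, br X Xd), (0, bm), (2, be), (1, m)]"]) (simp_all add: diagram_simps)
  also have "eqd [Xd, X, Xd, X] \<dots> [(1, br X Xd), (0, bm), (1, m)]"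
    by (rule rewrite[OF b_counit_right, where k = 2 and pre = "[]"
        and post = "[(1, br X Xd), (0, bm), (1, m)]"]) (simp_all add: diagram_simps)
  finally show ?thesis .
qed

lemma mult_double_comm:
  assumes comm: "eqd [X, X] [(0, br X X), (0, m)] [(0, m)]"
    and cocomm: "eqd [X] [(0, d), (0, br X X)] [(0, d)]"
    and b_comm: "eqd [Xd, Xd] [(0, br Xd Xd), (0, bm)] [(0, bm)]"
  shows "eqd [Xd, X, Xd, X] [(1, br X Xd), (0, br Xd Xd), (2, br X X), (1, br Xd X), (1, d), (3, bd), (2, br X Xd), (1, LA), (2, RA), (0, bm), (1, m)] [(1, d), (3, bd), (2, br X Xd), (1, LA), (2, RA), (0, bm), (1, m)]"
proof -
  have "eqd [Xd, X, Xd, X] [(1, br X Xd), (0, br Xd Xd), (2, br X X), (1, br Xd X), (1, d), (3, bd), (2, br X Xd), (1, LA), (2, RA), (0, bm), (1, m)] [(1, br X Xd), (2, br X X), (0, br Xd Xd), (1, br Xd X), (1, br X Xd), (2, m), (0, bm)]"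
    by (rule rewrite[OF mult_double_trivial[OF comm cocomm], where k = 0 and pre = "[(1, br X Xd), (0, br Xd Xd), (2, br X X), (1, br Xd X)]"
        and post = "[]"]) (simp_all add: diagram_simps)
  \<comment> \<open>Symmetry enters: the crossing of the multiplication undoes the last crossing of
    the braiding, so that the inner crossings act directly before \<open>bm\<close> and
    \<open>m\<close>.\<close>
  also have "eqd [Xd, X, Xd, X] \<dots> [(1, br X Xd), (2, br X X), (2, m), (0, br Xd Xd), (0, bm)]"
    by (rule rewrite[OF dx_xd, where k = 1 and pre = "[(1, br X Xd), (0, br Xd Xd), (2, br X X)]"
        and post = "[(0, bm), (1, m)]"]) (simp_all add: diagram_simps)
  also have "eqd [Xd, X, Xd, X] \<dots> [(1, br X Xd), (2, m), (0, br Xd Xd), (0, bm)]"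
    by (rule rewrite[OF comm, where k = 1 and pre = "[(1, br X Xd), (0, br Xd Xd), (0, bm)]"
        and post = "[]"]) (simp_all add: diagram_simps)
  also have "eqd [Xd, X, Xd, X] \<dots> [(1, br X Xd), (2, m), (0, bm)]"
    by (rule rewrite[OF b_comm, where k = 0 and pre = "[(1, br X Xd)]"
        and post = "[(1, m)]"]) (simp_all add: diagram_simps)
  also have "eqd [Xd, X, Xd, X] \<dots> [(1, d), (3, bd), (2, br X Xd), (1, LA), (2, RA), (0, bm), (1, m)]"
    by (rule rewrite[OF eqd_sym[OF mult_double_trivial[OF comm cocomm]], where k = 0 and pre = "[]"
        and post = "[]"]) (simp_all add: diagram_simps)
  finally show ?thesis .
qed

text \<open>By symmetry the first crossing of the braiding undoes the crossing of the
  comultiplication; the inner crossings are then absorbed by \<open>bd\<close> and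
  \<open>d\<close>.\<close>

lemma comult_double_cocomm:
  assumes cocomm: "eqd [X] [(0, d), (0, br X X)] [(0, d)]"
    and b_cocomm: "eqd [Xd] [(0, bd), (0, br Xd Xd)] [(0, bd)]"
  shows "eqd [Xd, X] [(0, bd), (2, d), (1, br Xd X), (1, br X Xd), (0, br Xd Xd), (2, br X X), (1, br Xd X)] [(0, bd), (2, d), (1, br Xd X)]"
proof -
  have "eqd [Xd, X] [(0, bd), (2, d), (1, br Xd X), (1, br X Xd), (0, br Xd Xd), (2, br X X), (1, br Xd X)] [(1, d), (1, br X X), (0, bd), (0, br Xd Xd), (1, br Xd X)]"
    by (rule rewrite[OF dx_xd, where k = 1 and pre = "[(0, bd), (2, d)]"
        and post = "[(0, br Xd Xd), (2, br X X), (1, br Xd X)]"]) (simp_all add: diagram_simps)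
  also have "eqd [Xd, X] \<dots> [(1, d), (0, bd), (0, br Xd Xd), (1, br Xd X)]"
    by (rule rewrite[OF cocomm, where k = 2 and pre = "[(0, bd), (0, br Xd Xd)]"
        and post = "[(1, br Xd X)]"]) (simp_all add: diagram_simps)
  also have "eqd [Xd, X] \<dots> [(0, bd), (2, d), (1, br Xd X)]"
    by (rule rewrite[OF b_cocomm, where k = 0 and pre = "[]"
        and post = "[(2, d), (1, br Xd X)]"]) (simp_all add: diagram_simps)
  finally show ?thesis .
qed

section \<open>The double as a diagram and the four conditions\<close>

abbreviation DH where "DH \<equiv> drinfeld_double C H Xd ev"

abbreviation double_mult :: "('a, 'b) diagram" where
  "double_mult \<equiv> [(1, d), (3, bd), (2, br X Xd), (1, LA), (2, RA), (0, bm), (1, m)]"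
abbreviation double_comult :: "('a, 'b) diagram" where
  "double_comult \<equiv> [(0, bd), (2, d), (1, br Xd X)]"
text \<open>The crossings appear in the order in which the hexagons produce them when the right-hand
  factor \<open>Xd \<boxtimes> X\<close> is split first.\<close>

abbreviation double_br :: "('a, 'b) diagram" where
  "double_br \<equiv> [(1, br X Xd), (0, br Xd Xd), (2, br X X), (1, br Xd X)]"

lemma double_sem:
  "ob DH = Xd \<boxtimes> X" "mult DH = sem [Xd, X, Xd, X] double_mult"
  "comult DH = sem [Xd, X] double_comult"
  "Braid C (Xd \<boxtimes> X) (Xd \<boxtimes> X) = sem [Xd, X, Xd, X] double_br"
proof -
  show "ob DH = Xd \<boxtimes> X" "mult DH = sem [Xd, X, Xd, X] double_mult"
    "comult DH = sem [Xd, X] double_comult"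
    by (simp_all add: drinfeld_double_def Let_def B_def[symmetric] B_sem LA_sem RA_sem H_reify)
  show "Braid C (Xd \<boxtimes> X) (Xd \<boxtimes> X) = sem [Xd, X, Xd, X] double_br"
    by (simp add: Braid_tensor_left Braid_tensor_right ObTensor_Obj) (simp add: H_reify)
qed

lemma double_wf: "wf [Xd, X, Xd, X] double_mult" "out [Xd, X, Xd, X] double_mult = [Xd, X]"
  "wf [Xd, X] double_comult" "out [Xd, X] double_comult = [Xd, X, Xd, X]"
  "wf [Xd, X, Xd, X] double_br" "out [Xd, X, Xd, X] double_br = [Xd, X, Xd, X]"
  by (simp_all add: diagram_simps)

lemma double_Hom: "mult DH \<in> Hom C ((Xd \<boxtimes> X) \<boxtimes> (Xd \<boxtimes> X)) (Xd \<boxtimes> X)"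
  "comult DH \<in> Hom C (Xd \<boxtimes> X) ((Xd \<boxtimes> X) \<boxtimes> (Xd \<boxtimes> X))"
  using sem_Hom[OF double_wf(1), unfolded double_wf(2)] sem_Hom[OF double_wf(3), unfolded double_wf(4)]
  by (simp_all add: double_sem ObTensor_unit_right ObTensor_assoc ObTensor_Obj)

lemma double_inclusions:
  "sem [X] [(0, bu)] \<in> Hom C X (Xd \<boxtimes> X)" "sem [Xd] [(1, u)] \<in> Hom C Xd (Xd \<boxtimes> X)"
  "sem [Xd, X] [(0, be)] \<in> Hom C (Xd \<boxtimes> X) X" "sem [Xd, X] [(1, e)] \<in> Hom C (Xd \<boxtimes> X) Xd"
  using sem_Hom[of "[X]" "[(0, bu)]"] sem_Hom[of "[Xd]" "[(1, u)]"]
    sem_Hom[of "[Xd, X]" "[(0, be)]"] sem_Hom[of "[Xd, X]" "[(1, e)]"]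
  by (simp_all add: diagram_simps ObTensor_unit_right)

lemma retract_H: "eqd [X] [(0, bu), (0, be)] []"
    by (rule rewrite[OF b_counit_unit, where k = 0 and pre = "[]"
        and post = "[]"]) (simp_all add: diagram_simps)

lemma retract_B: "eqd [Xd] [(1, u), (1, e)] []"
    by (rule rewrite[OF counit_unit, where k = 1 and pre = "[]"
        and post = "[]"]) (simp_all add: diagram_simps)

lemma double_retractions:
  "sem [Xd, X] [(0, be)] \<cdot> sem [X] [(0, bu)] = Id C X"
  "sem [Xd, X] [(1, e)] \<cdot> sem [Xd] [(1, u)] = Id C Xd"
  using retract_H retract_B by (simp_all add: H_reify)

lemma double_commutative_imp:
  assumes "is_commutative C DH"
  shows "is_commutative C H" "is_commutative C B"
proof -
  have c: "mult DH \<cdot> Braid C (Xd \<boxtimes> X) (Xd \<boxtimes> X) = mult DH"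
    using assms by (simp add: is_commutative_def double_sem(1))
  have "mult DH \<cdot> sem [X] [(0, bu)] \<otimes> sem [X] [(0, bu)] = sem [X] [(0, bu)] \<cdot> mult H"
    using mult_double_H by (simp add: double_sem H_reify)
  from commutative_retract[OF _ double_Hom(1) double_inclusions(1,3) double_retractions(1) this c]
  show "is_commutative C H"
    using H_prebialgebra by (simp add: is_commutative_def is_prebialgebra_def)
  have "mult DH \<cdot> sem [Xd] [(1, u)] \<otimes> sem [Xd] [(1, u)] = sem [Xd] [(1, u)] \<cdot> mult B"
    using mult_double_B by (simp add: double_sem B_sem H_reify)
  from commutative_retract[OF _ double_Hom(1) double_inclusions(2,4) double_retractions(2) this c]
  show "is_commutative C B"
    using B_prebialgebra by (simp add: is_commutative_def is_prebialgebra_def)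
qed

lemma double_cocommutative_imp:
  assumes "is_cocommutative C DH"
  shows "is_cocommutative C H" "is_cocommutative C B"
proof -
  have c: "Braid C (Xd \<boxtimes> X) (Xd \<boxtimes> X) \<cdot> comult DH = comult DH"
    using assms by (simp add: is_cocommutative_def double_sem(1))
  have "comult DH \<cdot> sem [X] [(0, bu)] = sem [X] [(0, bu)] \<otimes> sem [X] [(0, bu)] \<cdot> comult H"
    using comult_double_H by (simp add: double_sem H_reify)
  from cocommutative_retract[OF _ double_Hom(2) double_inclusions(1,3) double_retractions(1) this c]
  show "is_cocommutative C H"
    using H_prebialgebra by (simp add: is_cocommutative_def is_prebialgebra_def)
  have "comult DH \<cdot> sem [Xd] [(1, u)] = sem [Xd] [(1, u)] \<otimes> sem [Xd] [(1, u)] \<cdot> comult B"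
    using comult_double_B by (simp add: double_sem B_sem H_reify)
  from cocommutative_retract[OF _ double_Hom(2) double_inclusions(2,4) double_retractions(2) this c]
  show "is_cocommutative C B"
    using B_prebialgebra by (simp add: is_cocommutative_def is_prebialgebra_def)
qed

lemma double_commutativeI:
  assumes "is_commutative C H" "is_cocommutative C H" "is_commutative C B"
  shows "is_commutative C DH"
proof -
  have "sem [Xd, X, Xd, X] (double_br @ double_mult) = sem [Xd, X, Xd, X] double_mult"
    using mult_double_comm assms
      is_commutative_eqd[OF H_prebialgebra] is_cocommutative_eqd[OF H_prebialgebra]
      is_commutative_eqd[OF B_prebialgebra] by (simp add: eqd_def)
  then show ?thesis
    using double_wf by (simp add: is_commutative_def double_sem comp_sem del: append_Cons)
qed

lemma double_cocommutativeI:
  assumes "is_cocommutative C H" "is_cocommutative C B"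
  shows "is_cocommutative C DH"
proof -
  have "sem [Xd, X] (double_comult @ double_br) = sem [Xd, X] double_comult"
    using comult_double_cocomm assms
      is_cocommutative_eqd[OF H_prebialgebra] is_cocommutative_eqd[OF B_prebialgebra]
    by (simp add: eqd_def)
  then show ?thesis
    using double_wf by (simp add: is_cocommutative_def double_sem comp_sem del: append_Cons)
qed

text \<open>One of the two crossings in the equation for the opposite is cancelled by its inverse.
  The lemma links cocommutativity of \<open>B\<close>, which is dual to commutativity of the
  opposite, to \<open>H\<close> itself.\<close>

lemma op_commutative_iff: "is_commutative C (op_bialg C H) \<longleftrightarrow> is_commutative C H"
proof -
  note b = Braid_Hom[OF X_Obj X_Obj] and i = Braid_inverse[OF X_Obj X_Obj]
  have m: "mult H \<in> Hom C (X \<boxtimes> X) X"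
    using H_prebialgebra by (simp add: is_prebialgebra_def)
  have "mult H \<cdot> Braid C X X = mult H"
    if "(mult H \<cdot> Braid C X X) \<cdot> Braid C X X = mult H \<cdot> Braid C X X"
  proof -
    have "((mult H \<cdot> Braid C X X) \<cdot> Braid C X X) \<cdot> inverse_of C (Braid C X X)
        = (mult H \<cdot> Braid C X X) \<cdot> inverse_of C (Braid C X X)"
      by (simp only: that)
    then show ?thesis
      using Comp_assoc[OF i(1) b m] Comp_assoc[OF i(1) b Comp_Hom[OF b m]] i(3)
        Id_right[OF m] Id_right[OF Comp_Hom[OF b m]] by simp
  qed
  then show ?thesis by (auto simp: is_commutative_def op_bialg_def)
qed

text \<open>Each of the four conditions says that \<open>H\<close> is both commutative and
  cocommutative: passing to \<open>L\<close> or to \<open>B\<close> exchanges these two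
  properties.\<close>

lemma double_equivalences:
  defines "L \<equiv> dual_bialg C H Xd ev"
  shows "(is_commutative C DH \<longleftrightarrow> is_commutative C H \<and> is_commutative C L)
    \<and> (is_commutative C H \<and> is_commutative C L \<longleftrightarrow> is_cocommutative C H \<and> is_cocommutative C L)
    \<and> (is_cocommutative C H \<and> is_cocommutative C L \<longleftrightarrow> is_cocommutative C DH)"
proof -
  have L: "is_commutative C L \<longleftrightarrow> is_cocommutative C H" "is_cocommutative C L \<longleftrightarrow> is_commutative C H"
    unfolding L_def using dual_commutative_iff[OF H_prebialgebra ob_H refl]
      dual_cocommutative_iff[OF H_prebialgebra ob_H refl] by auto
  have "is_cocommutative C (op_bialg C H) \<longleftrightarrow> is_cocommutative C H"
    by (simp add: is_cocommutative_def op_bialg_def)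
  then have B: "is_commutative C B \<longleftrightarrow> is_cocommutative C H"
    "is_cocommutative C B \<longleftrightarrow> is_commutative C H"
    using dual_commutative_iff[OF op_dual] dual_cocommutative_iff[OF op_dual] op_commutative_iff
    by auto
  show ?thesis
    using L B double_commutative_imp double_commutativeI double_cocommutative_imp
      double_cocommutativeI by blast
qed

end

theorem lemma4p7:
  fixes C :: "('o, 'm) braided_cat"
    and H :: "('o, 'm) hopf"
    and Hd :: 'o and ev :: 'm
  assumes "braided_monoidal_category C"
    and "is_hopf_algebra C H"
    and "is_iso C (antipode H)"
    and "finite_object C (ob H)"
    and "is_internal_hom C (ob H) (UnitOb C) Hd ev"
    and "braid_symmetric C (ob H) Hd"
  shows "(is_commutative C (drinfeld_double C H Hd ev)
           \<longleftrightarrow> is_commutative C H \<and> is_commutative C (dual_bialg C H Hd ev))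
       \<and> (is_commutative C H \<and> is_commutative C (dual_bialg C H Hd ev)
           \<longleftrightarrow> is_cocommutative C H \<and> is_cocommutative C (dual_bialg C H Hd ev))
       \<and> (is_cocommutative C H \<and> is_cocommutative C (dual_bialg C H Hd ev)
           \<longleftrightarrow> is_cocommutative C (drinfeld_double C H Hd ev))"
proof -
  have ob: "ob H \<in> Obj C"
    using assms(2) by (simp add: is_hopf_algebra_def is_bialgebra_def is_algebra_def)
  obtain CV where "finite_dual C (ob H) Hd (Node [Hd, ob H] [] ev) CV"
    using braided_monoidal_category.finite_dual_exists[OF assms(1) ob assms(4,5)] ..
  then have "hopf_double C (ob H) Hd (Node [Hd, ob H] [] ev) CV H"
    using assms(2,3,6) by (intro hopf_double.intro hopf_double_axioms.intro) simp_all
  from hopf_double.double_equivalences[OF this] show ?thesis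
    unfolding node.sel .
qed

end
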